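(* Let $N\ge2$, $0<\alpha<N$, and let $\Omega\subset\mathbb{R}^N$ be a bounded domain. Then $$\lambda_1(\Omega)\le\lambda_1(\Omega^* ).$$ Equality holds only if $\Omega\cong\Omega^*$ up to a translation (that is, some translate of $\Omega^*$ is almost equal to $\Omega$).
   Context: For a bounded open set $\Omega\subseteq\mathbb{R}^N$, $N\ge2$, and $0<\alpha<N$, the Riesz potential operator on $L^2(\Omega)$ is $\mathcal{R}u(x)=\int_\Omega\frac{u(y)}{|x-y|^{N-\alpha}}\,dy$; it is positive, self-adjoint and compact. Its largest eigenvalue is $\lambda_1(\Omega)=\sup\left\{\int_\Omega\int_\Omega\frac{u(x)u(y)}{|x-y|^{N-\alpha}}\,dx\,dy:\ u\in L^2(\Omega),\ \|u\|_{L^2(\Omega)}=1\right\}$. $\Omega^*$ is the open ball centred at the origin with the same Lebesgue measure as $\Omega$. For measurable sets $A,B$, $A\cong B$ ("almost equal") means $|A\triangle B|=0$, where $\triangle$ is the symmetric difference and $|\cdot|$ is Lebesgue measure. *)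

theory Defs
  imports "HOL-Analysis.Analysis"
begin

text \<open>Real-valued \<open>L\<^sup>2\<close> functions on \<open>\<Omega>\<close>, as functions rather than classes modulo null sets; all
  quantities below only depend on the class. Values outside \<open>\<Omega>\<close> are irrelevant.\<close>

definition L2_space :: "'a::euclidean_space set \<Rightarrow> ('a \<Rightarrow> real) set" where
  "L2_space \<Omega> = {u. u \<in> borel_measurable (lebesgue_on \<Omega>) \<and>
                     integrable (lebesgue_on \<Omega>) (\<lambda>x. (u x)\<^sup>2)}"

definition L2_norm_on :: "'a::euclidean_space set \<Rightarrow> ('a \<Rightarrow> real) \<Rightarrow> real" where
  "L2_norm_on \<Omega> u = sqrt (LINT x|lebesgue_on \<Omega>. (u x)\<^sup>2)"

text \<open>The kernel takes the value \<open>0\<close> on the diagonal, a null set.\<close>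

definition riesz_form :: "real \<Rightarrow> 'a::euclidean_space set \<Rightarrow> ('a \<Rightarrow> real) \<Rightarrow> real" where
  "riesz_form \<alpha> \<Omega> u =
     (LINT x|lebesgue_on \<Omega>. LINT y|lebesgue_on \<Omega>.
        u x * u y / norm (x - y) powr (real DIM('a) - \<alpha>))"

text \<open>The variational formula for the largest eigenvalue of the Riesz potential operator
  \<open>u \<mapsto> (\<lambda>x. \<integral>\<^sub>\<Omega> u y / |x - y|\<^bsup>N-\<alpha>\<^esup> dy)\<close> on \<open>L\<^sup>2(\<Omega>)\<close>. For nonempty bounded open \<open>\<Omega>\<close> and
  \<open>0 < \<alpha> < N\<close> the set is nonempty and bounded above, so that the supremum in the reals is the
  true one.\<close>

definition lambda1 :: "real \<Rightarrow> 'a::euclidean_space set \<Rightarrow> real" where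
  "lambda1 \<alpha> \<Omega> = Sup {riesz_form \<alpha> \<Omega> u | u. u \<in> L2_space \<Omega> \<and> L2_norm_on \<Omega> u = 1}"

definition symm_ball :: "'a::euclidean_space set \<Rightarrow> 'a set" where
  "symm_ball \<Omega> = ball 0 (THE r. 0 \<le> r \<and> emeasure lebesgue (ball (0::'a) r) = emeasure lebesgue \<Omega>)"

definition almost_equal :: "'a::euclidean_space set \<Rightarrow> 'a set \<Rightarrow> bool" where
  "almost_equal A B \<longleftrightarrow> sym_diff A B \<in> null_sets lebesgue"

end

theory Submission
  imports Defs
begin

text \<open>
  The eigenvalue is a supremum of the double integral of \<open>u x * u y * K (x - y)\<close> over normalized \<open>u\<close>.
  Since \<open>K\<close> is positive one may take \<open>u \<ge> 0\<close>, and since \<open>K\<close> is radially decreasing the double integral can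
  be increased by rearranging \<open>u\<close>. The rearrangement used throughout is polarization: fix a hyperplane and
  one of its sides, and at each pair of mirror points put the larger of the two values of \<open>u\<close> on that side.
  This preserves the \<open>L\<^sup>2\<close> norm, and it raises the energy because for two points on the same side the
  distance between them is at most the distance between one and the mirror image of the other
  (\<open>energy_polarize_gain\<close>). The support of \<open>u\<close> is polarized along with \<open>u\<close>, so the eigenvalue of a set is
  at most that of its polarization (\<open>riesz_top_polarize\<close>).

  For the inequality, a set \<open>A\<close> is moved to the centred ball \<open>B\<close> of the same measure by finitely many
  polarizations, up to a set of small measure. Each polarization towards a half-space containing the origin
  decreases the measure of \<open>A - B\<close> by at least half the measure of the part of \<open>A - B\<close> that is reflected into
  \<open>B - A\<close> (\<open>polarize_set_excess\<close>); averaging over all hyperplanes shows that some reflection achieves a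
  decrease which depends only on the measure of \<open>A - B\<close> and on a ball containing \<open>A\<close>
  (\<open>exists_reflection_overlap\<close>). As a set of small measure contributes little to the energy
  (\<open>riesz_top_excess\<close>), the inequality follows in the limit (\<open>riesz_top_le_ball\<close>).

  For the equality case, suppose that for some hyperplane neither half of \<open>\<Omega>\<close> is reflected into \<open>\<Omega>\<close>
  up to a null set. The gain of energy under polarization is then at least a constant times the product of
  the masses of \<open>u\<close> on two fixed sets of positive measure. Functions whose energy is close to the
  supremum carry a fixed amount of mass on every subset of \<open>\<Omega>\<close> of
  positive measure (\<open>near_maximizer_mass_on\<close>), a quantitative form of the positivity of the
  first eigenfunction that does not presuppose its existence. Hence the gain is bounded below along a maximizing
  sequence, and the polarized set, whose measure is that of \<open>\<Omega>\<close>, has a strictly larger eigenvalue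
  (\<open>riesz_top_polarize_less\<close>), still at most that of the ball. So equality forces, for every
  hyperplane, that one of the halves reflects into \<open>\<Omega>\<close>. If the centroid \<open>c\<close> of \<open>\<Omega>\<close> is off the
  hyperplane, this must be the half on the side away from \<open>c\<close>; reflecting \<open>y \<in> \<Omega>\<close> to any point \<open>x\<close> closer to \<open>c\<close>, one
  finds that a neighbourhood of \<open>x\<close> is almost contained in \<open>\<Omega>\<close>, so \<open>\<Omega>\<close> is almost a ball about \<open>c\<close>
  (\<open>ball_if_one_sided\<close>).

  All energies are handled as integrals of extended nonnegative functions against Borel Lebesgue measure, so
  that Tonelli's theorem applies without integrability conditions; only the last section translates to
  real-valued square-integrable functions.
\<close>

section \<open>Reflections in hyperplanes\<close>

text \<open>The reflection is parametrized by an arbitrary nonzero \<open>w\<close> instead of a unit normal: averaging over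
  hyperplanes then becomes integration of \<open>w\<close> over the whole space and of \<open>t\<close> over the line. The mirror is
  the hyperplane where the offset vanishes, and the offset is the multiple of \<open>w\<close> to subtract in order
  to reach the mirror image. For \<open>t \<ge> 0\<close> the origin lies in the half-space of nonpositive offset.\<close>

definition offset :: "'a::euclidean_space \<Rightarrow> real \<Rightarrow> 'a \<Rightarrow> real" where
  "offset w t x = 2 * (x \<bullet> w) / (w \<bullet> w) - t"

definition reflect :: "'a::euclidean_space \<Rightarrow> real \<Rightarrow> 'a \<Rightarrow> 'a" where
  "reflect w t x = x - offset w t x *\<^sub>R w"

lemma offset_inner: "2 * (x \<bullet> w) = (offset w t x + t) * (w \<bullet> w)"
  by (cases "w = 0") (auto simp: offset_def)

lemma offset_reflect: "w \<noteq> 0 \<Longrightarrow> offset w t (reflect w t x) = - offset w t x"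
  by (simp add: offset_def reflect_def inner_diff_left field_simps)

lemma reflect_reflect [simp]: "w \<noteq> 0 \<Longrightarrow> reflect w t (reflect w t x) = x"
  by (subst reflect_def) (simp add: offset_reflect, simp add: reflect_def)

text \<open>Both monotonicity properties of polarization rest on this identity: passing to the mirror image of one
  of two points lengthens their distance exactly when the points lie on the same side of the mirror.\<close>

lemma dist_reflect_sq:
  "(norm (x - reflect w t y))\<^sup>2 = (norm (x - y))\<^sup>2 + offset w t x * offset w t y * (norm w)\<^sup>2"
proof -
  have e: "x - reflect w t y = (x - y) + offset w t y *\<^sub>R w" by (simp add: reflect_def)
  have "(norm (x - reflect w t y))\<^sup>2 =
     (norm (x - y))\<^sup>2 + offset w t y * (2 * ((x - y) \<bullet> w)) + (offset w t y)\<^sup>2 * (w \<bullet> w)"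
    unfolding e power2_norm_eq_inner by (simp add: algebra_simps power2_eq_square inner_commute)
  also have "2 * ((x - y) \<bullet> w) = (offset w t x - offset w t y) * (w \<bullet> w)"
    using offset_inner[of x w t] offset_inner[of y w t] by (simp add: algebra_simps)
  finally show ?thesis
    by (simp add: algebra_simps power2_eq_square[of "offset w t y"] flip: power2_norm_eq_inner)
qed

lemma norm_reflect_sq:
  "(norm (reflect w t x))\<^sup>2 = (norm x)\<^sup>2 - offset w t x * t * (norm w)\<^sup>2"
  using dist_reflect_sq[of 0 w t x] by (simp add: offset_def[of w t 0])

lemma dist_reflect_reflect:
  assumes "w \<noteq> 0" shows "norm (reflect w t x - reflect w t y) = norm (x - y)"
proof -
  have "(norm (reflect w t x - reflect w t y))\<^sup>2 = (norm (x - y))\<^sup>2"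
    using dist_reflect_sq[of "reflect w t x" w t y] dist_reflect_sq[of y w t x] offset_reflect[OF assms, of t x]
    by (simp add: norm_minus_commute algebra_simps)
  then show ?thesis by simp
qed

lemma dist_reflect_swap:
  assumes "w \<noteq> 0" shows "norm (reflect w t x - y) = norm (x - reflect w t y)"
  using dist_reflect_reflect[OF assms, of t x "reflect w t y"] assms by simp

lemma measurable_offset [measurable]: "offset w t \<in> borel_measurable borel"
  unfolding offset_def by measurable

lemma measurable_reflect [measurable]: "reflect w t \<in> borel_measurable borel"
  unfolding reflect_def by measurable

lemma nn_integral_lborel_shift:
  fixes h :: "'a::euclidean_space \<Rightarrow> ennreal"
  assumes [measurable]: "h \<in> borel_measurable borel"
  shows "(\<integral>\<^sup>+x. h (y + x) \<partial>lborel) = (\<integral>\<^sup>+x. h x \<partial>lborel)"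
  by (subst lborel_distr_plus[symmetric, where c=y], subst nn_integral_distr) auto

text \<open>Reflections preserve Lebesgue measure. The argument is the one for uniqueness of Haar measure: convolve
  with the indicator \<open>g\<close> of the unit ball and use translation invariance and Tonelli's theorem; the linear part
  \<open>T\<close> of the reflection disappears because the integral of \<open>g (y - T x)\<close> in \<open>x\<close> is the volume of a unit ball, \<open>T\<close> being an
  isometric involution.\<close>

lemma nn_integral_reflect:
  fixes f :: "'a::euclidean_space \<Rightarrow> ennreal"
  assumes [measurable]: "f \<in> borel_measurable borel" and w: "w \<noteq> 0"
  shows "(\<integral>\<^sup>+x. f (reflect w t x) \<partial>lborel) = (\<integral>\<^sup>+x. f x \<partial>lborel)"
proof -
  define T where "T x = x - (2 * (x \<bullet> w) / (w \<bullet> w)) *\<^sub>R w" for x :: 'a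
  have R: "reflect w t x = t *\<^sub>R w + T x" for x
    by (simp add: reflect_def offset_def T_def algebra_simps)
  have TT: "T (T x) = x" for x
    using w by (simp add: T_def inner_diff_left field_simps)
  have Tadd: "T (x + y) = T x + T y" for x y
    by (simp add: T_def inner_add_left algebra_simps add_divide_distrib)
  have Tiso: "norm (T x - T y) = norm (x - y)" for x y
    using dist_reflect_reflect[OF w, of t x y] by (simp add: R)
  have [measurable]: "T \<in> borel_measurable borel" unfolding T_def by measurable
  define g where "g = (indicator (ball (0::'a) 1) :: 'a \<Rightarrow> ennreal)"
  have [measurable]: "g \<in> borel_measurable borel" unfolding g_def by (intro borel_measurable_indicator) simp
  define c where "c = (\<integral>\<^sup>+x. g x \<partial>(lborel::'a measure))"
  have c: "c = emeasure lborel (ball (0::'a) 1)" unfolding c_def g_def by simp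
  have gT: "(\<integral>\<^sup>+x. g (y - T x) \<partial>lborel) = c" for y
  proof -
    have "g (y - T x) = indicator (ball (T y) 1) x" for x
      using Tiso[of "T y" x]
      by (simp add: g_def TT dist_norm indicator_def norm_minus_commute[of y "T x"])
    then have "(\<integral>\<^sup>+x. g (y - T x) \<partial>lborel) = emeasure lborel (ball (T y) 1)" by simp
    also have "\<dots> = c" unfolding c by (simp add: emeasure_ball)
    finally show ?thesis .
  qed
  have "c * (\<integral>\<^sup>+x. f (T x) \<partial>lborel) = (\<integral>\<^sup>+y. g y * (\<integral>\<^sup>+x. f (T x) \<partial>lborel) \<partial>lborel)"
    unfolding c_def by (simp add: nn_integral_multc)
  also have "\<dots> = (\<integral>\<^sup>+y. g y * (\<integral>\<^sup>+x. f (y + T x) \<partial>lborel) \<partial>lborel)"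
  proof (rule nn_integral_cong)
    fix y
    have "(\<integral>\<^sup>+x. f (T (T y + x)) \<partial>lborel) = (\<integral>\<^sup>+x. f (T x) \<partial>lborel)"
      by (rule nn_integral_lborel_shift[where h = "\<lambda>x. f (T x)"]) measurable
    then show "g y * (\<integral>\<^sup>+x. f (T x) \<partial>lborel) = g y * (\<integral>\<^sup>+x. f (y + T x) \<partial>lborel)"
      by (simp add: Tadd TT)
  qed
  also have "\<dots> = (\<integral>\<^sup>+y. (\<integral>\<^sup>+x. g y * f (y + T x) \<partial>lborel) \<partial>lborel)"
    by (simp add: nn_integral_cmult)
  also have "\<dots> = (\<integral>\<^sup>+x. (\<integral>\<^sup>+y. g y * f (y + T x) \<partial>lborel) \<partial>lborel)"
    by (rule lborel_pair.Fubini') measurable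
  also have "\<dots> = (\<integral>\<^sup>+x. (\<integral>\<^sup>+y. g (y - T x) * f y \<partial>lborel) \<partial>lborel)"
  proof (rule nn_integral_cong)
    fix x
    have "(\<integral>\<^sup>+y. g (- T x + y) * f ((- T x + y) + T x) \<partial>lborel) = (\<integral>\<^sup>+y. g y * f (y + T x) \<partial>lborel)"
      by (rule nn_integral_lborel_shift[where h = "\<lambda>y. g y * f (y + T x)"]) measurable
    then show "(\<integral>\<^sup>+y. g y * f (y + T x) \<partial>lborel) = (\<integral>\<^sup>+y. g (y - T x) * f y \<partial>lborel)"
      by simp
  qed
  also have "\<dots> = (\<integral>\<^sup>+y. (\<integral>\<^sup>+x. g (y - T x) * f y \<partial>lborel) \<partial>lborel)"
    by (rule lborel_pair.Fubini') measurable
  also have "\<dots> = c * (\<integral>\<^sup>+y. f y \<partial>lborel)"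
    by (simp add: nn_integral_multc gT nn_integral_cmult)
  finally have "c * (\<integral>\<^sup>+x. f (T x) \<partial>lborel) = c * (\<integral>\<^sup>+y. f y \<partial>lborel)" .
  moreover have "unit_ball_vol (real DIM('a)) \<noteq> 0"
    using unit_ball_vol_pos[of "real DIM('a)"] by linarith
  then have "c \<noteq> 0" "c \<noteq> \<infinity>" unfolding c by (auto simp: emeasure_ball)
  ultimately have "(\<integral>\<^sup>+x. f (T x) \<partial>lborel) = (\<integral>\<^sup>+y. f y \<partial>lborel)"
    by (metis ennreal_mult_cancel_left infinity_ennreal_def)
  moreover have "(\<integral>\<^sup>+x. f (reflect w t x) \<partial>lborel) = (\<integral>\<^sup>+x. f (T x) \<partial>lborel)"
  proof -
    have "(\<integral>\<^sup>+x. f (t *\<^sub>R w + T x) \<partial>lborel) = (\<integral>\<^sup>+x. f (T (T (t *\<^sub>R w) + x)) \<partial>lborel)"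
      by (simp add: Tadd TT)
    also have "\<dots> = (\<integral>\<^sup>+x. f (T x) \<partial>lborel)"
      by (rule nn_integral_lborel_shift[where h = "\<lambda>x. f (T x)"]) measurable
    finally show ?thesis by (simp add: R)
  qed
  ultimately show ?thesis by simp
qed

section \<open>The Riesz kernel and its potentials\<close>

text \<open>The kernel \<open>1 / |z|\<^bsup>\<beta>\<^esup>\<close> with \<open>\<beta> = N - \<alpha>\<close>. Its value at the origin is \<open>\<infinity>\<close>, so that it decreases
  with \<open>norm z\<close> on the whole space.\<close>

definition riesz_kernel :: "real \<Rightarrow> 'a::euclidean_space \<Rightarrow> ennreal" where
  "riesz_kernel \<beta> z = inverse (ennreal (norm z powr \<beta>))"

lemma measurable_riesz_kernel [measurable]: "riesz_kernel \<beta> \<in> borel_measurable borel"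
  unfolding riesz_kernel_def by measurable

lemma riesz_kernel_cong: "norm x = norm y \<Longrightarrow> riesz_kernel \<beta> x = riesz_kernel \<beta> y"
  by (simp add: riesz_kernel_def)

lemma riesz_kernel_minus_commute: "riesz_kernel \<beta> (x - y) = riesz_kernel \<beta> (y - x)"
  by (rule riesz_kernel_cong) (rule norm_minus_commute)

lemma riesz_kernel_eq: "z \<noteq> 0 \<Longrightarrow> riesz_kernel \<beta> z = ennreal (norm z powr - \<beta>)"
  by (simp add: riesz_kernel_def inverse_ennreal powr_minus)

lemma riesz_kernel_le:
  assumes "0 \<le> \<beta>" "0 < r" "r \<le> norm z"
  shows "riesz_kernel \<beta> z \<le> ennreal (r powr - \<beta>)"
proof -
  have "norm z powr - \<beta> \<le> r powr - \<beta>" using assms by (intro powr_mono2') auto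
  then show ?thesis using assms by (subst riesz_kernel_eq) (auto intro!: ennreal_leI)
qed

lemma riesz_kernel_ge:
  assumes "0 \<le> \<beta>" "0 < r" "norm z \<le> r"
  shows "ennreal (r powr - \<beta>) \<le> riesz_kernel \<beta> z"
proof (cases "z = 0")
  case True then show ?thesis by (simp add: riesz_kernel_def)
next
  case False
  then have "r powr - \<beta> \<le> norm z powr - \<beta>" using assms by (intro powr_mono2') auto
  then show ?thesis using False by (subst riesz_kernel_eq) (auto intro!: ennreal_leI)
qed

lemma riesz_kernel_antimono:
  assumes "0 \<le> \<beta>" "norm x \<le> norm y"
  shows "riesz_kernel \<beta> y \<le> riesz_kernel \<beta> x"
proof (cases "x = 0")
  case False
  then show ?thesis using assms riesz_kernel_le[of \<beta> "norm x" y] by (simp add: riesz_kernel_eq)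
qed (simp add: riesz_kernel_def)

text \<open>The kernel is integrable near the origin because \<open>\<beta> < N\<close>: on the dyadic annulus of outer radius
  \<open>s\<close> it is at most a constant times \<open>s powr - \<beta>\<close>, the annulus has volume at most a constant times \<open>s\<^sup>N\<close>, and the
  resulting geometric series has ratio \<open>(1/2) powr (N - \<beta>) < 1\<close>.\<close>

lemma riesz_kernel_ball_bound:
  fixes \<beta> :: real
  assumes "0 < \<beta>" "\<beta> < real DIM('a::euclidean_space)"
  obtains C where "0 < C"
    "\<And>r. 0 < r \<Longrightarrow> (\<integral>\<^sup>+z. riesz_kernel \<beta> z * indicator (ball (0::'a) r) z \<partial>lborel)
        \<le> ennreal (C * r powr (DIM('a) - \<beta>))"
proof -
  define a where "a = real DIM('a) - \<beta>"
  have a: "0 < a" using assms by (simp add: a_def)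
  define V where "V = unit_ball_vol (real DIM('a))"
  have V: "0 < V" unfolding V_def by (rule unit_ball_vol_pos) simp
  define q where "q = (1/2::real) powr a"
  have q: "0 < q" "q < 1" unfolding q_def using a powr_less_mono'[of "1/2" 0 a] by auto
  define C where "C = V * 2 powr \<beta> * (1 / (1 - q))"
  show thesis
  proof (rule that[of C])
    show "0 < C" using V q by (simp add: C_def)
    fix r :: real assume r: "0 < r"
    define s where "s k = r * (1/2) ^ k" for k :: nat
    have s: "0 < s k" "s (Suc k) = s k / 2" for k using r by (simp_all add: s_def)
    have [measurable]: "ball (0::'a) \<rho> \<in> sets borel" for \<rho> by simp
    have m: "(\<lambda>z. ennreal c * indicator (ball (0::'a) \<rho>) z) \<in> borel_measurable lborel" for c \<rho> :: real
      by measurable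
    have sl: "s \<longlonglongrightarrow> 0" unfolding s_def
      by (intro tendsto_mult_right_zero LIMSEQ_power_zero) auto
    have "(\<integral>\<^sup>+z. riesz_kernel \<beta> z * indicator (ball (0::'a) r) z \<partial>lborel)
       \<le> (\<integral>\<^sup>+z. (\<Sum>k. ennreal (s (Suc k) powr - \<beta>) * indicator (ball (0::'a) (s k)) z) \<partial>lborel)"
    proof (rule nn_integral_mono_AE, rule AE_mp[OF AE_lborel_singleton[of 0]], intro AE_I2 impI)
      fix z :: 'a assume z: "z \<noteq> 0"
      show "riesz_kernel \<beta> z * indicator (ball (0::'a) r) z
          \<le> (\<Sum>k. ennreal (s (Suc k) powr - \<beta>) * indicator (ball (0::'a) (s k)) z)"
      proof (cases "norm z < r")
        case True
        have "\<exists>k. s k \<le> norm z"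
          using order_tendstoD(2)[OF sl, of "norm z"] z
          by (auto simp: eventually_sequentially intro: less_imp_le)
        define k where "k = (LEAST k. s k \<le> norm z)"
        have k: "s k \<le> norm z" unfolding k_def using \<open>\<exists>k. s k \<le> norm z\<close> by (rule LeastI_ex)
        have "k \<noteq> 0" using k True by (intro notI) (simp add: s_def)
        then obtain j where j: "k = Suc j" by (cases k) auto
        have "\<not> s j \<le> norm z" using not_less_Least[of j "\<lambda>k. s k \<le> norm z"] j by (simp add: k_def)
        then have "ennreal (s (Suc j) powr - \<beta>) * indicator (ball (0::'a) (s j)) z = ennreal (s (Suc j) powr - \<beta>)"
          by simp
        moreover have "riesz_kernel \<beta> z \<le> ennreal (s (Suc j) powr - \<beta>)"
          using k s[of "Suc j"] assms unfolding j by (intro riesz_kernel_le) auto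
        moreover have "ennreal (s (Suc j) powr - \<beta>) * indicator (ball (0::'a) (s j)) z
            \<le> (\<Sum>k. ennreal (s (Suc k) powr - \<beta>) * indicator (ball (0::'a) (s k)) z)"
        proof -
          have "f j \<le> (\<Sum>k. f k)" for f :: "nat \<Rightarrow> ennreal"
            using sum_le_suminf[of f "{j}"] by simp
          then show ?thesis .
        qed
        ultimately show ?thesis using True by simp
      qed simp
    qed
    also have "\<dots> = (\<Sum>k. ennreal (s (Suc k) powr - \<beta>) * emeasure lborel (ball (0::'a) (s k)))"
    proof -
      have "(\<integral>\<^sup>+z. (\<Sum>k. ennreal (s (Suc k) powr - \<beta>) * indicator (ball (0::'a) (s k)) z) \<partial>lborel)
         = (\<Sum>k. (\<integral>\<^sup>+z. ennreal (s (Suc k) powr - \<beta>) * indicator (ball (0::'a) (s k)) z \<partial>lborel))"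
        by (intro nn_integral_suminf m)
      also have "\<dots> = (\<Sum>k. ennreal (s (Suc k) powr - \<beta>) * emeasure lborel (ball (0::'a) (s k)))"
        by (intro suminf_cong nn_integral_cmult_indicator) (simp only: sets_lborel borel_open open_ball)
      finally show ?thesis .
    qed
    also have "\<dots> = (\<Sum>k. ennreal (V * 2 powr \<beta> * r powr a * q ^ k))"
    proof (intro suminf_cong)
      fix k
      have "s (Suc k) powr - \<beta> = 2 powr \<beta> * s k powr - \<beta>"
        using s(1)[of k] by (simp add: s(2) powr_divide powr_minus inverse_eq_divide)
      moreover have "s k ^ DIM('a) = s k powr DIM('a)" using s(1)[of k] by (simp add: powr_realpow)
      moreover have "s k powr a = r powr a * q ^ k"
      proof -
        have "((1/2::real) ^ k) powr a = q ^ k"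
          by (induction k) (simp_all add: powr_divide q_def)
        then show ?thesis using r by (simp add: s_def powr_mult)
      qed
      moreover have "s k powr - \<beta> * s k powr DIM('a) = s k powr a"
        by (simp add: a_def powr_add[symmetric])
      moreover have emb: "emeasure lborel (ball (0::'a) (s k)) = ennreal (V * s k ^ DIM('a))"
        using s(1)[of k] by (simp add: emeasure_ball V_def)
      ultimately have "s (Suc k) powr - \<beta> * (V * s k ^ DIM('a)) = V * 2 powr \<beta> * r powr a * q ^ k"
        by (simp add: algebra_simps)
      then show "ennreal (s (Suc k) powr - \<beta>) * emeasure lborel (ball (0::'a) (s k)) = ennreal (V * 2 powr \<beta> * r powr a * q ^ k)"
        unfolding emb by (simp only: ennreal_mult'[symmetric] powr_ge_zero)
    qed
    also have "\<dots> = ennreal (C * r powr a)"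
    proof (rule suminf_ennreal_eq)
      show "0 \<le> V * 2 powr \<beta> * r powr a * q ^ k" for k using V q by simp
      show "(\<lambda>k. V * 2 powr \<beta> * r powr a * q ^ k) sums (C * r powr a)"
        using sums_mult[OF geometric_sums[of q], of "V * 2 powr \<beta> * r powr a"] q
        by (simp add: C_def mult_ac)
    qed
    finally show "(\<integral>\<^sup>+z. riesz_kernel \<beta> z * indicator (ball (0::'a) r) z \<partial>lborel)
        \<le> ennreal (C * r powr (DIM('a) - \<beta>))" by (simp add: a_def)
  qed
qed

text \<open>Splitting \<open>D\<close> at distance \<open>r\<close> from \<open>x\<close> bounds the potential of \<open>D\<close> by its measure, uniformly in \<open>x\<close>. A fixed
  \<open>r\<close> gives boundedness of the potential, a small \<open>r\<close> gives smallness for sets of small measure.\<close>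

lemma riesz_potential_bound:
  fixes \<beta> :: real
  assumes "0 < \<beta>" "\<beta> < real DIM('a::euclidean_space)"
  obtains C where "0 < C"
    "\<And>(D::'a set) x r. D \<in> sets borel \<Longrightarrow> 0 < r \<Longrightarrow>
        (\<integral>\<^sup>+y. riesz_kernel \<beta> (x - y) * indicator D y \<partial>lborel)
          \<le> ennreal (C * r powr (DIM('a) - \<beta>)) + ennreal (r powr - \<beta>) * emeasure lborel D"
proof -
  obtain C where C: "0 < C"
    "\<And>r. 0 < r \<Longrightarrow> (\<integral>\<^sup>+z. riesz_kernel \<beta> z * indicator (ball (0::'a) r) z \<partial>lborel)
        \<le> ennreal (C * r powr (DIM('a) - \<beta>))"
    using riesz_kernel_ball_bound[OF assms(1,2)] by metis
  show thesis
  proof (rule that[OF C(1)])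
    fix D :: "'a set" and x :: 'a and r :: real
    assume [measurable]: "D \<in> sets borel" and r: "0 < r"
    have [measurable]: "ball (0::'a) r \<in> sets borel" by simp
    have "(\<integral>\<^sup>+y. riesz_kernel \<beta> (x - y) * indicator D y \<partial>lborel)
      \<le> (\<integral>\<^sup>+y. riesz_kernel \<beta> (- x + y) * indicator (ball 0 r) (- x + y) + ennreal (r powr - \<beta>) * indicator D y \<partial>lborel)"
    proof (rule nn_integral_mono)
      fix y
      show "riesz_kernel \<beta> (x - y) * indicator D y
        \<le> riesz_kernel \<beta> (- x + y) * indicator (ball 0 r) (- x + y) + ennreal (r powr - \<beta>) * indicator D y"
        using riesz_kernel_le[of \<beta> r "x - y"] assms r
        by (cases "norm (x - y) < r")
          (auto simp: riesz_kernel_minus_commute[of _ y x] norm_minus_commute indicator_def)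
    qed
    also have "\<dots> = (\<integral>\<^sup>+y. riesz_kernel \<beta> (- x + y) * indicator (ball 0 r) (- x + y) \<partial>lborel) + ennreal (r powr - \<beta>) * emeasure lborel D"
      by (subst nn_integral_add) (auto simp: nn_integral_cmult_indicator)
    also have "(\<integral>\<^sup>+y. riesz_kernel \<beta> (- x + y) * indicator (ball 0 r) (- x + y) \<partial>lborel) 
        = (\<integral>\<^sup>+y. riesz_kernel \<beta> y * indicator (ball (0::'a) r) y \<partial>lborel)"
      by (rule nn_integral_lborel_shift[where h = "\<lambda>y. riesz_kernel \<beta> y * indicator (ball 0 r) y"]) auto
    also have "\<dots> + ennreal (r powr - \<beta>) * emeasure lborel D
        \<le> ennreal (C * r powr (DIM('a) - \<beta>)) + ennreal (r powr - \<beta>) * emeasure lborel D"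
      using C(2)[OF r] by (intro add_right_mono)
    finally show "(\<integral>\<^sup>+y. riesz_kernel \<beta> (x - y) * indicator D y \<partial>lborel)
       \<le> ennreal (C * r powr (DIM('a) - \<beta>)) + ennreal (r powr - \<beta>) * emeasure lborel D" .
  qed
qed

lemma riesz_potential_bounded:
  fixes \<beta> :: real
  assumes "0 < \<beta>" "\<beta> < real DIM('a::euclidean_space)" "0 \<le> m"
  obtains S where "0 < S"
    "\<And>(D::'a set) x. D \<in> sets borel \<Longrightarrow> emeasure lborel D \<le> ennreal m \<Longrightarrow>
        (\<integral>\<^sup>+y. riesz_kernel \<beta> (x - y) * indicator D y \<partial>lborel) \<le> ennreal S"
proof -
  obtain C where C: "0 < C" "\<And>(D::'a set) x r. D \<in> sets borel \<Longrightarrow> 0 < r \<Longrightarrow>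
        (\<integral>\<^sup>+y. riesz_kernel \<beta> (x - y) * indicator D y \<partial>lborel)
          \<le> ennreal (C * r powr (DIM('a) - \<beta>)) + ennreal (r powr - \<beta>) * emeasure lborel D"
    using riesz_potential_bound[OF assms(1,2)] by metis
  show thesis
  proof (rule that[of "C + m"])
    show "0 < C + m" using C assms by simp
    fix D :: "'a set" and x :: 'a
    assume "D \<in> sets borel" and D: "emeasure lborel D \<le> ennreal m"
    then have "(\<integral>\<^sup>+y. riesz_kernel \<beta> (x - y) * indicator D y \<partial>lborel) \<le> ennreal C + emeasure lborel D"
      using C(2)[of D 1 x] by simp
    also have "\<dots> \<le> ennreal C + ennreal m" using D by (rule add_left_mono)
    also have "\<dots> = ennreal (C + m)" using C assms by simp
    finally show "(\<integral>\<^sup>+y. riesz_kernel \<beta> (x - y) * indicator D y \<partial>lborel) \<le> ennreal (C + m)" .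
  qed
qed

lemma riesz_potential_small:
  fixes \<beta> e :: real
  assumes "0 < \<beta>" "\<beta> < real DIM('a::euclidean_space)" "0 < e"
  obtains d where "0 < d"
    "\<And>(D::'a set) x. D \<in> sets borel \<Longrightarrow> emeasure lborel D \<le> ennreal d \<Longrightarrow>
        (\<integral>\<^sup>+y. riesz_kernel \<beta> (x - y) * indicator D y \<partial>lborel) \<le> ennreal e"
proof -
  obtain C where C: "0 < C" "\<And>(D::'a set) x r. D \<in> sets borel \<Longrightarrow> 0 < r \<Longrightarrow>
        (\<integral>\<^sup>+y. riesz_kernel \<beta> (x - y) * indicator D y \<partial>lborel)
          \<le> ennreal (C * r powr (DIM('a) - \<beta>)) + ennreal (r powr - \<beta>) * emeasure lborel D"
    using riesz_potential_bound[OF assms(1,2)] by metis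
  define a where "a = real DIM('a) - \<beta>"
  have a: "0 < a" using assms by (simp add: a_def)
  \<comment> \<open>this radius makes the near part \<open>e / 2\<close>, and \<open>d\<close> then makes the far part at most \<open>e / 2\<close>\<close>
  define r where "r = (e / (2 * C)) powr (1/a)"
  have r: "0 < r" using assms C by (simp add: r_def)
  have Cr: "C * r powr a = e / 2" using a assms C by (simp add: r_def powr_powr)
  define d where "d = e / (2 * r powr - \<beta>)"
  have d: "0 < d" "r powr - \<beta> * d = e / 2" using r assms by (auto simp: d_def)
  show thesis
  proof (rule that[OF d(1)])
    fix D :: "'a set" and x :: 'a
    assume "D \<in> sets borel" and D: "emeasure lborel D \<le> ennreal d"
    then have "(\<integral>\<^sup>+y. riesz_kernel \<beta> (x - y) * indicator D y \<partial>lborel)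
       \<le> ennreal (e / 2) + ennreal (r powr - \<beta>) * emeasure lborel D"
      using C(2)[of D r x] r unfolding Cr[unfolded a_def] by simp
    also have "\<dots> \<le> ennreal (e / 2) + ennreal (r powr - \<beta>) * ennreal d"
      using D by (intro add_left_mono mult_left_mono) auto
    also have "\<dots> = ennreal e" using d assms by (simp flip: ennreal_plus ennreal_mult)
    finally show "(\<integral>\<^sup>+y. riesz_kernel \<beta> (x - y) * indicator D y \<partial>lborel) \<le> ennreal e" .
  qed
qed

section \<open>Polarization raises the energy\<close>

text \<open>Bilinear rather than quadratic, since energies of sums have to be expanded.\<close>

definition energy :: "real \<Rightarrow> ('a::euclidean_space \<Rightarrow> ennreal) \<Rightarrow> ('a \<Rightarrow> ennreal) \<Rightarrow> ennreal" where
  "energy \<beta> u v = (\<integral>\<^sup>+x. (\<integral>\<^sup>+y. u x * v y * riesz_kernel \<beta> (x - y) \<partial>lborel) \<partial>lborel)"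

text \<open>Also known as two-point rearrangement. On the mirror both branches agree.\<close>

definition polarize :: "'a::euclidean_space \<Rightarrow> real \<Rightarrow> ('a \<Rightarrow> ennreal) \<Rightarrow> 'a \<Rightarrow> ennreal" where
  "polarize w t u x = (if offset w t x \<le> 0 then max (u x) (u (reflect w t x))
                       else min (u x) (u (reflect w t x)))"

text \<open>The set whose indicator function is the polarized indicator function of \<open>A\<close>.\<close>

definition polarize_set :: "'a::euclidean_space \<Rightarrow> real \<Rightarrow> 'a set \<Rightarrow> 'a set" where
  "polarize_set w t A = {x. if offset w t x \<le> 0 then x \<in> A \<or> reflect w t x \<in> A
                            else x \<in> A \<and> reflect w t x \<in> A}"

lemma measurable_polarize [measurable]:
  assumes [measurable]: "u \<in> borel_measurable borel"
  shows "polarize w t u \<in> borel_measurable borel"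
  unfolding polarize_def by measurable

lemma polarize_indicator: "polarize w t (indicator A) = indicator (polarize_set w t A)"
  by (auto simp: polarize_def polarize_set_def indicator_def fun_eq_iff)

lemma sets_polarize_set [measurable]:
  assumes [measurable]: "A \<in> sets borel"
  shows "polarize_set w t A \<in> sets borel"
  unfolding polarize_set_def by measurable

lemma reflect_fixed: "offset w t x = 0 \<Longrightarrow> reflect w t x = x"
  by (simp add: reflect_def)

lemma polarize_nonpos:
  assumes "w \<noteq> 0" "offset w t x \<le> 0"
  shows "polarize w t u x = max (u x) (u (reflect w t x))"
        "polarize w t u (reflect w t x) = min (u x) (u (reflect w t x))"
  using assms reflect_fixed[of w t x]
  by (auto simp: polarize_def offset_reflect min.commute dest: antisym)

lemma polarize_nonneg:
  assumes "w \<noteq> 0" "0 \<le> offset w t x"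
  shows "polarize w t u x = min (u x) (u (reflect w t x))"
        "polarize w t u (reflect w t x) = max (u x) (u (reflect w t x))"
  using assms reflect_fixed[of w t x]
  by (auto simp: polarize_def offset_reflect max.commute dest: antisym)

lemma nn_integral_reflect_sum:
  fixes f :: "'a::euclidean_space \<Rightarrow> ennreal"
  assumes [measurable]: "f \<in> borel_measurable borel" and w: "w \<noteq> 0"
  shows "(\<integral>\<^sup>+x. f x + f (reflect w t x) \<partial>lborel) = 2 * (\<integral>\<^sup>+x. f x \<partial>lborel)"
  using nn_integral_reflect[OF assms, of t] by (simp add: nn_integral_add mult_2)

lemma ennreal_cancel_numeral:
  "numeral k * (a::ennreal) = numeral k * b \<longleftrightarrow> a = b"
  "numeral k * (a::ennreal) \<le> numeral k * b \<longleftrightarrow> a \<le> b"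
  by (auto simp: ennreal_mult_cancel_left ennreal_mult_le_mult_iff)

text \<open>At a pair of mirror points polarization only permutes the two values, so \<open>u\<close> and its polarization are
  equimeasurable.\<close>

lemma nn_integral_polarize:
  assumes [measurable]: "u \<in> borel_measurable borel" "\<phi> \<in> borel_measurable borel" and w: "w \<noteq> 0"
  shows "(\<integral>\<^sup>+x. \<phi> (polarize w t u x) \<partial>lborel) = (\<integral>\<^sup>+x. \<phi> (u x) \<partial>lborel)"
proof -
  have "\<phi> (polarize w t u x) + \<phi> (polarize w t u (reflect w t x)) = \<phi> (u x) + \<phi> (u (reflect w t x))" for x
    using polarize_nonpos[OF w, of t x u] polarize_nonneg[OF w, of t x u]
    by (cases "offset w t x \<le> 0"; cases "u x \<le> u (reflect w t x)") (auto simp: max_def min_def add.commute)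
  then have "2 * (\<integral>\<^sup>+x. \<phi> (polarize w t u x) \<partial>lborel) = 2 * (\<integral>\<^sup>+x. \<phi> (u x) \<partial>lborel)"
    using nn_integral_reflect_sum[OF _ w, of "\<lambda>x. \<phi> (polarize w t u x)" t] 
      nn_integral_reflect_sum[OF _ w, of "\<lambda>x. \<phi> (u x)" t] by simp
  then show ?thesis by (simp add: ennreal_cancel_numeral)
qed

lemma emeasure_polarize_set:
  assumes [measurable]: "A \<in> sets borel" and w: "w \<noteq> 0"
  shows "emeasure lborel (polarize_set w t A) = emeasure lborel A"
proof -
  have "(\<integral>\<^sup>+x. polarize w t (indicator A) x \<partial>lborel) = (\<integral>\<^sup>+x. indicator A x \<partial>lborel)"
    by (rule nn_integral_polarize[OF _ _ w]) measurable
  then show ?thesis unfolding polarize_indicator by (simp only: nn_integral_indicator sets_lborel sets_polarize_set assms)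
qed

text \<open>The rearrangement inequality for two pairs, in the form in which it holds in \<open>[0, \<infinity>]\<close>, where
  differences are not available.\<close>

lemma two_point_rearrangement_prod:
  fixes a a' b b' :: ennreal
  shows "a * b + a' * b' \<le> max a a' * max b b' + min a a' * min b b'"
proof -
  have *: "p * r + q * s \<le> p * s + q * r" if qp: "q \<le> p" and rs: "r \<le> s" for p q r s :: ennreal
  proof -
    obtain c where c: "p = q + c" using qp unfolding le_iff_add by blast
    obtain d where d: "s = r + d" using rs unfolding le_iff_add by blast
    have "p * s + q * r = (p * r + q * s) + c * d" unfolding c d by (simp add: algebra_simps)
    then show ?thesis by simp
  qed
  show ?thesis
    using *[of a a' b b'] *[of a' a b' b] *[of a a' b' b] *[of a' a b b']
    by (cases "a \<le> a'"; cases "b \<le> b'") (auto simp: max_def min_def add.commute)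
qed

text \<open>Writing \<open>k = k' + d\<close>, the \<open>k'\<close>-part of the sum depends only on \<open>a + a'\<close> and \<open>b + b'\<close>, which sorting does
  not change, and the \<open>d\<close>-part is controlled by the previous inequality.\<close>

lemma two_point_rearrangement:
  fixes a a' b b' k k' :: ennreal
  assumes "k' \<le> k"
  shows "a * b * k + a * b' * k' + a' * b * k' + a' * b' * k
    \<le> max a a' * max b b' * k + max a a' * min b b' * k' + min a a' * max b b' * k' + min a a' * min b b' * k"
proof -
  obtain d where d: "k = k' + d" using assms unfolding le_iff_add by blast
  have s: "max p q + min p q = p + q" for p q :: ennreal by (auto simp: max_def min_def add.commute)
  have e: "p * q * k + p * q' * k' + p' * q * k' + p' * q' * k = (p + p') * (q + q') * k' + (p * q + p' * q') * d"
    for p p' q q' by (simp add: d algebra_simps)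
  show ?thesis
    unfolding e s by (intro add_left_mono mult_right_mono two_point_rearrangement_prod) auto
qed

text \<open>Averaging over the four combinations of reflecting or keeping each variable turns a comparison of double
  integrals into a pointwise comparison for quadruples of points.\<close>

lemma nn_integral_reflect_sum4:
  fixes g :: "'a::euclidean_space \<Rightarrow> 'a \<Rightarrow> ennreal"
  assumes [measurable]: "(\<lambda>(x, y). g x y) \<in> borel_measurable (borel \<Otimes>\<^sub>M borel)" and w: "w \<noteq> 0"
  shows "(\<integral>\<^sup>+x. (\<integral>\<^sup>+y. g x y + g x (reflect w t y) + g (reflect w t x) y + g (reflect w t x) (reflect w t y) \<partial>lborel) \<partial>lborel)
       = 4 * (\<integral>\<^sup>+x. (\<integral>\<^sup>+y. g x y \<partial>lborel) \<partial>lborel)"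
proof -
  let ?G = "\<lambda>x. (\<integral>\<^sup>+y. g x y \<partial>lborel)"
  have y: "(\<integral>\<^sup>+y. g x (reflect w t y) \<partial>lborel) = ?G x" for x
    by (rule nn_integral_reflect[OF _ w]) measurable
  have "(\<integral>\<^sup>+y. g x y + g x (reflect w t y) + g (reflect w t x) y + g (reflect w t x) (reflect w t y) \<partial>lborel)
     = 2 * (?G x + ?G (reflect w t x))" for x
    by (simp add: nn_integral_add y algebra_simps mult_2)
  then have "(\<integral>\<^sup>+x. (\<integral>\<^sup>+y. g x y + g x (reflect w t y) + g (reflect w t x) y + g (reflect w t x) (reflect w t y) \<partial>lborel) \<partial>lborel)
     = 2 * (\<integral>\<^sup>+x. ?G x + ?G (reflect w t x) \<partial>lborel)" 
    by (simp only:) (rule nn_integral_cmult, measurable)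
  also have "\<dots> = 4 * (\<integral>\<^sup>+x. ?G x \<partial>lborel)"
    by (subst nn_integral_reflect_sum[OF _ w]) (auto simp: mult.assoc[symmetric])
  finally show ?thesis .
qed

text \<open>For a quadruple \<open>x\<close>, \<open>y\<close> and mirror images only two kernel values occur, one for points on the same side
  and a smaller one for points on opposite sides, so the rearrangement inequality applies. The gain recorded
  here comes from the pairs \<open>x \<in> S\<close>, \<open>y \<in> T\<close> at which \<open>u\<close> vanishes at the mirror image of \<open>x\<close> and at \<open>y\<close>:
  polarization moves the value at the image of \<open>y\<close> to \<open>y\<close>, onto the side of \<open>x\<close>, and the kernel increases by
  at least \<open>\<kappa>\<close>. The factor 4 stems from symmetrizing in both variables.\<close>

lemma energy_polarize_gain:
  fixes u :: "'a::euclidean_space \<Rightarrow> ennreal" and \<kappa> :: ennreal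
  assumes [measurable]: "u \<in> borel_measurable borel" "S \<in> sets borel" "T \<in> sets borel"
    and \<beta>: "0 \<le> \<beta>" and w: "w \<noteq> 0"
    and S: "\<And>x. x \<in> S \<Longrightarrow> offset w t x \<le> 0 \<and> u (reflect w t x) = 0"
    and T: "\<And>y. y \<in> T \<Longrightarrow> offset w t y \<le> 0 \<and> u y = 0"
    and gap: "\<And>x y. x \<in> S \<Longrightarrow> y \<in> T \<Longrightarrow>
        riesz_kernel \<beta> (x - reflect w t y) + \<kappa> \<le> riesz_kernel \<beta> (x - y)"
  shows "4 * energy \<beta> u u + \<kappa> * (\<integral>\<^sup>+x. u x * indicator S x \<partial>lborel) * (\<integral>\<^sup>+y. u (reflect w t y) * indicator T y \<partial>lborel)
    \<le> 4 * energy \<beta> (polarize w t u) (polarize w t u)"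
proof -
  define g where "g v x y = v x * v y * riesz_kernel \<beta> (x - y)" for v :: "'a \<Rightarrow> ennreal" and x y
  let ?s = "reflect w t" and ?U = "polarize w t u"
  let ?h = "\<lambda>v x y. g v x y + g v x (?s y) + g v (?s x) y + g v (?s x) (?s y)"
  have mg [measurable]: "(\<lambda>(x, y). g v x y) \<in> borel_measurable (borel \<Otimes>\<^sub>M borel)"
    if [measurable]: "v \<in> borel_measurable borel" for v unfolding g_def by measurable
  have [measurable]: "(\<lambda>x. g v (p x) (q x)) \<in> borel_measurable M"
    if [measurable]: "v \<in> borel_measurable borel" "p \<in> borel_measurable M" "q \<in> borel_measurable M" 
    for v p q and M :: "'b measure" unfolding g_def by measurable
  have point: "?h u x y + \<kappa> * (u x * indicator S x) * (u (?s y) * indicator T y) \<le> ?h ?U x y" for x y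
  proof -
    define k k' where "k = riesz_kernel \<beta> (x - y)" and "k' = riesz_kernel \<beta> (x - ?s y)"
    have ks: "riesz_kernel \<beta> (?s x - y) = k'" "riesz_kernel \<beta> (?s x - ?s y) = k"
      unfolding k_def k'_def
      by (rule riesz_kernel_cong[OF dist_reflect_swap[OF w]], rule riesz_kernel_cong[OF dist_reflect_reflect[OF w]])
    have hx: "?h v x y = v x * v y * k + v x * v (?s y) * k' + v (?s x) * v y * k' + v (?s x) * v (?s y) * k" for v
      by (simp add: g_def ks k_def[symmetric] k'_def[symmetric])
    have kk: "k' \<le> k" if "0 \<le> offset w t x * offset w t y"
    proof -
      have "(norm (x - y))\<^sup>2 \<le> (norm (x - ?s y))\<^sup>2"
        using that by (simp add: dist_reflect_sq)
      then have "norm (x - y) \<le> norm (x - ?s y)" by (simp add: power2_le_iff_abs_le)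
      then show ?thesis unfolding k_def k'_def by (rule riesz_kernel_antimono[OF \<beta>])
    qed
    have kk': "k \<le> k'" if "offset w t x * offset w t y \<le> 0"
    proof -
      have "(norm (x - ?s y))\<^sup>2 \<le> (norm (x - y))\<^sup>2"
        using that by (simp add: dist_reflect_sq mult_nonpos_nonneg)
      then have "norm (x - ?s y) \<le> norm (x - y)" by (simp add: power2_le_iff_abs_le)
      then show ?thesis unfolding k_def k'_def by (rule riesz_kernel_antimono[OF \<beta>])
    qed
    note R = two_point_rearrangement
    show ?thesis
    proof (cases "x \<in> S \<and> y \<in> T")
      case True
      then have "k' + \<kappa> \<le> k" using gap by (simp add: k_def k'_def)
      then have "u x * u (?s y) * k' + \<kappa> * u x * u (?s y) \<le> u x * u (?s y) * k"
        using mult_left_mono[of "k' + \<kappa>" k "u x * u (?s y)"] by (simp add: algebra_simps)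
      then show ?thesis unfolding hx using True S[of x] T[of y]
        by (simp add: polarize_nonpos[OF w] mult_ac)
    next
      case False
      then have z: "\<kappa> * (u x * indicator S x) * (u (?s y) * indicator T y) = 0" by auto
      consider "offset w t x \<le> 0" "offset w t y \<le> 0" | "offset w t x \<le> 0" "0 \<le> offset w t y"
        | "0 \<le> offset w t x" "offset w t y \<le> 0" | "0 \<le> offset w t x" "0 \<le> offset w t y" by linarith
      then show ?thesis
      proof cases
        case 1
        then show ?thesis unfolding hx z
          using R[OF kk, of "u x" "u y" "u (?s y)" "u (?s x)"]
          by (simp add: polarize_nonpos[OF w] mult_nonpos_nonpos)
      next
        case 2
        then show ?thesis unfolding hx z
          using R[OF kk', of "u x" "u (?s y)" "u y" "u (?s x)"]
          by (simp add: polarize_nonpos[OF w] polarize_nonneg[OF w] mult_nonpos_nonneg add_ac max.commute min.commute)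
      next
        case 3
        then show ?thesis unfolding hx z
          using R[OF kk', of "u (?s x)" "u y" "u (?s y)" "u x"]
          by (simp add: polarize_nonpos[OF w] polarize_nonneg[OF w] mult_nonneg_nonpos add_ac max.commute min.commute)
      next
        case 4
        then show ?thesis unfolding hx z
          using R[OF kk, of "u (?s x)" "u (?s y)" "u y" "u x"]
          by (simp add: polarize_nonneg[OF w] add_ac max.commute min.commute)
      qed
    qed
  qed
  have E: "4 * energy \<beta> v v = (\<integral>\<^sup>+x. (\<integral>\<^sup>+y. ?h v x y \<partial>lborel) \<partial>lborel)" if [measurable]: "v \<in> borel_measurable borel" for v
    unfolding energy_def g_def[symmetric]
    by (rule nn_integral_reflect_sum4[OF _ w, symmetric]) measurable
  have "4 * energy \<beta> u u + \<kappa> * (\<integral>\<^sup>+x. u x * indicator S x \<partial>lborel) * (\<integral>\<^sup>+y. u (?s y) * indicator T y \<partial>lborel)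
     = (\<integral>\<^sup>+x. (\<integral>\<^sup>+y. ?h u x y + \<kappa> * (u x * indicator S x) * (u (?s y) * indicator T y) \<partial>lborel) \<partial>lborel)"
    by (simp add: E nn_integral_add nn_integral_cmult nn_integral_multc)
  also have "\<dots> \<le> (\<integral>\<^sup>+x. (\<integral>\<^sup>+y. ?h ?U x y \<partial>lborel) \<partial>lborel)"
    by (intro nn_integral_mono point)
  also have "\<dots> = 4 * energy \<beta> ?U ?U" by (rule E[symmetric]) measurable
  finally show ?thesis .
qed

lemma energy_polarize:
  fixes u :: "'a::euclidean_space \<Rightarrow> ennreal"
  assumes "u \<in> borel_measurable borel" "0 \<le> \<beta>" "w \<noteq> 0"
  shows "energy \<beta> u u \<le> energy \<beta> (polarize w t u) (polarize w t u)"
proof -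
  have "4 * energy \<beta> u u \<le> 4 * energy \<beta> (polarize w t u) (polarize w t u)"
    using energy_polarize_gain[OF assms(1) _ _ assms(2,3), of "{}" "{}" t 0] by simp
  then show ?thesis by (simp only: ennreal_cancel_numeral)
qed

section \<open>Polarization moves sets towards a centred ball\<close>

text \<open>Since \<open>0 \<le> t\<close>, points of nonpositive offset are at least as close to the origin as their mirror
  images, so polarizing replaces each point of \<open>A\<close> outside the ball whose mirror image lies in the ball but not in \<open>A\<close>
  by that image, and does not push anything out of the ball.\<close>

lemma polarize_set_excess:
  assumes [measurable]: "A \<in> sets borel" and w: "w \<noteq> 0" and t: "0 \<le> t"
  shows "2 * emeasure lborel (polarize_set w t A - ball 0 r)
       + emeasure lborel {x \<in> A - ball 0 r. reflect w t x \<in> ball 0 r - A}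
       \<le> 2 * emeasure lborel (A - ball (0::'a::euclidean_space) r)"
proof -
  let ?s = "reflect w t" and ?B = "ball (0::'a) r" and ?P = "polarize_set w t A"
  let ?X = "{x \<in> A - ?B. ?s x \<in> ?B - A}"
  have [measurable]: "?B \<in> sets borel" by simp
  have [measurable]: "?X \<in> sets borel" by measurable
  have point: "indicator (?P - ?B) x + indicator (?P - ?B) (?s x) + indicator ?X x
      \<le> indicator (A - ?B) x + (indicator (A - ?B) (?s x) :: ennreal)" for x
  proof -
    have n: "(norm (?s x))\<^sup>2 = (norm x)\<^sup>2 - offset w t x * t * (norm w)\<^sup>2" by (rule norm_reflect_sq)
    have P: "?s x \<in> ?P \<longleftrightarrow> (if 0 \<le> offset w t x then ?s x \<in> A \<or> x \<in> A else ?s x \<in> A \<and> x \<in> A)"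
      using w by (simp add: polarize_set_def offset_reflect)
    have Q: "x \<in> ?P \<longleftrightarrow> (if offset w t x \<le> 0 then x \<in> A \<or> ?s x \<in> A else x \<in> A \<and> ?s x \<in> A)"
      by (simp add: polarize_set_def)
    show ?thesis
    proof (cases "offset w t x = 0")
      case True
      then show ?thesis using reflect_fixed[OF True] by (auto simp: polarize_set_def indicator_def)
    next
      case nz: False
      show ?thesis
      proof (cases "offset w t x < 0")
        case True
        have "0 \<le> - offset w t x * t * (norm w)\<^sup>2" using True t by (intro mult_nonneg_nonneg) auto
        then have "(norm x)\<^sup>2 \<le> (norm (?s x))\<^sup>2" using n by linarith
        then have "norm x \<le> norm (?s x)" by (rule power2_le_imp_le) simp
        then have "?s x \<in> ?B \<Longrightarrow> x \<in> ?B" by simp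
        then show ?thesis using True
          by (cases "x \<in> A"; cases "?s x \<in> A"; cases "x \<in> ?B"; cases "?s x \<in> ?B")
            (simp_all add: indicator_def P Q del: mem_ball mem_ball_0)
      next
        case False
        then have "0 \<le> offset w t x * t * (norm w)\<^sup>2" using t by (intro mult_nonneg_nonneg) auto
        then have "(norm (?s x))\<^sup>2 \<le> (norm x)\<^sup>2" using n by linarith
        then have "norm (?s x) \<le> norm x" by (rule power2_le_imp_le) simp
        then have "x \<in> ?B \<Longrightarrow> ?s x \<in> ?B" by simp
        then show ?thesis using False nz
          by (cases "x \<in> A"; cases "?s x \<in> A"; cases "x \<in> ?B"; cases "?s x \<in> ?B")
            (simp_all add: indicator_def P Q del: mem_ball mem_ball_0)
      qed
    qed
  qed
  have S: "(\<integral>\<^sup>+x. indicator Y x + indicator Y (?s x) \<partial>lborel) = 2 * emeasure lborel Y" 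
    if [measurable]: "Y \<in> sets borel" for Y :: "'a set"
  proof -
    have "(\<integral>\<^sup>+x. indicator Y x + indicator Y (?s x) \<partial>lborel) = 2 * (\<integral>\<^sup>+x. indicator Y x \<partial>lborel)"
      by (rule nn_integral_reflect_sum[OF _ w]) measurable
    then show ?thesis by simp
  qed
  have "2 * emeasure lborel (?P - ?B) + emeasure lborel ?X
     = (\<integral>\<^sup>+x. (indicator (?P - ?B) x + indicator (?P - ?B) (?s x)) + indicator ?X x \<partial>lborel)"
    by (subst nn_integral_add, measurable, subst S) auto
  also have "\<dots> \<le> (\<integral>\<^sup>+x. indicator (A - ?B) x + indicator (A - ?B) (?s x) \<partial>lborel)"
    by (intro nn_integral_mono point)
  also have "\<dots> = 2 * emeasure lborel (A - ?B)" by (rule S) measurable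
  finally show ?thesis .
qed

lemma nn_integral_lborel_scale:
  fixes h :: "'a::euclidean_space \<Rightarrow> ennreal"
  assumes [measurable]: "h \<in> borel_measurable borel" and s: "0 < s"
  shows "(\<integral>\<^sup>+y. h y \<partial>lborel) = ennreal (s ^ DIM('a)) * (\<integral>\<^sup>+v. h (x - s *\<^sub>R v) \<partial>lborel)"
proof -
  have "(\<integral>\<^sup>+y. h y \<partial>lborel) = (\<integral>\<^sup>+y. h y \<partial>density (distr lborel borel (\<lambda>v. x + (-s) *\<^sub>R v)) (\<lambda>_. \<bar>-s\<bar> ^ DIM('a)))"
    by (subst lborel_affine[of "-s" x]) (use s in auto)
  also have "\<dots> = ennreal (s ^ DIM('a)) * (\<integral>\<^sup>+v. h (x - s *\<^sub>R v) \<partial>lborel)"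
    using s by (simp add: nn_integral_density nn_integral_distr nn_integral_cmult)
  finally show ?thesis .
qed

text \<open>The proof averages over hyperplanes. The product of the measures of \<open>D\<close> and \<open>E\<close> counts pairs
  \<open>(x, y)\<close>; write \<open>y = x - s w\<close> with \<open>s \<in> [1, 2]\<close> and integrate over \<open>s\<close> and \<open>w\<close>. For fixed \<open>w\<close> the
  substitution \<open>s = offset w t x\<close>, which is a translation in \<open>t\<close>, turns \<open>y\<close> into the mirror image of \<open>x\<close>, so that the
  inner integral collects the overlaps of the mirror image of \<open>D\<close> with \<open>E\<close> for all \<open>t\<close>. If all overlaps were smaller than \<open>\<eta>\<close>,
  the total would be too small. Short vectors \<open>w\<close>, for which the range of \<open>t\<close> is long, are discarded: they
  contribute little because they fill a ball of small volume.\<close>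

lemma exists_reflection_overlap:
  fixes \<epsilon> R :: real
  assumes \<epsilon>: "0 < \<epsilon>" and R: "0 < R"
  obtains \<eta> where "0 < \<eta>"
    "\<And>D E :: 'a::euclidean_space set. D \<in> sets borel \<Longrightarrow> E \<in> sets borel \<Longrightarrow>
       D \<subseteq> ball 0 R \<Longrightarrow> E \<subseteq> ball 0 R \<Longrightarrow>
       ennreal \<epsilon> \<le> emeasure lborel D \<Longrightarrow> ennreal \<epsilon> \<le> emeasure lborel E \<Longrightarrow>
       \<exists>w t. w \<noteq> 0 \<and> ennreal \<eta> \<le> emeasure lborel {x \<in> D. reflect w t x \<in> E}"
proof -
  define n where "n = DIM('a)"
  have n: "0 < n" by (simp add: n_def)
  define v where "v = unit_ball_vol (real n)"
  have v: "0 < v" unfolding v_def by (rule unit_ball_vol_pos) simp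
  have ball: "emeasure lborel (ball (0::'a) \<rho>) = ennreal (v * \<rho> ^ n)" if "0 < \<rho>" for \<rho>
    using that by (simp add: emeasure_ball v_def n_def)
  define V where "V = v * R ^ n"
  have V: "0 < V" using v R by (simp add: V_def)
  \<comment> \<open>vectors \<open>w\<close> shorter than \<open>\<kappa>\<close> will contribute at most \<open>\<epsilon>\<^sup>2 / 4\<close>\<close>
  define \<kappa> where "\<kappa> = min 1 (\<epsilon>\<^sup>2 / (4 * 2 ^ n * V * v))"
  have \<kappa>: "0 < \<kappa>" "\<kappa> \<le> 1" using v V \<epsilon> by (auto simp: \<kappa>_def)
  have \<kappa>1: "2 ^ n * (V * (v * \<kappa> ^ n)) \<le> \<epsilon>\<^sup>2 / 4"
  proof -
    have "\<kappa> ^ n \<le> \<kappa> ^ 1" using n \<kappa> by (intro power_decreasing) auto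
    also have "\<kappa> ^ 1 \<le> \<epsilon>\<^sup>2 / (4 * 2 ^ n * V * v)" by (simp add: \<kappa>_def)
    finally show ?thesis using v V by (simp add: field_simps)
  qed
  \<comment> \<open>for longer \<open>w\<close>, all \<open>t\<close> with \<open>offset w t x \<in> {1..2}\<close> for some \<open>x\<close> in the ball lie in \<open>{-(L/2)..L/2}\<close>\<close>
  define L where "L = 4 + 4 * R / \<kappa>"
  have L: "0 < L" using R \<kappa> by (simp add: L_def add_pos_pos)
  define W where "W = v * (2 * R) ^ n"
  have W: "0 < W" using v R by (simp add: W_def)
  \<comment> \<open>overlaps at most \<open>\<eta>\<close> make these \<open>w\<close> contribute at most \<open>\<epsilon>\<^sup>2 / 4\<close>\<close>
  define \<eta> where "\<eta> = \<epsilon>\<^sup>2 / (4 * 2 ^ n * W * L)"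
  have \<eta>: "0 < \<eta>" using \<epsilon> W L by (simp add: \<eta>_def)
  have \<eta>1: "2 ^ n * (W * (L * \<eta>)) = \<epsilon>\<^sup>2 / 4" using W L by (simp add: \<eta>_def)
  show thesis
  proof (rule that[OF \<eta>])
    fix D E :: "'a set"
    assume [measurable]: "D \<in> sets borel" "E \<in> sets borel" and DR: "D \<subseteq> ball 0 R" and ER: "E \<subseteq> ball 0 R"
      and De: "ennreal \<epsilon> \<le> emeasure lborel D" and Ee: "ennreal \<epsilon> \<le> emeasure lborel E"
    show "\<exists>w t. w \<noteq> 0 \<and> ennreal \<eta> \<le> emeasure lborel {x \<in> D. reflect w t x \<in> E}"
    proof (rule ccontr)
      assume "\<not> ?thesis"
      then have small: "emeasure lborel {x \<in> D. reflect w t x \<in> E} \<le> ennreal \<eta>" if "w \<noteq> 0" for w t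
        using that by (meson linear)
      let ?I = "indicator {1..2::real} :: real \<Rightarrow> ennreal"
      let ?D = "indicator D :: 'a \<Rightarrow> ennreal" and ?E = "indicator E :: 'a \<Rightarrow> ennreal"
      let ?B = "\<lambda>\<rho>. indicator (ball (0::'a) \<rho>) :: 'a \<Rightarrow> ennreal"
      have [measurable]: "ball (0::'a) \<rho> \<in> sets borel" for \<rho> by simp
      define \<Phi> where "\<Phi> w = (\<integral>\<^sup>+x. (\<integral>\<^sup>+s. ?I s * ?D x * ?E (x - s *\<^sub>R w) \<partial>lborel) \<partial>lborel)" for w
      have DV: "emeasure lborel D \<le> ennreal V"
        using emeasure_mono[OF DR, of lborel] ball[OF R] by (simp add: V_def)
      have \<Phi>V: "\<Phi> w \<le> ennreal V" for w
      proof -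
        have "\<Phi> w \<le> (\<integral>\<^sup>+x. (\<integral>\<^sup>+s. ?I s * ?D x \<partial>lborel) \<partial>lborel)"
          unfolding \<Phi>_def by (intro nn_integral_mono) (auto simp: indicator_def)
        also have "\<dots> = emeasure lborel D" by (simp add: nn_integral_multc)
        finally show ?thesis using DV by simp
      qed
      have \<Phi>\<eta>: "\<Phi> w \<le> ennreal (L * \<eta>)" if w: "\<kappa> \<le> norm w" for w
      proof -
        have w0: "w \<noteq> 0" using w \<kappa> by auto
        have "\<Phi> w = (\<integral>\<^sup>+x. (\<integral>\<^sup>+t. ?I (offset w t x) * ?D x * ?E (reflect w t x) \<partial>lborel) \<partial>lborel)"
          unfolding \<Phi>_def
        proof (rule nn_integral_cong)
          fix x
          have "(\<integral>\<^sup>+s. ?I s * ?D x * ?E (x - s *\<^sub>R w) \<partial>lborel) =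
             \<bar>-1::real\<bar> * (\<integral>\<^sup>+t. ?I (2 * (x \<bullet> w) / (w \<bullet> w) + (-1) * t) * ?D x * ?E (x - (2 * (x \<bullet> w) / (w \<bullet> w) + (-1) * t) *\<^sub>R w) \<partial>lborel)"
            by (rule nn_integral_real_affine) auto
          then show "(\<integral>\<^sup>+s. ?I s * ?D x * ?E (x - s *\<^sub>R w) \<partial>lborel) =
              (\<integral>\<^sup>+t. ?I (offset w t x) * ?D x * ?E (reflect w t x) \<partial>lborel)"
            by (simp add: reflect_def offset_def)
        qed
        also have "\<dots> \<le> (\<integral>\<^sup>+x. (\<integral>\<^sup>+t. indicator {-(L/2)..L/2} t * (?D x * ?E (reflect w t x)) \<partial>lborel) \<partial>lborel)"
        proof (intro nn_integral_mono)
          fix x :: 'a and t :: real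
          have tL: "\<bar>t\<bar> \<le> L / 2" if "x \<in> D" "1 \<le> offset w t x" "offset w t x \<le> 2"
          proof -
            have "\<bar>x \<bullet> w\<bar> \<le> norm x * norm w" by (rule Cauchy_Schwarz_ineq2)
            also have "\<dots> \<le> R * norm w" using that(1) DR by (intro mult_right_mono) auto
            finally have "\<bar>2 * (x \<bullet> w) / (w \<bullet> w)\<bar> \<le> 2 * (R * norm w) / (w \<bullet> w)"
              by (simp add: abs_mult divide_right_mono)
            also have "\<dots> = 2 * R / norm w" using w0 by (simp add: power2_norm_eq_inner[symmetric] power2_eq_square)
            also have "\<dots> \<le> 2 * R / \<kappa>" using w \<kappa> R w0 by (intro divide_left_mono mult_pos_pos) auto
            also have "\<dots> = L / 2 - 2" using \<kappa> by (simp add: L_def field_simps)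
            finally have "\<bar>2 * (x \<bullet> w) / (w \<bullet> w)\<bar> \<le> L / 2 - 2" .
            then show ?thesis using that(2,3) unfolding offset_def by linarith
          qed
          show "?I (offset w t x) * ?D x * ?E (reflect w t x) \<le> indicator {-(L/2)..L/2} t * (?D x * ?E (reflect w t x))"
          proof (cases "x \<in> D \<and> 1 \<le> offset w t x \<and> offset w t x \<le> 2")
            case True
            then have "\<bar>t\<bar> \<le> L / 2" using tL by blast
            then have "t \<in> {-(L/2)..L/2}" unfolding abs_le_iff atLeastAtMost_iff by linarith
            then have i1: "indicator {-(L/2)..L/2} t = (1::ennreal)" by (rule indicator_simps(1))
            have i2: "?I (offset w t x) = 1" using True by (intro indicator_simps(1)) (simp only: atLeastAtMost_iff)
            show ?thesis unfolding i1 i2 by (simp only: mult_1 order_refl)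
          next
            case False
            then have "?I (offset w t x) = 0 \<or> ?D x = 0"
              unfolding indicator_eq_0_iff atLeastAtMost_iff by blast
            then have i: "?I (offset w t x) * ?D x = 0" by (simp only: mult_eq_0_iff)
            show ?thesis unfolding i by simp
          qed
        qed
        also have "\<dots> = (\<integral>\<^sup>+t. (\<integral>\<^sup>+x. indicator {-(L/2)..L/2} t * (?D x * ?E (reflect w t x)) \<partial>lborel) \<partial>lborel)"
          by (rule lborel_pair.Fubini') (unfold reflect_def offset_def, measurable)
        also have "\<dots> \<le> (\<integral>\<^sup>+t. ennreal \<eta> * indicator {-(L/2)..L/2} t \<partial>lborel)"
        proof (rule nn_integral_mono)
          fix t :: real
          have "(\<integral>\<^sup>+x. ?D x * ?E (reflect w t x) \<partial>lborel) = (\<integral>\<^sup>+x. indicator {x \<in> D. reflect w t x \<in> E} x \<partial>lborel)"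
            by (intro nn_integral_cong) (auto simp: indicator_def)
          also have "\<dots> = emeasure lborel {x \<in> D. reflect w t x \<in> E}" by (rule nn_integral_indicator) measurable
          also have "\<dots> \<le> ennreal \<eta>" by (rule small[OF w0])
          finally show "(\<integral>\<^sup>+x. indicator {-(L/2)..L/2} t * (?D x * ?E (reflect w t x)) \<partial>lborel) \<le> ennreal \<eta> * indicator {-(L/2)..L/2} t"
            by (auto simp: indicator_def)
        qed
        also have "\<dots> = ennreal \<eta> * ennreal L" using L by (subst nn_integral_cmult_indicator) auto
        finally show ?thesis using \<eta> L by (simp add: ennreal_mult mult.commute)
      qed
      have swap: "(\<integral>\<^sup>+s. (\<integral>\<^sup>+x. (\<integral>\<^sup>+w. ?B (2*R) w * (?I s * ?D x * ?E (x - s *\<^sub>R w)) \<partial>lborel) \<partial>lborel) \<partial>lborel)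
         = (\<integral>\<^sup>+w. ?B (2*R) w * \<Phi> w \<partial>lborel)"
      proof -
        have "(\<integral>\<^sup>+s. (\<integral>\<^sup>+x. (\<integral>\<^sup>+w. ?B (2*R) w * (?I s * ?D x * ?E (x - s *\<^sub>R w)) \<partial>lborel) \<partial>lborel) \<partial>lborel)
           = (\<integral>\<^sup>+s. (\<integral>\<^sup>+w. (\<integral>\<^sup>+x. ?B (2*R) w * (?I s * ?D x * ?E (x - s *\<^sub>R w)) \<partial>lborel) \<partial>lborel) \<partial>lborel)"
          by (rule nn_integral_cong, rule lborel_pair.Fubini') measurable
        also have "\<dots> = (\<integral>\<^sup>+w. (\<integral>\<^sup>+s. (\<integral>\<^sup>+x. ?B (2*R) w * (?I s * ?D x * ?E (x - s *\<^sub>R w)) \<partial>lborel) \<partial>lborel) \<partial>lborel)"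
          by (rule lborel_pair.Fubini') measurable
        also have "\<dots> = (\<integral>\<^sup>+w. (\<integral>\<^sup>+x. (\<integral>\<^sup>+s. ?B (2*R) w * (?I s * ?D x * ?E (x - s *\<^sub>R w)) \<partial>lborel) \<partial>lborel) \<partial>lborel)"
          by (rule nn_integral_cong, rule lborel_pair.Fubini') measurable
        also have "\<dots> = (\<integral>\<^sup>+w. ?B (2*R) w * \<Phi> w \<partial>lborel)"
          unfolding \<Phi>_def by (simp add: nn_integral_cmult)
        finally show ?thesis .
      qed
      have "emeasure lborel D * emeasure lborel E = (\<integral>\<^sup>+s. ?I s * (emeasure lborel D * emeasure lborel E) \<partial>lborel)"
        by (simp add: nn_integral_multc)
      also have "\<dots> \<le> (\<integral>\<^sup>+s. 2 ^ n * (\<integral>\<^sup>+x. (\<integral>\<^sup>+w. ?B (2*R) w * (?I s * ?D x * ?E (x - s *\<^sub>R w)) \<partial>lborel) \<partial>lborel) \<partial>lborel)"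
      proof (rule nn_integral_mono)
        fix s :: real
        show "?I s * (emeasure lborel D * emeasure lborel E) \<le> 2 ^ n * (\<integral>\<^sup>+x. (\<integral>\<^sup>+w. ?B (2*R) w * (?I s * ?D x * ?E (x - s *\<^sub>R w)) \<partial>lborel) \<partial>lborel)"
        proof (cases "s \<in> {1..2}")
          case True
          then have s: "0 < s" "1 \<le> s" "s \<le> 2" by auto
          have "emeasure lborel D * emeasure lborel E = (\<integral>\<^sup>+x. ?D x * (\<integral>\<^sup>+y. ?E y \<partial>lborel) \<partial>lborel)"
            by (simp add: nn_integral_multc)
          also have "\<dots> = (\<integral>\<^sup>+x. ?D x * (ennreal (s ^ n) * (\<integral>\<^sup>+w. ?E (x - s *\<^sub>R w) \<partial>lborel)) \<partial>lborel)"
            unfolding n_def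
            by (rule nn_integral_cong) (subst nn_integral_lborel_scale[OF _ s(1)], auto)
          also have "\<dots> \<le> (\<integral>\<^sup>+x. 2 ^ n * (\<integral>\<^sup>+w. ?B (2*R) w * (?I s * ?D x * ?E (x - s *\<^sub>R w)) \<partial>lborel) \<partial>lborel)"
          proof (rule nn_integral_mono)
            fix x
            have p: "?D x * ?E (x - s *\<^sub>R w) \<le> ?B (2*R) w * (?I s * ?D x * ?E (x - s *\<^sub>R w))" for w
            proof -
              have "norm w < 2 * R" if "x \<in> D" "x - s *\<^sub>R w \<in> E"
              proof -
                have "norm w \<le> norm (s *\<^sub>R w)" using s by (simp add: mult_le_cancel_right1)
                also have "s *\<^sub>R w = x - (x - s *\<^sub>R w)" by simp
                also have "norm \<dots> \<le> norm x + norm (x - s *\<^sub>R w)" by (rule norm_triangle_ineq4)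
                also have "\<dots> < R + R" using that DR ER by (intro add_strict_mono) auto
                finally show ?thesis by simp
              qed
              then show ?thesis using True by (auto simp: indicator_def)
            qed
            have "?D x * (ennreal (s ^ n) * (\<integral>\<^sup>+w. ?E (x - s *\<^sub>R w) \<partial>lborel)) = ennreal (s ^ n) * (\<integral>\<^sup>+w. ?D x * ?E (x - s *\<^sub>R w) \<partial>lborel)"
              by (simp add: nn_integral_cmult mult_ac)
            also have "\<dots> \<le> ennreal (2 ^ n) * (\<integral>\<^sup>+w. ?B (2*R) w * (?I s * ?D x * ?E (x - s *\<^sub>R w)) \<partial>lborel)"
              using s by (intro mult_mono ennreal_leI power_mono nn_integral_mono p) auto
            finally show "?D x * (ennreal (s ^ n) * (\<integral>\<^sup>+w. ?E (x - s *\<^sub>R w) \<partial>lborel)) \<le> 2 ^ n * (\<integral>\<^sup>+w. ?B (2*R) w * (?I s * ?D x * ?E (x - s *\<^sub>R w)) \<partial>lborel)"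
              by (simp flip: ennreal_power)
          qed
          also have "\<dots> = 2 ^ n * (\<integral>\<^sup>+x. (\<integral>\<^sup>+w. ?B (2*R) w * (?I s * ?D x * ?E (x - s *\<^sub>R w)) \<partial>lborel) \<partial>lborel)"
            by (rule nn_integral_cmult) measurable
          finally show ?thesis using True by simp
        qed simp
      qed
      also have "\<dots> = 2 ^ n * (\<integral>\<^sup>+w. ?B (2*R) w * \<Phi> w \<partial>lborel)"
        unfolding swap[symmetric] by (rule nn_integral_cmult) measurable
      also have "\<dots> \<le> 2 ^ n * (\<integral>\<^sup>+w. ennreal V * ?B \<kappa> w + ennreal (L * \<eta>) * ?B (2*R) w \<partial>lborel)"
      proof (intro mult_left_mono nn_integral_mono)
        fix w
        show "?B (2*R) w * \<Phi> w \<le> ennreal V * ?B \<kappa> w + ennreal (L * \<eta>) * ?B (2*R) w"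
          using \<Phi>V[of w] \<Phi>\<eta>[of w] by (cases "norm w < \<kappa>") (auto simp: indicator_def add_increasing2)
      qed simp
      also have "\<dots> = ennreal (2 ^ n) * (ennreal V * ennreal (v * \<kappa> ^ n) + ennreal (L * \<eta>) * ennreal W)"
        using R \<kappa> by (subst nn_integral_add) (auto simp: nn_integral_cmult_indicator ball W_def simp flip: ennreal_power)
      also have "\<dots> = ennreal (2 ^ n * (V * (v * \<kappa> ^ n) + L * \<eta> * W))"
        using V v \<kappa> L \<eta> W by (simp add: ennreal_mult' ennreal_plus del: ennreal_power)
      also have "2 ^ n * (V * (v * \<kappa> ^ n) + L * \<eta> * W) \<le> \<epsilon>\<^sup>2 / 2"
        using \<kappa>1 \<eta>1 by (simp add: algebra_simps)
      finally have "emeasure lborel D * emeasure lborel E \<le> ennreal (\<epsilon>\<^sup>2 / 2)" by (simp add: ennreal_leI)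
      moreover have "ennreal (\<epsilon> * \<epsilon>) \<le> emeasure lborel D * emeasure lborel E"
        using mult_mono[OF De Ee] \<epsilon> by (simp add: ennreal_mult)
      ultimately have "\<epsilon> * \<epsilon> \<le> \<epsilon>\<^sup>2 / 2" by (meson ennreal_le_iff order_trans zero_le_divide_iff zero_le_numeral zero_le_power2)
      then show False using \<epsilon> by (simp add: power2_eq_square)
    qed
  qed
qed

section \<open>The variational eigenvalue of a Borel set\<close>

text \<open>Extended nonnegative Borel representatives of the normalized functions supported in \<open>A\<close>.\<close>

definition trial :: "'a::euclidean_space set \<Rightarrow> ('a \<Rightarrow> ennreal) set" where
  "trial A = {u. u \<in> borel_measurable borel \<and> (\<forall>x. x \<notin> A \<longrightarrow> u x = 0) \<and> (\<integral>\<^sup>+x. (u x)\<^sup>2 \<partial>lborel) = 1}"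

definition riesz_top :: "real \<Rightarrow> 'a::euclidean_space set \<Rightarrow> ennreal" where
  "riesz_top \<beta> A = (SUP u\<in>trial A. energy \<beta> u u)"

lemma energy_le_riesz_top: "u \<in> trial A \<Longrightarrow> energy \<beta> u u \<le> riesz_top \<beta> A"
  unfolding riesz_top_def by (rule SUP_upper)

lemma polarize_trial:
  assumes u: "u \<in> trial A" and w: "w \<noteq> 0"
  shows "polarize w t u \<in> trial (polarize_set w t A)"
proof -
  have [measurable]: "u \<in> borel_measurable borel" using u by (simp add: trial_def)
  have "(\<integral>\<^sup>+x. (polarize w t u x)\<^sup>2 \<partial>lborel) = (\<integral>\<^sup>+x. (u x)\<^sup>2 \<partial>lborel)"
    by (rule nn_integral_polarize[OF _ _ w, of u "\<lambda>z. z\<^sup>2"]) measurable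
  moreover have "polarize w t u x = 0" if "x \<notin> polarize_set w t A" for x
    using that u by (auto simp: polarize_def polarize_set_def trial_def split: if_splits)
  ultimately show ?thesis using u by (simp add: trial_def measurable_polarize)
qed

lemma riesz_top_polarize:
  assumes "0 \<le> \<beta>" "w \<noteq> 0"
  shows "riesz_top \<beta> A \<le> riesz_top \<beta> (polarize_set w t A)"
  unfolding riesz_top_def[of \<beta> A]
proof (rule SUP_least)
  fix u assume u: "u \<in> trial A"
  then have "energy \<beta> u u \<le> energy \<beta> (polarize w t u) (polarize w t u)"
    using assms by (intro energy_polarize) (auto simp: trial_def)
  also have "\<dots> \<le> riesz_top \<beta> (polarize_set w t A)"
    using polarize_trial[OF u assms(2)] by (rule energy_le_riesz_top)
  finally show "energy \<beta> u u \<le> riesz_top \<beta> (polarize_set w t A)" .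
qed

lemma energy_scale:
  assumes [measurable]: "u \<in> borel_measurable borel"
  shows "energy \<beta> (\<lambda>x. c * u x) (\<lambda>x. c * u x) = c\<^sup>2 * energy \<beta> u u"
proof -
  have "energy \<beta> (\<lambda>x. c * u x) (\<lambda>x. c * u x)
     = (\<integral>\<^sup>+x. (\<integral>\<^sup>+y. c\<^sup>2 * (u x * u y * riesz_kernel \<beta> (x - y)) \<partial>lborel) \<partial>lborel)"
    unfolding energy_def by (intro nn_integral_cong) (simp add: power2_eq_square mult_ac)
  also have "\<dots> = c\<^sup>2 * energy \<beta> u u" unfolding energy_def by (simp add: nn_integral_cmult)
  finally show ?thesis .
qed

lemma energy_commute:
  assumes [measurable]: "u \<in> borel_measurable borel" "v \<in> borel_measurable borel"
  shows "energy \<beta> u v = energy \<beta> v u"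
proof -
  have "energy \<beta> u v = (\<integral>\<^sup>+y. (\<integral>\<^sup>+x. u x * v y * riesz_kernel \<beta> (x - y) \<partial>lborel) \<partial>lborel)"
    unfolding energy_def by (rule lborel_pair.Fubini') measurable
  also have "\<dots> = energy \<beta> v u"
    unfolding energy_def by (intro nn_integral_cong) (simp add: mult_ac riesz_kernel_minus_commute)
  finally show ?thesis .
qed

lemma energy_add_left:
  assumes [measurable]: "u \<in> borel_measurable borel" "u' \<in> borel_measurable borel" "v \<in> borel_measurable borel"
  shows "energy \<beta> (\<lambda>x. u x + u' x) v = energy \<beta> u v + energy \<beta> u' v"
  unfolding energy_def by (simp add: distrib_right nn_integral_add)

lemma energy_add_right:
  assumes [measurable]: "u \<in> borel_measurable borel" "v \<in> borel_measurable borel" "v' \<in> borel_measurable borel"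
  shows "energy \<beta> u (\<lambda>x. v x + v' x) = energy \<beta> u v + energy \<beta> u v'"
  unfolding energy_def by (simp add: distrib_right distrib_left nn_integral_add)

lemma energy_mono:
  assumes "\<And>x. u x \<le> u' x" "\<And>x. v x \<le> v' x"
  shows "energy \<beta> u v \<le> energy \<beta> u' v'"
  unfolding energy_def using assms by (intro nn_integral_mono mult_mono) auto

text \<open>Both sides are homogeneous of degree two in \<open>u\<close>.\<close>

lemma energy_le_riesz_top_mass:
  assumes [measurable]: "u \<in> borel_measurable borel" and A: "\<And>x. x \<notin> A \<Longrightarrow> u x = 0"
    and fin: "(\<integral>\<^sup>+x. (u x)\<^sup>2 \<partial>lborel) < \<infinity>"
  shows "energy \<beta> u u \<le> riesz_top \<beta> A * (\<integral>\<^sup>+x. (u x)\<^sup>2 \<partial>lborel)"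
proof (cases "(\<integral>\<^sup>+x. (u x)\<^sup>2 \<partial>lborel) = 0")
  case True
  then have ae: "AE x in lborel. u x = 0" by (subst (asm) nn_integral_0_iff_AE) auto
  have "energy \<beta> u u = (\<integral>\<^sup>+x. 0 \<partial>(lborel :: 'a measure))"
    unfolding energy_def by (rule nn_integral_cong_AE) (use ae in \<open>auto elim!: eventually_mono\<close>)
  then show ?thesis by simp
next
  case False
  define m where "m = enn2real (\<integral>\<^sup>+x. (u x)\<^sup>2 \<partial>lborel)"
  have m: "(\<integral>\<^sup>+x. (u x)\<^sup>2 \<partial>lborel) = ennreal m" using fin by (simp add: m_def)
  have m0: "0 < m" using False m by (cases "m \<le> 0") (auto simp: ennreal_neg)
  define c where "c = ennreal (1 / sqrt m)"
  have c2: "c\<^sup>2 = ennreal (1 / m)" using m0 by (simp add: c_def ennreal_power power_divide)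
  have "(\<lambda>x. c * u x) \<in> trial A"
  proof -
    have "(\<integral>\<^sup>+x. (c * u x)\<^sup>2 \<partial>lborel) = c\<^sup>2 * ennreal m"
      unfolding m[symmetric] power_mult_distrib by (rule nn_integral_cmult) measurable
    also have "\<dots> = 1" using m0 by (simp add: c2 flip: ennreal_mult)
    finally show ?thesis using A by (simp add: trial_def)
  qed
  then have "c\<^sup>2 * energy \<beta> u u \<le> riesz_top \<beta> A"
    using energy_le_riesz_top[of "\<lambda>x. c * u x" A \<beta>] by (simp add: energy_scale)
  then have "ennreal m * (c\<^sup>2 * energy \<beta> u u) \<le> ennreal m * riesz_top \<beta> A" by (rule mult_left_mono) simp
  moreover have "ennreal m * c\<^sup>2 = 1" using m0 by (simp add: c2 flip: ennreal_mult)
  ultimately show ?thesis by (simp add: m mult.assoc[symmetric] mult.commute)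
qed

lemma ennreal_weighted_am_gm:
  fixes a b :: ennreal assumes t: "0 < t"
  shows "2 * (a * b) \<le> ennreal t * a\<^sup>2 + ennreal (1 / t) * b\<^sup>2"
proof (cases a; cases b)
  fix p q assume pq: "a = ennreal p" "0 \<le> p" "b = ennreal q" "0 \<le> q"
  have "0 \<le> (t * p - q)\<^sup>2 / t" using t by simp
  also have "\<dots> = t * p\<^sup>2 + 1 / t * q\<^sup>2 - 2 * (p * q)" using t by (simp add: field_simps power2_eq_square)
  finally have "2 * (p * q) \<le> t * p\<^sup>2 + 1 / t * q\<^sup>2" by simp
  moreover have "2 * (a * b) = ennreal (2 * (p * q))"
    using pq by (simp add: ennreal_mult')
  moreover have "ennreal t * a\<^sup>2 + ennreal (1 / t) * b\<^sup>2 = ennreal (t * p\<^sup>2 + 1 / t * q\<^sup>2)"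
  proof -
    have "ennreal (t * p\<^sup>2) = ennreal t * a\<^sup>2" using pq t by (simp add: ennreal_mult' ennreal_power)
    moreover have "ennreal (1 / t * q\<^sup>2) = ennreal (1 / t) * b\<^sup>2"
      using pq t by (subst ennreal_mult') (simp_all add: ennreal_power)
    ultimately show ?thesis using t by (subst ennreal_plus) auto
  qed
  ultimately show ?thesis by (metis ennreal_leI)
qed (use t in \<open>auto simp: ennreal_mult_top power2_eq_square top_add add_top\<close>)

text \<open>Schur's test with a weight: \<open>2 u(x) v(y) \<le> t u(x)\<^sup>2 + v(y)\<^sup>2 / t\<close>, and then one variable is
  integrated out. A large bound \<open>a\<close> can be compensated by a small bound \<open>b\<close> through the choice of \<open>t\<close>.\<close>

lemma energy_schur:
  assumes [measurable]: "u \<in> borel_measurable borel" "v \<in> borel_measurable borel" "D \<in> sets borel" "A \<in> sets borel"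
    and u: "\<And>x. x \<notin> D \<Longrightarrow> u x = 0" and v: "\<And>y. y \<notin> A \<Longrightarrow> v y = 0" and t: "0 < t"
    and a: "\<And>x. (\<integral>\<^sup>+y. riesz_kernel \<beta> (x - y) * indicator A y \<partial>lborel) \<le> a"
    and b: "\<And>y. (\<integral>\<^sup>+x. riesz_kernel \<beta> (y - x) * indicator D x \<partial>lborel) \<le> b"
  shows "2 * energy \<beta> u v \<le> ennreal t * a * (\<integral>\<^sup>+x. (u x)\<^sup>2 \<partial>lborel) + ennreal (1 / t) * b * (\<integral>\<^sup>+y. (v y)\<^sup>2 \<partial>lborel)"
proof -
  let ?K = "riesz_kernel \<beta>"
  let ?F = "\<lambda>x y. ennreal t * (u x)\<^sup>2 * (?K (x - y) * indicator A y)"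
  let ?G = "\<lambda>x y. ennreal (1 / t) * (v y)\<^sup>2 * (?K (y - x) * indicator D x)"
  have "2 * energy \<beta> u v = (\<integral>\<^sup>+x. (\<integral>\<^sup>+y. 2 * (u x * v y * ?K (x - y)) \<partial>lborel) \<partial>lborel)"
    unfolding energy_def by (simp add: nn_integral_cmult)
  also have "\<dots> \<le> (\<integral>\<^sup>+x. (\<integral>\<^sup>+y. ?F x y + ?G x y \<partial>lborel) \<partial>lborel)"
  proof (intro nn_integral_mono)
    fix x y
    show "2 * (u x * v y * ?K (x - y)) \<le> ?F x y + ?G x y"
    proof (cases "x \<in> D \<and> y \<in> A")
      case True
      have "2 * (u x * v y) * ?K (x - y) \<le> (ennreal t * (u x)\<^sup>2 + ennreal (1 / t) * (v y)\<^sup>2) * ?K (x - y)"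
        by (intro mult_right_mono ennreal_weighted_am_gm t) simp
      then show ?thesis using True by (simp add: distrib_right mult.assoc riesz_kernel_minus_commute[of _ y x])
    next
      case False
      then show ?thesis using u[of x] v[of y] by auto
    qed
  qed
  also have "\<dots> = (\<integral>\<^sup>+x. (\<integral>\<^sup>+y. ?F x y \<partial>lborel) \<partial>lborel) + (\<integral>\<^sup>+x. (\<integral>\<^sup>+y. ?G x y \<partial>lborel) \<partial>lborel)"
    by (simp add: nn_integral_add)
  also have "(\<integral>\<^sup>+x. (\<integral>\<^sup>+y. ?G x y \<partial>lborel) \<partial>lborel) = (\<integral>\<^sup>+y. (\<integral>\<^sup>+x. ?G x y \<partial>lborel) \<partial>lborel)"
    by (rule lborel_pair.Fubini') measurable
  also have "(\<integral>\<^sup>+x. (\<integral>\<^sup>+y. ?F x y \<partial>lborel) \<partial>lborel) \<le> (\<integral>\<^sup>+x. ennreal t * a * (u x)\<^sup>2 \<partial>lborel)"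
  proof (rule nn_integral_mono)
    fix x
    have "(\<integral>\<^sup>+y. ?F x y \<partial>lborel) = ennreal t * (u x)\<^sup>2 * (\<integral>\<^sup>+y. ?K (x - y) * indicator A y \<partial>lborel)"
      by (rule nn_integral_cmult) measurable
    also have "\<dots> \<le> ennreal t * (u x)\<^sup>2 * a" by (intro mult_left_mono a) simp
    finally show "(\<integral>\<^sup>+y. ?F x y \<partial>lborel) \<le> ennreal t * a * (u x)\<^sup>2" by (simp add: mult_ac)
  qed
  also have "(\<integral>\<^sup>+y. (\<integral>\<^sup>+x. ?G x y \<partial>lborel) \<partial>lborel) \<le> (\<integral>\<^sup>+y. ennreal (1 / t) * b * (v y)\<^sup>2 \<partial>lborel)"
  proof (rule nn_integral_mono)
    fix y
    have "(\<integral>\<^sup>+x. ?G x y \<partial>lborel) = ennreal (1 / t) * (v y)\<^sup>2 * (\<integral>\<^sup>+x. ?K (y - x) * indicator D x \<partial>lborel)"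
      by (rule nn_integral_cmult) measurable
    also have "\<dots> \<le> ennreal (1 / t) * (v y)\<^sup>2 * b" by (intro mult_left_mono b) simp
    finally show "(\<integral>\<^sup>+x. ?G x y \<partial>lborel) \<le> ennreal (1 / t) * b * (v y)\<^sup>2" by (simp add: mult_ac)
  qed
  finally show ?thesis by (simp add: nn_integral_cmult add_mono)
qed

lemma riesz_top_finite:
  fixes A :: "'a::euclidean_space set"
  assumes "0 < \<beta>" "\<beta> < real DIM('a)" "A \<in> sets borel" "emeasure lborel A < \<infinity>"
  shows "riesz_top \<beta> A < \<infinity>"
proof -
  define m where "m = enn2real (emeasure lborel A)"
  have m: "0 \<le> m" "emeasure lborel A \<le> ennreal m" using assms by (auto simp: m_def)
  obtain S where S: "0 < S" 
    "\<And>(D::'a set) x. D \<in> sets borel \<Longrightarrow> emeasure lborel D \<le> ennreal m \<Longrightarrow>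
        (\<integral>\<^sup>+y. riesz_kernel \<beta> (x - y) * indicator D y \<partial>lborel) \<le> ennreal S"
    using riesz_potential_bounded[OF assms(1,2) m(1)] by metis
  have "riesz_top \<beta> A \<le> ennreal S"
    unfolding riesz_top_def
  proof (rule SUP_least)
    fix u assume u: "u \<in> trial A"
    have "2 * energy \<beta> u u \<le> ennreal 1 * ennreal S * (\<integral>\<^sup>+x. (u x)\<^sup>2 \<partial>lborel) + ennreal (1 / 1) * ennreal S * (\<integral>\<^sup>+x. (u x)\<^sup>2 \<partial>lborel)"
      using u assms S(2)[OF assms(3) m(2)] by (intro energy_schur[where A = A and D = A]) (auto simp: trial_def)
    also have "\<dots> = 2 * ennreal S" using u by (simp add: trial_def mult_2)
    finally show "energy \<beta> u u \<le> ennreal S" by (simp only: ennreal_cancel_numeral)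
  qed
  then show ?thesis by (simp add: le_less_trans)
qed

text \<open>The part of a normalized function that lives on a set of small measure interacts weakly with the whole,
  uniformly in the function: in the weighted Schur test the factor belonging to \<open>D\<close> is as small as desired.\<close>

lemma energy_small_support:
  fixes e m :: real
  assumes \<beta>: "0 < \<beta>" "\<beta> < real DIM('a)" and m: "0 \<le> m" and e: "0 < e"
  obtains d where "0 < d"
    "\<And>A D u. A \<in> sets borel \<Longrightarrow> emeasure lborel A \<le> ennreal m \<Longrightarrow> D \<in> sets borel \<Longrightarrow>
       emeasure lborel D \<le> ennreal d \<Longrightarrow> u \<in> trial (A :: 'a::euclidean_space set) \<Longrightarrow>
       2 * energy \<beta> (\<lambda>x. u x * indicator D x) u \<le> ennreal e"
proof -
  obtain S where S: "0 < S" 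
    "\<And>(D::'a set) x. D \<in> sets borel \<Longrightarrow> emeasure lborel D \<le> ennreal m \<Longrightarrow>
        (\<integral>\<^sup>+y. riesz_kernel \<beta> (x - y) * indicator D y \<partial>lborel) \<le> ennreal S"
    using riesz_potential_bounded[OF \<beta> m] by metis
  define t where "t = e / (2 * S)"
  have t: "0 < t" "t * S = e / 2" using e S by (auto simp: t_def)
  have "0 < e * t / 2" using e t by simp
  then obtain d where d: "0 < d"
    "\<And>(D::'a set) x. D \<in> sets borel \<Longrightarrow> emeasure lborel D \<le> ennreal d \<Longrightarrow>
        (\<integral>\<^sup>+y. riesz_kernel \<beta> (x - y) * indicator D y \<partial>lborel) \<le> ennreal (e * t / 2)"
    using riesz_potential_small[OF \<beta>] by metis
  show thesis
  proof (rule that[OF d(1)])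
    fix A D :: "'a set" and u
    assume A [measurable]: "A \<in> sets borel" and Am: "emeasure lborel A \<le> ennreal m"
      and D [measurable]: "D \<in> sets borel" and Dd: "emeasure lborel D \<le> ennreal d" and u: "u \<in> trial A"
    have [measurable]: "u \<in> borel_measurable borel" and u0: "\<And>x. x \<notin> A \<Longrightarrow> u x = 0"
      and u1: "(\<integral>\<^sup>+x. (u x)\<^sup>2 \<partial>lborel) = 1" using u by (auto simp: trial_def)
    define q where "q x = u x * indicator D x" for x
    have [measurable]: "q \<in> borel_measurable borel" unfolding q_def by measurable
    have q1: "(\<integral>\<^sup>+x. (q x)\<^sup>2 \<partial>lborel) \<le> 1"
      unfolding u1[symmetric] by (intro nn_integral_mono) (auto simp: q_def indicator_def)
    have "2 * energy \<beta> q u \<le> ennreal t * ennreal S * (\<integral>\<^sup>+x. (q x)\<^sup>2 \<partial>lborel) + ennreal (1 / t) * ennreal (e * t / 2) * (\<integral>\<^sup>+x. (u x)\<^sup>2 \<partial>lborel)"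
      by (rule energy_schur[where A = A and D = D])
        (use u0 t(1) S(2)[OF A Am] d(2)[OF D Dd] in \<open>auto simp: q_def\<close>)
    also have "\<dots> \<le> ennreal t * ennreal S * 1 + ennreal (1 / t) * ennreal (e * t / 2) * 1"
      unfolding u1 by (intro add_mono mult_left_mono q1) auto
    also have "\<dots> = ennreal e"
      using t e S(1) by (simp flip: ennreal_mult ennreal_plus)
    finally show "2 * energy \<beta> (\<lambda>x. u x * indicator D x) u \<le> ennreal e" unfolding q_def .
  qed
qed

text \<open>Cutting a trial function for \<open>A\<close> down to \<open>B\<close> loses only the interaction of its part on \<open>A - B\<close> with itself
  and with the rest.\<close>

lemma riesz_top_excess:
  fixes B :: "'a::euclidean_space set" and e m :: real
  assumes \<beta>: "0 < \<beta>" "\<beta> < real DIM('a)" and B [measurable]: "B \<in> sets borel" and m: "0 \<le> m" and e: "0 < e"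
  obtains d where "0 < d"
    "\<And>A. A \<in> sets borel \<Longrightarrow> emeasure lborel A \<le> ennreal m \<Longrightarrow> emeasure lborel (A - B) \<le> ennreal d \<Longrightarrow>
       riesz_top \<beta> A \<le> riesz_top \<beta> B + ennreal e"
proof -
  obtain d where d: "0 < d"
    "\<And>A D u. A \<in> sets borel \<Longrightarrow> emeasure lborel A \<le> ennreal m \<Longrightarrow> D \<in> sets borel \<Longrightarrow>
       emeasure lborel D \<le> ennreal d \<Longrightarrow> u \<in> trial (A :: 'a set) \<Longrightarrow>
       2 * energy \<beta> (\<lambda>x. u x * indicator D x) u \<le> ennreal e"
    using energy_small_support[OF \<beta> m e] by metis
  show thesis
  proof (rule that[OF d(1)])
    fix A assume A [measurable]: "A \<in> sets borel" and Am: "emeasure lborel A \<le> ennreal m"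
      and AB: "emeasure lborel (A - B) \<le> ennreal d"
    show "riesz_top \<beta> A \<le> riesz_top \<beta> B + ennreal e"
      unfolding riesz_top_def[of \<beta> A]
    proof (rule SUP_least)
      fix u assume u: "u \<in> trial A"
      have [measurable]: "u \<in> borel_measurable borel" and u0: "\<And>x. x \<notin> A \<Longrightarrow> u x = 0"
        and u1: "(\<integral>\<^sup>+x. (u x)\<^sup>2 \<partial>lborel) = 1" using u by (auto simp: trial_def)
      define p q where "p x = u x * indicator B x" and "q x = u x * indicator (A - B) x" for x
      have [measurable]: "p \<in> borel_measurable borel" "q \<in> borel_measurable borel"
        unfolding p_def q_def by measurable
      have upq: "u = (\<lambda>x. p x + q x)" using u0 by (auto simp: p_def q_def indicator_def fun_eq_iff)
      have p1: "(\<integral>\<^sup>+x. (p x)\<^sup>2 \<partial>lborel) \<le> 1"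
        unfolding u1[symmetric] by (intro nn_integral_mono) (auto simp: p_def indicator_def)
      have "energy \<beta> u u = energy \<beta> p u + energy \<beta> q u"
        by (subst (1) upq, rule energy_add_left) measurable
      also have "energy \<beta> p u = energy \<beta> p p + energy \<beta> p q"
        by (subst upq, rule energy_add_right) measurable
      also have "energy \<beta> p q \<le> energy \<beta> u q" by (rule energy_mono) (simp_all add: upq)
      also have "energy \<beta> u q = energy \<beta> q u" by (rule energy_commute) measurable
      also have "energy \<beta> p p + energy \<beta> q u + energy \<beta> q u = energy \<beta> p p + 2 * energy \<beta> q u"
        by (simp add: mult_2 add.assoc)
      also have "energy \<beta> p p \<le> riesz_top \<beta> B * (\<integral>\<^sup>+x. (p x)\<^sup>2 \<partial>lborel)"
        by (rule energy_le_riesz_top_mass) (use p1 in \<open>auto simp: p_def intro: le_less_trans\<close>)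
      also have "\<dots> \<le> riesz_top \<beta> B * 1" by (intro mult_left_mono p1) simp
      also have "2 * energy \<beta> q u \<le> ennreal e"
        unfolding q_def by (rule d(2)[OF A Am _ AB u]) measurable
      finally show "energy \<beta> u u \<le> riesz_top \<beta> B + ennreal e" by (simp add: add_mono)
    qed
  qed
qed

section \<open>Balls maximize the eigenvalue\<close>

lemma reflect_uminus: "reflect (- w) (- t) = reflect w (t :: real)" for w :: "'a::euclidean_space"
proof
  fix x :: 'a
  have "offset (- w) (- t) x = - offset w t x" by (simp add: offset_def)
  then show "reflect (- w) (- t) x = reflect w t x" by (simp add: reflect_def)
qed

text \<open>As \<open>A\<close> and the ball have equal measure, \<open>A - B\<close> and \<open>B - A\<close> have equal measure, and some reflection maps
  a definite part of one into the other. Changing the sign of both parameters leaves the reflection unchanged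
  and exchanges the two sides, so the origin can be assumed to lie on the favoured side.\<close>

lemma exists_improving_polarization:
  fixes r R \<epsilon> :: real
  assumes "0 < \<epsilon>" "0 < r" "r \<le> R"
  obtains \<eta> where "0 < \<eta>"
    "\<And>A :: 'a::euclidean_space set. A \<in> sets borel \<Longrightarrow> A \<subseteq> ball 0 R \<Longrightarrow>
       emeasure lborel A = emeasure lborel (ball (0::'a) r) \<Longrightarrow> ennreal \<epsilon> \<le> emeasure lborel (A - ball 0 r) \<Longrightarrow>
       \<exists>w t. w \<noteq> 0 \<and> 0 \<le> t \<and>
         2 * emeasure lborel (polarize_set w t A - ball 0 r) + ennreal \<eta> \<le> 2 * emeasure lborel (A - ball 0 r)"
proof -
  have R: "0 < R" using assms by linarith
  obtain \<eta> where \<eta>: "0 < \<eta>"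
    "\<And>D E :: 'a::euclidean_space set. D \<in> sets borel \<Longrightarrow> E \<in> sets borel \<Longrightarrow>
       D \<subseteq> ball 0 R \<Longrightarrow> E \<subseteq> ball 0 R \<Longrightarrow>
       ennreal \<epsilon> \<le> emeasure lborel D \<Longrightarrow> ennreal \<epsilon> \<le> emeasure lborel E \<Longrightarrow>
       \<exists>w t. w \<noteq> 0 \<and> ennreal \<eta> \<le> emeasure lborel {x \<in> D. reflect w t x \<in> E}"
    using exists_reflection_overlap[OF assms(1) R, where ?'a = 'a] by blast
  show thesis
  proof (rule that[OF \<eta>(1)])
    fix A :: "'a set"
    let ?B = "ball (0::'a) r"
    assume A [measurable]: "A \<in> sets borel" and AR: "A \<subseteq> ball 0 R"
      and AB: "emeasure lborel A = emeasure lborel ?B" and e: "ennreal \<epsilon> \<le> emeasure lborel (A - ?B)"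
    have B [measurable]: "?B \<in> sets borel" by simp
    have fin: "emeasure lborel (A \<inter> ?B) \<noteq> \<infinity>"
      using emeasure_mono[of "A \<inter> ?B" ?B lborel] emeasure_lborel_ball_finite[of "0::'a" r] by (auto simp: top_unique)
    have "emeasure lborel (A - ?B) + emeasure lborel (A \<inter> ?B) = emeasure lborel (?B - A) + emeasure lborel (A \<inter> ?B)"
    proof -
      have *: "emeasure lborel (X - Y) + emeasure lborel (X \<inter> Y) = emeasure lborel X"
        if [measurable]: "X \<in> sets borel" "Y \<in> sets borel" for X Y :: "'a set"
      proof -
        have "emeasure lborel (X - Y) + emeasure lborel (X \<inter> Y) = emeasure lborel ((X - Y) \<union> (X \<inter> Y))"
          by (rule plus_emeasure) auto
        also have "(X - Y) \<union> (X \<inter> Y) = X" by blast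
        finally show ?thesis .
      qed
      show ?thesis using *[OF A B] *[OF B A] AB by (simp add: Int_commute)
    qed
    then have "emeasure lborel (A - ?B) = emeasure lborel (?B - A)"
      using fin by (simp add: ennreal_add_left_cancel add.commute[of _ "emeasure lborel (A \<inter> ?B)"])
    then have e': "ennreal \<epsilon> \<le> emeasure lborel (?B - A)" using e by simp
    have "A - ?B \<subseteq> ball 0 R" "?B - A \<subseteq> ball 0 R" using AR assms by auto
    then obtain w t where wt: "w \<noteq> 0" "ennreal \<eta> \<le> emeasure lborel {x \<in> A - ?B. reflect w t x \<in> ?B - A}"
      using \<eta>(2)[OF sets.Diff[OF A B] sets.Diff[OF B A] _ _ e e'] by blast
    have *: "\<exists>w t. w \<noteq> 0 \<and> 0 \<le> t \<and>
         2 * emeasure lborel (polarize_set w t A - ?B) + ennreal \<eta> \<le> 2 * emeasure lborel (A - ?B)"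
      if "w \<noteq> 0" "0 \<le> t" "ennreal \<eta> \<le> emeasure lborel {x \<in> A - ?B. reflect w t x \<in> ?B - A}" for w t
      using order_trans[OF add_left_mono[OF that(3)] polarize_set_excess[OF A that(1,2), of r]] that(1,2) by blast
    show "\<exists>w t. w \<noteq> 0 \<and> 0 \<le> t \<and>
         2 * emeasure lborel (polarize_set w t A - ?B) + ennreal \<eta> \<le> 2 * emeasure lborel (A - ?B)"
    proof (cases "0 \<le> t")
      case True then show ?thesis using *[OF wt(1) _ wt(2)] by simp
    next
      case False
      then show ?thesis using *[of "- w" "- t"] wt by (simp add: reflect_uminus)
    qed
  qed
qed

lemma polarize_set_subset_ball:
  assumes A: "A \<subseteq> ball 0 R" and t: "0 \<le> t"
  shows "polarize_set w t A \<subseteq> ball 0 R"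
proof
  fix x assume x: "x \<in> polarize_set w t A"
  show "x \<in> ball 0 R"
  proof (cases "x \<in> A")
    case False
    then have "offset w t x \<le> 0" "reflect w t x \<in> A" using x by (auto simp: polarize_set_def split: if_splits)
    then have "0 \<le> - offset w t x * t * (norm w)\<^sup>2" using t by (intro mult_nonneg_nonneg) auto
    then have "(norm x)\<^sup>2 \<le> (norm (reflect w t x))\<^sup>2" using norm_reflect_sq[of w t x] by linarith
    then have "norm x \<le> norm (reflect w t x)" by (rule power2_le_imp_le) simp
    moreover have "norm (reflect w t x) < R" using \<open>reflect w t x \<in> A\<close> A by auto
    ultimately show ?thesis by simp
  qed (use A in auto)
qed

text \<open>The gain \<open>\<eta>\<close> does not depend on \<open>A\<close>, and polarization towards the origin does not leave the ball of radius
  \<open>R\<close>, so finitely many steps suffice.\<close>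

lemma exists_nearly_ball:
  fixes A :: "'a::euclidean_space set" and r R \<epsilon> :: real
  assumes \<beta>: "0 \<le> \<beta>" and \<epsilon>: "0 < \<epsilon>" and r: "0 < r" "r \<le> R"
    and A: "A \<in> sets borel" "A \<subseteq> ball 0 R" "emeasure lborel A = emeasure lborel (ball (0::'a) r)"
  shows "\<exists>A' :: 'a set. A' \<in> sets borel \<and> emeasure lborel A' = emeasure lborel (ball (0::'a) r) \<and>
           emeasure lborel (A' - ball 0 r) \<le> ennreal \<epsilon> \<and> riesz_top \<beta> A \<le> riesz_top \<beta> A'"
proof -
  let ?B = "ball (0::'a) r"
  obtain \<eta> where \<eta>: "0 < \<eta>"
    "\<And>A :: 'a::euclidean_space set. A \<in> sets borel \<Longrightarrow> A \<subseteq> ball 0 R \<Longrightarrow>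
       emeasure lborel A = emeasure lborel ?B \<Longrightarrow> ennreal \<epsilon> \<le> emeasure lborel (A - ?B) \<Longrightarrow>
       \<exists>w t. w \<noteq> 0 \<and> 0 \<le> t \<and>
         2 * emeasure lborel (polarize_set w t A - ?B) + ennreal \<eta> \<le> 2 * emeasure lborel (A - ?B)"
    using exists_improving_polarization[OF \<epsilon> r] by metis
  \<comment> \<open>each polarization lowers twice the excess by \<open>\<eta>\<close>, so \<open>n\<close> of them reach the target\<close>
  have step: "\<exists>A'. A' \<in> sets borel \<and> emeasure lborel A' = emeasure lborel ?B \<and>
           emeasure lborel (A' - ?B) \<le> ennreal \<epsilon> \<and> riesz_top \<beta> A \<le> riesz_top \<beta> A'"
    if "A \<in> sets borel" "A \<subseteq> ball 0 R" "emeasure lborel A = emeasure lborel ?B"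
       "2 * emeasure lborel (A - ?B) \<le> ennreal (n * \<eta>)" for n :: nat and A
    using that
  proof (induction n arbitrary: A)
    case 0
    then have "emeasure lborel (A - ?B) \<le> ennreal \<epsilon>" by simp
    then show ?case using 0 by blast
  next
    case (Suc n)
    show ?case
    proof (cases "emeasure lborel (A - ?B) \<le> ennreal \<epsilon>")
      case True then show ?thesis using Suc.prems by blast
    next
      case False
      then obtain w t where wt: "w \<noteq> 0" "0 \<le> t"
        "2 * emeasure lborel (polarize_set w t A - ?B) + ennreal \<eta> \<le> 2 * emeasure lborel (A - ?B)"
        using \<eta>(2)[of A] Suc.prems by (meson linear)
      have "ennreal \<eta> + 2 * emeasure lborel (polarize_set w t A - ?B) \<le> ennreal (Suc n * \<eta>)"
        using order_trans[OF wt(3) Suc.prems(4)] by (simp only: add.commute)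
      also have "\<dots> = ennreal \<eta> + ennreal (n * \<eta>)" using \<eta>(1) by (simp add: distrib_right flip: ennreal_plus)
      finally have "2 * emeasure lborel (polarize_set w t A - ?B) \<le> ennreal (n * \<eta>)"
        by (simp add: ennreal_add_left_cancel_le)
      then obtain A' where A': "A' \<in> sets borel" "emeasure lborel A' = emeasure lborel ?B"
           "emeasure lborel (A' - ?B) \<le> ennreal \<epsilon>" "riesz_top \<beta> (polarize_set w t A) \<le> riesz_top \<beta> A'"
        using Suc.IH[OF sets_polarize_set[OF Suc.prems(1)] polarize_set_subset_ball[OF Suc.prems(2) wt(2)]]
          emeasure_polarize_set[OF Suc.prems(1) wt(1), of t] Suc.prems(3) by (simp only: simp_thms) blast
      then show ?thesis using riesz_top_polarize[OF \<beta> wt(1), of A t] by (blast intro: order_trans)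
    qed
  qed
  have "2 * emeasure lborel (A - ?B) \<le> 2 * emeasure lborel A"
    using A by (intro mult_left_mono emeasure_mono) auto
  also have "\<dots> < \<infinity>" using A(3) emeasure_lborel_ball_finite[of "0::'a" r]
    by (simp add: ennreal_mult_less_top)
  finally obtain c where c: "2 * emeasure lborel (A - ?B) = ennreal c" "0 \<le> c"
    by (cases "2 * emeasure lborel (A - ?B)") auto
  obtain n :: nat where "c / \<eta> \<le> n" using real_arch_simple by blast
  then have "2 * emeasure lborel (A - ?B) \<le> ennreal (n * \<eta>)" using \<eta>(1) c by (simp add: ennreal_leI field_simps)
  then show ?thesis by (rule step[OF A])
qed

text \<open>The rearrangement inequality for the eigenvalue, for arbitrary bounded Borel sets. This generality is used in
  the equality case, where the inequality is applied to a polarization of the original open set.\<close>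

lemma riesz_top_le_ball:
  fixes A :: "'a::euclidean_space set"
  assumes \<beta>: "0 < \<beta>" "\<beta> < real DIM('a)" and A: "A \<in> sets borel" "bounded A" and r: "0 < r"
    and AB: "emeasure lborel A = emeasure lborel (ball (0::'a) r)"
  shows "riesz_top \<beta> A \<le> riesz_top \<beta> (ball (0::'a) r)"
proof (rule ennreal_le_epsilon)
  fix e :: real assume e: "0 < e"
  let ?B = "ball (0::'a) r"
  obtain R0 where R0: "\<forall>x\<in>A. norm x < R0" using A(2) bounded_pos_less by blast
  define R where "R = max r R0"
  have R: "r \<le> R" "A \<subseteq> ball 0 R" using R0 by (auto simp: R_def less_max_iff_disj)
  define m where "m = measure lborel ?B"
  have m: "0 \<le> m" "emeasure lborel ?B = ennreal m"
    using emeasure_lborel_ball_finite[of "0::'a" r] by (auto simp: m_def emeasure_eq_ennreal_measure top.not_eq_extremum)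
  obtain d where d: "0 < d"
    "\<And>A. A \<in> sets borel \<Longrightarrow> emeasure lborel A \<le> ennreal m \<Longrightarrow> emeasure lborel (A - ?B) \<le> ennreal d \<Longrightarrow>
       riesz_top \<beta> A \<le> riesz_top \<beta> ?B + ennreal e"
    using riesz_top_excess[OF \<beta> borel_open[OF open_ball] m(1) e] by metis
  obtain A' where A': "A' \<in> sets borel" "emeasure lborel A' = emeasure lborel ?B"
    "emeasure lborel (A' - ?B) \<le> ennreal d" "riesz_top \<beta> A \<le> riesz_top \<beta> A'"
    using exists_nearly_ball[OF less_imp_le[OF \<beta>(1)] d(1) r R(1) A(1) R(2) AB] by blast
  have "riesz_top \<beta> A' \<le> riesz_top \<beta> ?B + ennreal e"
    using A' m by (intro d(2)) auto
  then show "riesz_top \<beta> A \<le> riesz_top \<beta> ?B + ennreal e" using A'(4) by (rule order_trans[rotated])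
qed

section \<open>Mass distribution of near-maximizers\<close>

text \<open>If \<open>|p|\<^sup>2 + c \<le> |q|\<^sup>2\<close> with \<open>|q| \<le> M\<close>, then \<open>|p| \<le> \<theta> |q|\<close> with a ratio \<open>\<theta> < 1\<close>, and the negative power
  turns this ratio into a gap.\<close>

lemma riesz_kernel_gap:
  fixes \<beta> M c :: real
  assumes \<beta>: "0 < \<beta>" and M: "0 < M" and c: "0 < c"
  obtains \<kappa> where "0 < \<kappa>"
    "\<And>(p :: 'a::euclidean_space) (q :: 'a). (norm p)\<^sup>2 + c \<le> (norm q)\<^sup>2 \<Longrightarrow> norm q \<le> M \<Longrightarrow>
       riesz_kernel \<beta> q + ennreal \<kappa> \<le> riesz_kernel \<beta> p"
proof -
  \<comment> \<open>\<open>c\<close> is lowered, if necessary, to keep the ratio \<open>\<theta>\<close> positive\<close>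
  define d where "d = min c (M\<^sup>2 / 2)"
  have d: "0 < d" "d \<le> c" "d < M\<^sup>2" using c M by (auto simp: d_def min_less_iff_disj)
  define \<theta> where "\<theta> = sqrt (1 - d / M\<^sup>2)"
  have \<theta>: "0 < \<theta>" "\<theta> < 1" "\<theta>\<^sup>2 = 1 - d / M\<^sup>2" using d M by (auto simp: \<theta>_def)
  define \<kappa> where "\<kappa> = (\<theta> powr - \<beta> - 1) * M powr - \<beta>"
  have "1 powr - \<beta> < \<theta> powr - \<beta>" using \<theta> \<beta> by (intro powr_less_mono2_neg) auto
  then have \<kappa>: "0 < \<kappa>" using M by (simp add: \<kappa>_def)
  show thesis
  proof (rule that[OF \<kappa>])
    fix p q :: 'a assume pq: "(norm p)\<^sup>2 + c \<le> (norm q)\<^sup>2" and q: "norm q \<le> M"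
    have "0 < (norm q)\<^sup>2" using pq c zero_le_power2[of "norm p"] by linarith
    then have q0: "0 < norm q" by simp
    show "riesz_kernel \<beta> q + ennreal \<kappa> \<le> riesz_kernel \<beta> p"
    proof (cases "p = 0")
      case True
      then have "riesz_kernel \<beta> p = top" by (simp add: riesz_kernel_def)
      then show ?thesis by simp
    next
      case False
      have q2: "(norm q)\<^sup>2 \<le> M\<^sup>2" using q by (intro power_mono) auto
      have "(norm p)\<^sup>2 \<le> (norm q)\<^sup>2 - d" using pq d by linarith
      also have "\<dots> \<le> (norm q)\<^sup>2 - d * ((norm q)\<^sup>2 / M\<^sup>2)"
        using d q2 M mult_left_mono[of "(norm q)\<^sup>2 / M\<^sup>2" 1 d] by simp
      also have "\<dots> = (\<theta> * norm q)\<^sup>2" by (simp add: power_mult_distrib \<theta> algebra_simps)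
      finally have "norm p \<le> \<theta> * norm q" by (rule power2_le_imp_le) (use \<theta> in simp)
      then have "(\<theta> * norm q) powr - \<beta> \<le> norm p powr - \<beta>" using False \<beta> by (intro powr_mono2') auto
      moreover have "(\<theta> * norm q) powr - \<beta> = \<theta> powr - \<beta> * norm q powr - \<beta>" using \<theta> by (simp add: powr_mult)
      moreover have "M powr - \<beta> \<le> norm q powr - \<beta>" using q q0 \<beta> by (intro powr_mono2') auto
      then have "\<kappa> \<le> (\<theta> powr - \<beta> - 1) * norm q powr - \<beta>"
        unfolding \<kappa>_def using \<open>1 powr - \<beta> < \<theta> powr - \<beta>\<close> by (intro mult_left_mono) auto
      ultimately have "norm q powr - \<beta> + \<kappa> \<le> norm p powr - \<beta>" by (simp add: algebra_simps)
      then show ?thesis using False q0 \<kappa> by (simp add: riesz_kernel_eq flip: ennreal_plus)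
    qed
  qed
qed

text \<open>Any two points of a bounded set interact with at least the kernel value at the diameter of a
  ball containing it.\<close>

lemma energy_ge_product:
  assumes [measurable]: "u \<in> borel_measurable borel" "v \<in> borel_measurable borel"
    and \<beta>: "0 \<le> \<beta>" and R: "0 < R" and \<Omega>: "\<Omega> \<subseteq> ball 0 R"
    and u: "\<And>x. x \<notin> \<Omega> \<Longrightarrow> u x = 0" and v: "\<And>x. x \<notin> \<Omega> \<Longrightarrow> v x = 0"
  shows "ennreal ((2 * R) powr - \<beta>) * ((\<integral>\<^sup>+x. u x \<partial>lborel) * (\<integral>\<^sup>+y. v y \<partial>lborel)) \<le> energy \<beta> u v"
proof -
  have "ennreal ((2 * R) powr - \<beta>) * ((\<integral>\<^sup>+x. u x \<partial>lborel) * (\<integral>\<^sup>+y. v y \<partial>lborel))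
     = (\<integral>\<^sup>+x. (\<integral>\<^sup>+y. u x * v y * ennreal ((2 * R) powr - \<beta>) \<partial>lborel) \<partial>lborel)"
    by (simp add: nn_integral_cmult nn_integral_multc mult_ac)
  also have "\<dots> \<le> energy \<beta> u v"
    unfolding energy_def
  proof (intro nn_integral_mono)
    fix x y
    show "u x * v y * ennreal ((2 * R) powr - \<beta>) \<le> u x * v y * riesz_kernel \<beta> (x - y)"
    proof (cases "x \<in> \<Omega> \<and> y \<in> \<Omega>")
      case True
      have "norm (x - y) \<le> norm x + norm y" by (rule norm_triangle_ineq4)
      also have "\<dots> \<le> R + R" using True \<Omega> by (intro add_mono) auto
      finally have "ennreal ((2 * R) powr - \<beta>) \<le> riesz_kernel \<beta> (x - y)"
        using R \<beta> by (intro riesz_kernel_ge) auto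
      then show ?thesis by (rule mult_left_mono) simp
    qed (use u v in auto)
  qed
  finally show ?thesis .
qed

lemma riesz_top_pos:
  fixes \<Omega> :: "'a::euclidean_space set"
  assumes \<beta>: "0 \<le> \<beta>" and \<Omega> [measurable]: "\<Omega> \<in> sets borel" and R: "0 < R" "\<Omega> \<subseteq> ball 0 R" and pos: "emeasure lborel \<Omega> \<noteq> 0"
  shows "0 < riesz_top \<beta> \<Omega>"
proof -
  have fin: "emeasure lborel \<Omega> < \<infinity>"
    using emeasure_mono[OF R(2), of lborel] emeasure_lborel_ball_finite[of "0::'a" R] by (auto intro: le_less_trans)
  have sq: "(\<integral>\<^sup>+x. (indicator \<Omega> x)\<^sup>2 \<partial>lborel) = emeasure lborel \<Omega>"
  proof -
    have "(\<integral>\<^sup>+x. (indicator \<Omega> x)\<^sup>2 \<partial>lborel) = (\<integral>\<^sup>+x. indicator \<Omega> x \<partial>lborel)"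
      by (intro nn_integral_cong) (auto simp: indicator_def)
    then show ?thesis by simp
  qed
  have "ennreal ((2 * R) powr - \<beta>) * (emeasure lborel \<Omega> * emeasure lborel \<Omega>) \<le> energy \<beta> (indicator \<Omega>) (indicator \<Omega>)"
    using energy_ge_product[of "indicator \<Omega>" "indicator \<Omega>" \<beta> R \<Omega>] \<beta> R by simp
  also have "\<dots> \<le> riesz_top \<beta> \<Omega> * emeasure lborel \<Omega>"
    using energy_le_riesz_top_mass[of "indicator \<Omega>" \<Omega> \<beta>] fin by (simp add: sq)
  finally have le: "ennreal ((2 * R) powr - \<beta>) * (emeasure lborel \<Omega> * emeasure lborel \<Omega>) \<le> riesz_top \<beta> \<Omega> * emeasure lborel \<Omega>" .
  show ?thesis
  proof (rule ccontr)
    assume "\<not> ?thesis"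
    then have "riesz_top \<beta> \<Omega> = 0" by simp
    then show False using le pos R by simp
  qed
qed

text \<open>Cut \<open>u\<close> at a height \<open>M\<close>. By Chebyshev's inequality the part above \<open>M\<close> has support of small measure and
  contributes little energy, while the energy of the part below \<open>M\<close> is at most a constant times the integral of
  \<open>u\<close>. So a function of substantial energy has substantial integral.\<close>

lemma near_maximizer_mass:
  fixes \<Omega> :: "'a::euclidean_space set"
  assumes \<beta>: "0 < \<beta>" "\<beta> < real DIM('a)" and \<Omega> [measurable]: "\<Omega> \<in> sets borel"
    and fin: "emeasure lborel \<Omega> < \<infinity>" and pos: "0 < riesz_top \<beta> \<Omega>"
  obtains m0 where "0 < m0"
    "\<And>u. u \<in> trial \<Omega> \<Longrightarrow> riesz_top \<beta> \<Omega> \<le> 2 * energy \<beta> u u \<Longrightarrow> ennreal m0 \<le> (\<integral>\<^sup>+x. u x \<partial>lborel)"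
proof -
  obtain l where l: "riesz_top \<beta> \<Omega> = ennreal l" "0 < l"
    using riesz_top_finite[OF \<beta> \<Omega> fin] pos by (cases "riesz_top \<beta> \<Omega>") auto
  obtain m where m: "emeasure lborel \<Omega> = ennreal m" "0 \<le> m"
    using fin by (cases "emeasure lborel \<Omega>") auto
  obtain S where S: "0 < S"
    "\<And>(D::'a set) x. D \<in> sets borel \<Longrightarrow> emeasure lborel D \<le> ennreal m \<Longrightarrow>
        (\<integral>\<^sup>+y. riesz_kernel \<beta> (x - y) * indicator D y \<partial>lborel) \<le> ennreal S"
    using riesz_potential_bounded[OF \<beta> m(2)] by metis
  have l2: "0 < l / 2" using l by simp
  obtain d where d: "0 < d"
    "\<And>A D u. A \<in> sets borel \<Longrightarrow> emeasure lborel A \<le> ennreal m \<Longrightarrow> D \<in> sets borel \<Longrightarrow>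
       emeasure lborel D \<le> ennreal d \<Longrightarrow> u \<in> trial (A :: 'a set) \<Longrightarrow>
       2 * energy \<beta> (\<lambda>x. u x * indicator D x) u \<le> ennreal (l / 2)"
    using energy_small_support[OF \<beta> m(2) l2] by metis
  \<comment> \<open>the height above which a normalized function lives on a set of measure at most \<open>d\<close>\<close>
  define M where "M = 1 / sqrt d"
  have M: "0 < M" "M\<^sup>2 * d = 1" using d by (auto simp: M_def power_divide)
  define m0 where "m0 = l / (4 * M * S)"
  have m0: "0 < m0" "2 * M * S * m0 = l / 2" using l M S by (auto simp: m0_def)
  show thesis
  proof (rule that[OF m0(1)])
    fix u assume u: "u \<in> trial \<Omega>" and near: "riesz_top \<beta> \<Omega> \<le> 2 * energy \<beta> u u"
    have [measurable]: "u \<in> borel_measurable borel" and u0: "\<And>x. x \<notin> \<Omega> \<Longrightarrow> u x = 0"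
        and u1: "(\<integral>\<^sup>+x. (u x)\<^sup>2 \<partial>lborel) = 1" using u by (auto simp: trial_def)
    define D where "D = {x. ennreal M < u x}"
    have D [measurable]: "D \<in> sets borel" unfolding D_def by measurable
    define p q where "p x = u x * indicator (- D) x" and "q x = u x * indicator D x" for x
    have [measurable]: "p \<in> borel_measurable borel" "q \<in> borel_measurable borel"
      unfolding p_def q_def by measurable
    have upq: "u = (\<lambda>x. p x + q x)" by (auto simp: p_def q_def indicator_def fun_eq_iff)
    have "ennreal (M\<^sup>2) * emeasure lborel D = (\<integral>\<^sup>+x. ennreal (M\<^sup>2) * indicator D x \<partial>lborel)"
      by (simp add: nn_integral_cmult_indicator)
    also have "\<dots> \<le> (\<integral>\<^sup>+x. (u x)\<^sup>2 \<partial>lborel)"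
    proof (rule nn_integral_mono)
      fix x
      show "ennreal (M\<^sup>2) * indicator D x \<le> (u x)\<^sup>2"
      proof (cases "x \<in> D")
        case True
        then have "(ennreal M)\<^sup>2 \<le> (u x)\<^sup>2" by (intro power_mono) (auto simp: D_def)
        then show ?thesis using True M by (simp add: ennreal_power)
      qed simp
    qed
    finally have "ennreal d * (ennreal (M\<^sup>2) * emeasure lborel D) \<le> ennreal d * 1"
      unfolding u1 by (rule mult_left_mono) simp
    moreover have "ennreal d * ennreal (M\<^sup>2) = 1" using M d by (simp add: mult.commute flip: ennreal_mult)
    ultimately have Dd: "emeasure lborel D \<le> ennreal d" by (simp add: mult.assoc[symmetric])
    have q: "2 * energy \<beta> q u \<le> ennreal (l / 2)"
      unfolding q_def by (rule d(2)[OF \<Omega> _ D Dd u]) (simp add: m)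
    have p: "energy \<beta> p u \<le> ennreal (M * S) * (\<integral>\<^sup>+x. u x \<partial>lborel)"
    proof -
      have "energy \<beta> p u = energy \<beta> u p" by (rule energy_commute) measurable
      also have "\<dots> \<le> (\<integral>\<^sup>+x. (\<integral>\<^sup>+y. ennreal M * u x * (riesz_kernel \<beta> (x - y) * indicator \<Omega> y) \<partial>lborel) \<partial>lborel)"
        unfolding energy_def
      proof (intro nn_integral_mono)
        fix x y
        have "p y \<le> ennreal M * indicator \<Omega> y"
          using u0[of y] by (auto simp: p_def D_def indicator_def)
        then have "u x * p y * riesz_kernel \<beta> (x - y) \<le> u x * (ennreal M * indicator \<Omega> y) * riesz_kernel \<beta> (x - y)"
          by (intro mult_right_mono mult_left_mono) auto
        then show "u x * p y * riesz_kernel \<beta> (x - y) \<le> ennreal M * u x * (riesz_kernel \<beta> (x - y) * indicator \<Omega> y)"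
          by (simp add: mult_ac)
      qed
      also have "\<dots> \<le> (\<integral>\<^sup>+x. ennreal M * u x * ennreal S \<partial>lborel)"
        by (intro nn_integral_mono, subst nn_integral_cmult, measurable, intro mult_left_mono S(2)[OF \<Omega>]) (simp_all add: m)
      also have "\<dots> = ennreal (M * S) * (\<integral>\<^sup>+x. u x \<partial>lborel)"
        using M S by (simp add: nn_integral_cmult nn_integral_multc ennreal_mult mult_ac)
      finally show ?thesis .
    qed
    have "energy \<beta> u u = energy \<beta> p u + energy \<beta> q u"
      by (subst (1) upq, rule energy_add_left) measurable
    then have "ennreal l \<le> 2 * energy \<beta> p u + 2 * energy \<beta> q u"
      using near l by (simp add: distrib_left)
    also have "\<dots> \<le> 2 * (ennreal (M * S) * (\<integral>\<^sup>+x. u x \<partial>lborel)) + ennreal (l / 2)"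
      by (intro add_mono mult_left_mono p q) simp
    finally have le: "ennreal l \<le> 2 * (ennreal (M * S) * (\<integral>\<^sup>+x. u x \<partial>lborel)) + ennreal (l / 2)" .
    show "ennreal m0 \<le> (\<integral>\<^sup>+x. u x \<partial>lborel)"
    proof (cases "\<integral>\<^sup>+x. u x \<partial>lborel")
      case (real i)
      have "2 * (ennreal (M * S) * ennreal i) + ennreal (l / 2) = ennreal (2 * (M * S * i) + l / 2)"
        using real l M S by (simp add: ennreal_mult' ennreal_plus)
      then have "l \<le> 2 * (M * S * i) + l / 2"
        using le real l M S by (simp add: ennreal_le_iff del: ennreal_plus flip: ennreal_plus)
      then have "2 * M * S * m0 \<le> 2 * M * S * i" using m0 by simp
      then have "m0 \<le> i" using M S by (simp add: mult_le_cancel_left_pos)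
      then show ?thesis using real by (simp add: ennreal_leI)
    qed simp
  qed
qed

text \<open>Perturb a near-maximizer \<open>u\<close> to \<open>v = u + t 1\<^sub>S\<close>. The energy grows at least by \<open>2 t c0\<close>, where \<open>c0\<close> is a lower
  bound for the interaction of \<open>u\<close> with \<open>S\<close>, whereas the squared norm grows by \<open>2 t\<close> times the mass of \<open>u\<close> on
  \<open>S\<close> plus \<open>t\<^sup>2 |S|\<close>. As the energy of \<open>v\<close> cannot exceed the eigenvalue times its squared norm, the mass of
  \<open>u\<close> on \<open>S\<close> is bounded below once \<open>t\<close> is small and \<open>u\<close> is close enough to maximal.\<close>

lemma near_maximizer_mass_on:
  fixes \<Omega> S :: "'a::euclidean_space set"
  assumes \<beta>: "0 < \<beta>" "\<beta> < real DIM('a)" and \<Omega> [measurable]: "\<Omega> \<in> sets borel" and R: "0 < R" "\<Omega> \<subseteq> ball 0 R"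
    and S [measurable]: "S \<in> sets borel" "S \<subseteq> \<Omega>" and Spos: "emeasure lborel S \<noteq> 0"
  obtains c \<eta> where "0 < c" "0 < \<eta>"
    "\<And>u. u \<in> trial \<Omega> \<Longrightarrow> riesz_top \<beta> \<Omega> \<le> energy \<beta> u u + ennreal \<eta> \<Longrightarrow>
        ennreal c \<le> (\<integral>\<^sup>+x. u x * indicator S x \<partial>lborel)"
proof -
  have fin: "emeasure lborel \<Omega> < \<infinity>"
    using emeasure_mono[OF R(2), of lborel] emeasure_lborel_ball_finite[of "0::'a" R] by (auto intro: le_less_trans)
  have Sle: "emeasure lborel S \<le> emeasure lborel \<Omega>" using S by (intro emeasure_mono) auto
  have pos: "0 < riesz_top \<beta> \<Omega>"
    using Sle Spos \<beta> R by (intro riesz_top_pos[OF _ \<Omega> R]) auto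
  obtain l where l: "riesz_top \<beta> \<Omega> = ennreal l" "0 < l"
    using riesz_top_finite[OF \<beta> \<Omega> fin] pos by (cases "riesz_top \<beta> \<Omega>") auto
  obtain s where s: "emeasure lborel S = ennreal s" "0 < s"
    using fin Sle Spos by (cases "emeasure lborel S") (auto simp: top_unique less_le)
  obtain m0 where m0: "0 < m0"
    "\<And>u. u \<in> trial \<Omega> \<Longrightarrow> riesz_top \<beta> \<Omega> \<le> 2 * energy \<beta> u u \<Longrightarrow> ennreal m0 \<le> (\<integral>\<^sup>+x. u x \<partial>lborel)"
    using near_maximizer_mass[OF \<beta> \<Omega> fin pos] by metis
  define k where "k = (2 * R) powr - \<beta>"
  have k: "0 < k" using R by (simp add: k_def)
  define c0 where "c0 = k * (m0 * s)"
  have c0: "0 < c0" using k m0 s by (simp add: c0_def)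
  \<comment> \<open>with this \<open>t\<close> the term \<open>t\<^sup>2 |S|\<close>, multiplied by the eigenvalue \<open>l\<close>, costs \<open>t c0 / 2\<close>\<close>
  define t where "t = c0 / (2 * l * s)"
  have t: "0 < t" "2 * (l * t * s) = c0" using c0 l s by (auto simp: t_def)
  define \<eta> where "\<eta> = min (l / 2) (t * c0 / 2)"
  have \<eta>: "0 < \<eta>" "\<eta> \<le> l / 2" "\<eta> \<le> t * c0 / 2" using l t c0 by (auto simp: \<eta>_def)
  define c where "c = c0 / (2 * l)"
  have c: "0 < c" "2 * l * c = c0" using c0 l by (auto simp: c_def)
  show thesis
  proof (rule that[OF c(1) \<eta>(1)])
    fix u assume u: "u \<in> trial \<Omega>" and near: "riesz_top \<beta> \<Omega> \<le> energy \<beta> u u + ennreal \<eta>"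
    have [measurable]: "u \<in> borel_measurable borel" and u0: "\<And>x. x \<notin> \<Omega> \<Longrightarrow> u x = 0"
        and u1: "(\<integral>\<^sup>+x. (u x)\<^sup>2 \<partial>lborel) = 1" using u by (auto simp: trial_def)
    obtain E where E: "energy \<beta> u u = ennreal E" "0 \<le> E"
      using energy_le_riesz_top[OF u, of \<beta>] l by (cases "energy \<beta> u u") (auto simp: top_unique)
    have lE: "l \<le> E + \<eta>" using near E l \<eta> by (simp add: ennreal_le_iff flip: ennreal_plus)
    have "riesz_top \<beta> \<Omega> \<le> 2 * energy \<beta> u u"
    proof -
      have "l \<le> 2 * E" using lE \<eta> by linarith
      then show ?thesis using E l by (simp add: ennreal_leI flip: ennreal_mult' ennreal_numeral)
    qed
    then have mass: "ennreal m0 \<le> (\<integral>\<^sup>+x. u x \<partial>lborel)" by (rule m0(2)[OF u])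
    define v where "v x = u x + ennreal t * indicator S x" for x
    have [measurable]: "v \<in> borel_measurable borel" unfolding v_def by measurable
    have cross: "ennreal c0 \<le> energy \<beta> u (indicator S)"
    proof -
      have "ennreal c0 = ennreal k * (ennreal m0 * emeasure lborel S)" using k m0 s by (simp add: c0_def ennreal_mult)
      also have "\<dots> \<le> ennreal k * ((\<integral>\<^sup>+x. u x \<partial>lborel) * (\<integral>\<^sup>+y. indicator S y \<partial>lborel))"
        by (simp, intro mult_left_mono mult_right_mono mass) auto
      also have "\<dots> \<le> energy \<beta> u (indicator S)"
        unfolding k_def using \<beta>(1) u0 S(2)
        by (intro energy_ge_product[OF _ _ _ R]) (auto simp: indicator_eq_0_iff)
      finally show ?thesis .
    qed
    have Ev: "energy \<beta> u u + 2 * ennreal t * ennreal c0 \<le> energy \<beta> v v"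
    proof -
      have ts: "energy \<beta> u (\<lambda>x. ennreal t * indicator S x) = ennreal t * energy \<beta> u (indicator S)"
      proof -
        have "energy \<beta> u (\<lambda>x. ennreal t * indicator S x)
            = (\<integral>\<^sup>+x. (\<integral>\<^sup>+y. ennreal t * (u x * indicator S y * riesz_kernel \<beta> (x - y)) \<partial>lborel) \<partial>lborel)"
          unfolding energy_def by (simp add: mult_ac)
        also have "\<dots> = ennreal t * energy \<beta> u (indicator S)"
          unfolding energy_def by (simp add: nn_integral_cmult)
        finally show ?thesis .
      qed
      have "energy \<beta> v v = energy \<beta> u v + energy \<beta> (\<lambda>x. ennreal t * indicator S x) v"
        by (subst (1) v_def[abs_def], rule energy_add_left) measurable
      also have "energy \<beta> u v = energy \<beta> u u + energy \<beta> u (\<lambda>x. ennreal t * indicator S x)"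
        unfolding v_def[abs_def] by (rule energy_add_right) measurable
      finally have "energy \<beta> v v = energy \<beta> u u + energy \<beta> u (\<lambda>x. ennreal t * indicator S x)
          + energy \<beta> (\<lambda>x. ennreal t * indicator S x) v" .
      moreover have "energy \<beta> (\<lambda>x. ennreal t * indicator S x) u \<le> energy \<beta> (\<lambda>x. ennreal t * indicator S x) v"
        by (rule energy_mono) (simp_all add: v_def)
      moreover have "energy \<beta> (\<lambda>x. ennreal t * indicator S x) u = energy \<beta> u (\<lambda>x. ennreal t * indicator S x)"
        by (rule energy_commute) measurable
      ultimately have "energy \<beta> u u + ennreal t * energy \<beta> u (indicator S) + ennreal t * energy \<beta> u (indicator S) \<le> energy \<beta> v v"
        by (simp add: ts add_left_mono)
      moreover have "energy \<beta> u u + (ennreal t * ennreal c0 + ennreal t * ennreal c0)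
          \<le> energy \<beta> u u + (ennreal t * energy \<beta> u (indicator S) + ennreal t * energy \<beta> u (indicator S))"
        by (intro add_left_mono add_mono mult_left_mono cross) auto
      ultimately have "energy \<beta> u u + (ennreal t * ennreal c0 + ennreal t * ennreal c0) \<le> energy \<beta> v v"
        unfolding add.assoc by (rule order_trans[rotated])
      then show ?thesis by (simp only: mult_2 distrib_right)
    qed
    have v2: "(\<integral>\<^sup>+x. (v x)\<^sup>2 \<partial>lborel) = 1 + 2 * ennreal t * (\<integral>\<^sup>+x. u x * indicator S x \<partial>lborel) + ennreal (t\<^sup>2) * ennreal s"
    proof -
      have "(v x)\<^sup>2 = (u x)\<^sup>2 + 2 * ennreal t * (u x * indicator S x) + ennreal (t\<^sup>2) * indicator S x" for x
        using t by (auto simp: v_def indicator_def power2_eq_square ennreal_mult algebra_simps mult_2)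
      then have "(\<integral>\<^sup>+x. (v x)\<^sup>2 \<partial>lborel)
         = (\<integral>\<^sup>+x. ((u x)\<^sup>2 + 2 * ennreal t * (u x * indicator S x)) + ennreal (t\<^sup>2) * indicator S x \<partial>lborel)" by simp
      also have "\<dots> = (\<integral>\<^sup>+x. (u x)\<^sup>2 + 2 * ennreal t * (u x * indicator S x) \<partial>lborel) + (\<integral>\<^sup>+x. ennreal (t\<^sup>2) * indicator S x \<partial>lborel)"
        by (rule nn_integral_add) measurable
      also have "(\<integral>\<^sup>+x. (u x)\<^sup>2 + 2 * ennreal t * (u x * indicator S x) \<partial>lborel)
         = (\<integral>\<^sup>+x. (u x)\<^sup>2 \<partial>lborel) + (\<integral>\<^sup>+x. 2 * ennreal t * (u x * indicator S x) \<partial>lborel)"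
        by (rule nn_integral_add) measurable
      also have "(\<integral>\<^sup>+x. 2 * ennreal t * (u x * indicator S x) \<partial>lborel) = 2 * ennreal t * (\<integral>\<^sup>+x. u x * indicator S x \<partial>lborel)"
        by (rule nn_integral_cmult) measurable
      also have "(\<integral>\<^sup>+x. ennreal (t\<^sup>2) * indicator S x \<partial>lborel) = ennreal (t\<^sup>2) * ennreal s"
        by (simp add: nn_integral_cmult_indicator s)
      finally show ?thesis unfolding u1 .
    qed
    show "ennreal c \<le> (\<integral>\<^sup>+x. u x * indicator S x \<partial>lborel)"
    proof (cases "\<integral>\<^sup>+x. u x * indicator S x \<partial>lborel")
      case (real i)
      have v2': "(\<integral>\<^sup>+x. (v x)\<^sup>2 \<partial>lborel) = ennreal (1 + 2 * t * i + t\<^sup>2 * s)"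
        unfolding v2 real(2) using t real s
        by (simp add: ennreal_plus ennreal_mult)
      have "energy \<beta> v v \<le> ennreal l * ennreal (1 + 2 * t * i + t\<^sup>2 * s)"
        unfolding v2'[symmetric] l(1)[symmetric]
        by (rule energy_le_riesz_top_mass) (use u0 S v2' in \<open>auto simp: v_def indicator_def\<close>)
      then have "ennreal E + 2 * ennreal t * ennreal c0 \<le> ennreal l * ennreal (1 + 2 * t * i + t\<^sup>2 * s)"
        using Ev E by (metis order_trans)
      moreover have "ennreal E + 2 * ennreal t * ennreal c0 = ennreal (E + 2 * t * c0)"
        using E t c0 by (simp add: ennreal_plus ennreal_mult)
      moreover have "ennreal l * ennreal (1 + 2 * t * i + t\<^sup>2 * s) = ennreal (l * (1 + 2 * t * i + t\<^sup>2 * s))"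
        using l by (simp add: ennreal_mult')
      ultimately have "E + 2 * t * c0 \<le> l * (1 + 2 * t * i + t\<^sup>2 * s)"
        using l t s real by (simp add: ennreal_le_iff)
      then have "2 * t * c0 \<le> \<eta> + 2 * l * t * i + t * (l * t * s)"
        using lE by (simp add: algebra_simps power2_eq_square)
      also have "t * (l * t * s) = t * c0 / 2" using t(2) by simp
      finally have "t * c0 \<le> t * (2 * l * i)" using \<eta>(3) by (simp add: algebra_simps)
      then have "2 * l * c \<le> 2 * l * i" using t c by (simp add: mult_le_cancel_left_pos)
      then have "c \<le> i" using l by (simp add: mult_le_cancel_left_pos)
      then show ?thesis using real by (simp add: ennreal_leI)
    qed simp
  qed
qed

section \<open>Strict gain, and sets that admit none\<close>

lemma exists_positive_level:
  fixes f :: "'a::euclidean_space \<Rightarrow> real"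
  assumes [measurable]: "f \<in> borel_measurable borel" "A \<in> sets borel"
    and A: "emeasure lborel A \<noteq> 0" "\<And>x. x \<in> A \<Longrightarrow> 0 < f x"
  obtains \<rho> where "0 < \<rho>" "emeasure lborel {x \<in> A. \<rho> \<le> f x} \<noteq> 0"
proof -
  have "\<exists>n. emeasure lborel {x \<in> A. 1 / real (Suc n) \<le> f x} \<noteq> 0"
  proof (rule ccontr)
    assume "\<not> ?thesis"
    then have "emeasure lborel (\<Union>n. {x \<in> A. 1 / real (Suc n) \<le> f x}) = 0"
      by (intro emeasure_UN_eq_0) (auto intro!: measurable_sets_borel)
    also have "(\<Union>n. {x \<in> A. 1 / real (Suc n) \<le> f x}) = A"
    proof (intro equalityI subsetI)
      fix x assume x: "x \<in> A"
      obtain n where "1 / real (Suc n) < f x" using reals_Archimedean[OF A(2)[OF x]] by (auto simp: inverse_eq_divide)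
      then show "x \<in> (\<Union>n. {x \<in> A. 1 / real (Suc n) \<le> f x})" using x by (auto intro: less_imp_le)
    qed auto
    finally show False using A by simp
  qed
  then show thesis using that[of "1 / real (Suc _)"] by fastforce
qed

text \<open>Points of \<open>\<Omega>\<close> whose mirror images miss \<open>\<Omega>\<close> exist on both sides. Restrict them to sets \<open>S\<close> and \<open>T\<close> at
  a positive distance from the mirror, so that the kernel gap is uniform. Near-maximizers have a fixed mass on
  \<open>S\<close> and on \<open>T\<close>, hence gain a fixed amount of energy when polarized.\<close>

lemma riesz_top_polarize_less:
  fixes \<Omega> :: "'a::euclidean_space set"
  assumes \<beta>: "0 < \<beta>" "\<beta> < real DIM('a)" and \<Omega> [measurable]: "\<Omega> \<in> sets borel" and bd: "bounded \<Omega>" and w: "w \<noteq> 0"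
    and P: "emeasure lborel {x \<in> \<Omega>. offset w t x < 0 \<and> reflect w t x \<notin> \<Omega>} \<noteq> 0"
    and Q: "emeasure lborel {x \<in> \<Omega>. 0 < offset w t x \<and> reflect w t x \<notin> \<Omega>} \<noteq> 0"
  shows "riesz_top \<beta> \<Omega> < riesz_top \<beta> (polarize_set w t \<Omega>)"
proof -
  obtain R where R: "0 < R" "\<Omega> \<subseteq> ball 0 R" using bd bounded_subset_ballD by blast
  let ?s = "reflect w t"
  let ?P = "{x \<in> \<Omega>. offset w t x < 0 \<and> ?s x \<notin> \<Omega>}" and ?Q = "{x \<in> \<Omega>. 0 < offset w t x \<and> ?s x \<notin> \<Omega>}"
  have [measurable]: "?P \<in> sets borel" "?Q \<in> sets borel" by measurable
  obtain \<rho>1 where \<rho>1: "0 < \<rho>1" "emeasure lborel {x \<in> ?P. \<rho>1 \<le> - offset w t x} \<noteq> 0"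
    by (rule exists_positive_level[of "\<lambda>x. - offset w t x" ?P]) (use P in auto)
  obtain \<rho>2 where \<rho>2: "0 < \<rho>2" "emeasure lborel {x \<in> ?Q. \<rho>2 \<le> offset w t x} \<noteq> 0"
    by (rule exists_positive_level[of "offset w t" ?Q]) (use Q in auto)
  define S T where "S = {x \<in> ?P. \<rho>1 \<le> - offset w t x}" and "T = {x \<in> ?Q. \<rho>2 \<le> offset w t x}"
  have [measurable]: "S \<in> sets borel" "T \<in> sets borel" unfolding S_def T_def by measurable
  have "S \<subseteq> \<Omega>" "T \<subseteq> \<Omega>" by (auto simp: S_def T_def)
  obtain c1 \<eta>1 where 1: "0 < c1" "0 < \<eta>1"
    "\<And>u. u \<in> trial \<Omega> \<Longrightarrow> riesz_top \<beta> \<Omega> \<le> energy \<beta> u u + ennreal \<eta>1 \<Longrightarrow>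
        ennreal c1 \<le> (\<integral>\<^sup>+x. u x * indicator S x \<partial>lborel)"
    using near_maximizer_mass_on[OF \<beta> \<Omega> R _ \<open>S \<subseteq> \<Omega>\<close> \<rho>1(2)[folded S_def]] \<open>S \<in> sets borel\<close> by metis
  obtain c2 \<eta>2 where 2: "0 < c2" "0 < \<eta>2"
    "\<And>u. u \<in> trial \<Omega> \<Longrightarrow> riesz_top \<beta> \<Omega> \<le> energy \<beta> u u + ennreal \<eta>2 \<Longrightarrow>
        ennreal c2 \<le> (\<integral>\<^sup>+x. u x * indicator T x \<partial>lborel)"
    using near_maximizer_mass_on[OF \<beta> \<Omega> R _ \<open>T \<subseteq> \<Omega>\<close> \<rho>2(2)[folded T_def]] \<open>T \<in> sets borel\<close> by metis
  have c: "0 < \<rho>1 * \<rho>2 * (norm w)\<^sup>2" using \<rho>1 \<rho>2 w by simp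
  have R2: "0 < 2 * R" using R by simp
  obtain \<kappa> where \<kappa>: "0 < \<kappa>"
    "\<And>(p :: 'a) (q :: 'a). (norm p)\<^sup>2 + \<rho>1 * \<rho>2 * (norm w)\<^sup>2 \<le> (norm q)\<^sup>2 \<Longrightarrow> norm q \<le> 2 * R \<Longrightarrow>
       riesz_kernel \<beta> q + ennreal \<kappa> \<le> riesz_kernel \<beta> p"
    using riesz_kernel_gap[OF \<beta>(1) R2 c, where ?'a = 'a] by blast
  \<comment> \<open>\<open>T\<close> lies on the side that loses under polarization, its mirror image on the favoured side\<close>
  define T' where "T' = {y. ?s y \<in> T}"
  have [measurable]: "T' \<in> sets borel" unfolding T'_def by measurable
  define g where "g = \<kappa> * (c1 * c2) / 4"
  have g: "0 < g" "\<kappa> * (c1 * c2) = 4 * g" using \<kappa> 1 2 by (auto simp: g_def)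
  define \<eta> where "\<eta> = min (min \<eta>1 \<eta>2) (g / 2)"
  have \<eta>: "0 < \<eta>" "\<eta> \<le> \<eta>1" "\<eta> \<le> \<eta>2" "\<eta> \<le> g / 2" using g 1 2 by (auto simp: \<eta>_def)
  have fin\<Omega>: "emeasure lborel \<Omega> < \<infinity>"
    using emeasure_mono[OF R(2), of lborel] emeasure_lborel_ball_finite[of "0::'a" R] by (auto intro: le_less_trans)
  have pos\<Omega>: "emeasure lborel \<Omega> \<noteq> 0"
    using P emeasure_mono[of ?P \<Omega> lborel] by auto
  have lpos: "0 < riesz_top \<beta> \<Omega>" using \<beta> R pos\<Omega> by (intro riesz_top_pos[OF _ \<Omega> R]) auto
  obtain l where l: "riesz_top \<beta> \<Omega> = ennreal l" "0 < l"
    using riesz_top_finite[OF \<beta> \<Omega> fin\<Omega>] lpos by (cases "riesz_top \<beta> \<Omega>") auto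
  have "ennreal (l - \<eta>) < riesz_top \<beta> \<Omega>" using l \<eta> by (simp add: ennreal_less_iff ennreal_lessI)
  then obtain u where u: "u \<in> trial \<Omega>" "ennreal (l - \<eta>) < energy \<beta> u u"
    unfolding riesz_top_def less_SUP_iff by blast
  have [measurable]: "u \<in> borel_measurable borel" and u0: "\<And>x. x \<notin> \<Omega> \<Longrightarrow> u x = 0" using u by (auto simp: trial_def)
  have near: "riesz_top \<beta> \<Omega> \<le> energy \<beta> u u + ennreal \<eta>"
  proof -
    have "ennreal l \<le> ennreal (l - \<eta>) + ennreal \<eta>"
      using \<eta> by (cases "\<eta> \<le> l") (simp_all add: ennreal_neg ennreal_leI flip: ennreal_plus)
    also have "\<dots> \<le> energy \<beta> u u + ennreal \<eta>" using u by (intro add_right_mono less_imp_le)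
    finally show ?thesis using l by simp
  qed
  have "ennreal c1 \<le> (\<integral>\<^sup>+x. u x * indicator S x \<partial>lborel)"
    by (intro 1(3) u(1) order_trans[OF near] add_left_mono ennreal_leI \<eta>(2))
  moreover have "ennreal c2 \<le> (\<integral>\<^sup>+y. u (?s y) * indicator T' y \<partial>lborel)"
  proof -
    have "ennreal c2 \<le> (\<integral>\<^sup>+x. u x * indicator T x \<partial>lborel)"
      by (intro 2(3) u(1) order_trans[OF near] add_left_mono ennreal_leI \<eta>(3))
    also have "\<dots> = (\<integral>\<^sup>+x. u (?s x) * indicator T (?s x) \<partial>lborel)"
      by (rule nn_integral_reflect[OF _ w, symmetric]) measurable
    also have "\<dots> = (\<integral>\<^sup>+y. u (?s y) * indicator T' y \<partial>lborel)"
      by (intro nn_integral_cong) (simp add: T'_def indicator_def)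
    finally show ?thesis .
  qed
  ultimately have prod: "ennreal c1 * ennreal c2 \<le> (\<integral>\<^sup>+x. u x * indicator S x \<partial>lborel) * (\<integral>\<^sup>+y. u (?s y) * indicator T' y \<partial>lborel)"
    by (intro mult_mono) auto
  have gain: "4 * energy \<beta> u u + ennreal \<kappa> * (\<integral>\<^sup>+x. u x * indicator S x \<partial>lborel) * (\<integral>\<^sup>+y. u (?s y) * indicator T' y \<partial>lborel)
    \<le> 4 * energy \<beta> (polarize w t u) (polarize w t u)"
  proof (rule energy_polarize_gain[OF _ _ _ _ w])
    fix x y assume x: "x \<in> S" and y: "y \<in> T'"
    have oy: "offset w t (?s y) = - offset w t y" using w by (rule offset_reflect)
    have "\<rho>1 * \<rho>2 \<le> (- offset w t x) * (- offset w t y)"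
      using x y \<rho>1 \<rho>2 oy by (intro mult_mono) (auto simp: S_def T'_def T_def)
    then have "\<rho>1 * \<rho>2 * (norm w)\<^sup>2 \<le> offset w t x * offset w t y * (norm w)\<^sup>2"
      by (intro mult_right_mono) auto
    then have 1: "(norm (x - y))\<^sup>2 + \<rho>1 * \<rho>2 * (norm w)\<^sup>2 \<le> (norm (x - ?s y))\<^sup>2"
      using dist_reflect_sq[of x w t y] by linarith
    have "norm (x - ?s y) \<le> norm x + norm (?s y)" by (rule norm_triangle_ineq4)
    also have "\<dots> \<le> R + R" using x y R \<open>S \<subseteq> \<Omega>\<close> \<open>T \<subseteq> \<Omega>\<close> by (intro add_mono) (auto simp: T'_def)
    finally show "riesz_kernel \<beta> (x - ?s y) + ennreal \<kappa> \<le> riesz_kernel \<beta> (x - y)"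
      by (intro \<kappa>(2)[OF 1]) simp
  next
    fix y assume "y \<in> T'"
    then have "0 < offset w t (?s y)" "y \<notin> \<Omega>" using w by (auto simp: T'_def T_def)
    then show "offset w t y \<le> 0 \<and> u y = 0" using u0[of y] offset_reflect[OF w, of t y] by auto
  qed (use \<beta> u0 in \<open>auto simp: S_def\<close>)
  have "4 * energy \<beta> u u + ennreal (4 * g) \<le> 4 * riesz_top \<beta> (polarize_set w t \<Omega>)"
  proof -
    have "ennreal (4 * g) = ennreal \<kappa> * (ennreal c1 * ennreal c2)"
      using \<kappa> 1 2 by (simp add: ennreal_mult flip: g(2))
    also have "\<dots> \<le> ennreal \<kappa> * ((\<integral>\<^sup>+x. u x * indicator S x \<partial>lborel) * (\<integral>\<^sup>+y. u (?s y) * indicator T' y \<partial>lborel))"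
      by (rule mult_left_mono[OF prod]) simp
    finally have "4 * energy \<beta> u u + ennreal (4 * g) \<le> 4 * energy \<beta> (polarize w t u) (polarize w t u)"
      using gain by (simp only: mult.assoc) (rule order_trans[OF add_left_mono])
    also have "\<dots> \<le> 4 * riesz_top \<beta> (polarize_set w t \<Omega>)"
      by (intro mult_left_mono energy_le_riesz_top polarize_trial u w) simp
    finally show ?thesis .
  qed
  moreover have "ennreal (4 * g) = 4 * ennreal g" using g by (simp add: ennreal_mult)
  ultimately have le: "energy \<beta> u u + ennreal g \<le> riesz_top \<beta> (polarize_set w t \<Omega>)"
    by (simp only: distrib_left[symmetric] ennreal_cancel_numeral)
  show ?thesis
  proof (rule ccontr)
    assume "\<not> ?thesis"
    then have "energy \<beta> u u + ennreal g \<le> ennreal l" using le l by (simp add: not_less)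
    then have "energy \<beta> u u + ennreal g \<le> energy \<beta> u u + ennreal \<eta>"
      by (rule order_trans[OF _ near[unfolded l(1)]])
    moreover have "energy \<beta> u u < \<infinity>" using energy_le_riesz_top[OF u(1), of \<beta>] l by (auto intro: le_less_trans)
    ultimately have "ennreal g \<le> ennreal \<eta>" by (auto simp: ennreal_add_left_cancel_le)
    then show False using g \<eta> by simp
  qed
qed

text \<open>The offset is an affine function, so its integral over \<open>\<Omega>\<close> has the sign of its value at the centroid. If
  almost all of the half of \<open>\<Omega>\<close> with negative offset were reflected into \<open>\<Omega>\<close>, the negative part of this
  integral would be balanced by the positive part.\<close>

lemma centroid_side_not_null:
  fixes \<Omega> :: "'a::euclidean_space set"
  assumes \<Omega> [measurable]: "\<Omega> \<in> sets borel" and bd: "bounded \<Omega>" and pos: "emeasure lborel \<Omega> \<noteq> 0" and w: "w \<noteq> 0"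
    and c: "c = (1 / measure lborel \<Omega>) *\<^sub>R (\<integral>z. indicator \<Omega> z *\<^sub>R z \<partial>lborel)"
    and dc: "offset w t c < 0"
  shows "emeasure lborel {x \<in> \<Omega>. offset w t x < 0 \<and> reflect w t x \<notin> \<Omega>} \<noteq> 0"
proof
  let ?s = "reflect w t" and ?P = "{x \<in> \<Omega>. offset w t x < 0 \<and> reflect w t x \<notin> \<Omega>}"
  assume null: "emeasure lborel ?P = 0"
  obtain R where R: "0 < R" "\<Omega> \<subseteq> ball 0 R" using bd bounded_subset_ballD by blast
  have fin: "emeasure lborel \<Omega> < \<infinity>"
    using emeasure_mono[OF R(2), of lborel] emeasure_lborel_ball_finite[of "0::'a" R] by (auto intro: le_less_trans)
  define m where "m = measure lborel \<Omega>"
  have m: "0 < m" using fin pos by (simp add: m_def measure_def enn2real_positive_iff zero_less_iff_neq_zero less_top)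
  have int1: "integrable lborel (indicator \<Omega> :: 'a \<Rightarrow> real)" using fin by simp
  have int: "integrable lborel (\<lambda>z. indicator \<Omega> z *\<^sub>R z)"
  proof (rule Bochner_Integration.integrable_bound)
    show "integrable lborel (\<lambda>z. R * indicator \<Omega> z :: real)" using int1 by simp
    show "AE z in lborel. norm (indicator \<Omega> z *\<^sub>R z) \<le> norm (R * indicator \<Omega> z)"
      using R by (intro AE_I2) (auto simp: indicator_def)
  qed measurable
  define f where "f z = indicator \<Omega> z * offset w t z" for z
  have [measurable]: "f \<in> borel_measurable borel" unfolding f_def by measurable
  have f_eq: "f z = 2 / (w \<bullet> w) * ((indicator \<Omega> z *\<^sub>R z) \<bullet> w) - t * indicator \<Omega> z" for z
    by (simp add: f_def offset_def algebra_simps)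
  have i1: "integrable lborel (\<lambda>z. 2 / (w \<bullet> w) * ((indicator \<Omega> z *\<^sub>R z) \<bullet> w))"
    by (intro integrable_mult_right integrable_inner_left int)
  have i2: "integrable lborel (\<lambda>z. t * indicator \<Omega> z)" by (intro integrable_mult_right int1)
  have intf: "integrable lborel f"
    unfolding f_eq[abs_def] using i1 i2 by (rule Bochner_Integration.integrable_diff)
  have "integral\<^sup>L lborel f = 2 / (w \<bullet> w) * ((\<integral>z. indicator \<Omega> z *\<^sub>R z \<partial>lborel) \<bullet> w) - t * m"
    unfolding f_eq[abs_def] Bochner_Integration.integral_diff[OF i1 i2] integral_mult_right_zero
      integral_inner_left[OF int] by (simp add: m_def)
  also have "(\<integral>z. indicator \<Omega> z *\<^sub>R z \<partial>lborel) = m *\<^sub>R c" using m by (simp add: c m_def)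
  also have "2 / (w \<bullet> w) * ((m *\<^sub>R c) \<bullet> w) - t * m = m * offset w t c" by (simp add: offset_def algebra_simps)
  also have "\<dots> < 0" using m dc by (rule mult_pos_neg)
  finally have neg: "integral\<^sup>L lborel f < 0" .
  have "AE z in lborel. z \<notin> ?P" using null by (intro AE_not_in) (auto intro!: null_setsI)
  then have "(\<integral>\<^sup>+z. ennreal (- f z) \<partial>lborel) \<le> (\<integral>\<^sup>+z. ennreal (f (?s z)) \<partial>lborel)"
  proof (intro nn_integral_mono_AE, elim AE_mp, intro AE_I2 impI)
    fix z assume z: "z \<notin> ?P"
    show "ennreal (- f z) \<le> ennreal (f (?s z))"
    proof (cases "z \<in> \<Omega> \<and> offset w t z < 0")
      case True
      then show ?thesis using z by (auto simp: f_def offset_reflect[OF w])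
    next
      case False
      then have "- f z \<le> 0" by (auto simp: f_def indicator_def)
      then show ?thesis by (simp add: ennreal_neg)
    qed
  qed
  also have "\<dots> = (\<integral>\<^sup>+z. ennreal (f z) \<partial>lborel)" by (rule nn_integral_reflect[OF _ w]) measurable
  finally have "(\<integral>\<^sup>+z. ennreal (- f z) \<partial>lborel) \<le> (\<integral>\<^sup>+z. ennreal (f z) \<partial>lborel)" .
  moreover have "(\<integral>\<^sup>+z. ennreal (f z) \<partial>lborel) < \<infinity>"
    using intf unfolding real_integrable_def by (auto simp: top.not_eq_extremum)
  ultimately have "0 \<le> integral\<^sup>L lborel f"
    unfolding real_lebesgue_integral_def[OF intf] by (simp add: enn2real_mono)
  then show False using neg by simp
qed

lemma emeasure_lborel_open_pos:
  fixes \<Omega> :: "'a::euclidean_space set"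
  assumes "open \<Omega>" "\<Omega> \<noteq> {}"
  shows "emeasure lborel \<Omega> \<noteq> 0"
proof -
  obtain y \<rho> where y: "0 < \<rho>" "ball y \<rho> \<subseteq> \<Omega>" using assms by (meson open_contains_ball ex_in_conv)
  then have "emeasure lborel (ball y \<rho>) \<le> emeasure lborel \<Omega>" using assms by (intro emeasure_mono) auto
  moreover have "emeasure lborel (ball y \<rho>) \<noteq> 0"
    using y(1) unit_ball_vol_pos[of "real DIM('a)"] by (simp add: emeasure_ball ennreal_eq_0_iff mult_le_0_iff not_le)
  ultimately show ?thesis by auto
qed

text \<open>Let \<open>y \<in> \<Omega>\<close> and let \<open>x\<close> be closer to the centroid than \<open>y\<close>. In the hyperplane that exchanges \<open>x\<close> and \<open>y\<close>,
  the half of \<open>\<Omega>\<close> on the side of the centroid is not reflected into \<open>\<Omega>\<close>, so the half containing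
  \<open>y\<close> is, and a neighbourhood of \<open>y\<close> contained in \<open>\<Omega>\<close> yields a neighbourhood of \<open>x\<close> almost contained in \<open>\<Omega>\<close>. Taking
  for \<open>y\<close> points whose distances to the centroid approach their supremum gives the ball.\<close>

lemma ball_if_one_sided:
  fixes \<Omega> :: "'a::euclidean_space set"
  assumes "open \<Omega>" "bounded \<Omega>" "\<Omega> \<noteq> {}"
    and side: "\<And>w t. w \<noteq> 0 \<Longrightarrow>
        emeasure lborel {x \<in> \<Omega>. offset w t x < 0 \<and> reflect w t x \<notin> \<Omega>} = 0 \<or>
        emeasure lborel {x \<in> \<Omega>. 0 < offset w t x \<and> reflect w t x \<notin> \<Omega>} = 0"
  obtains c r where "0 < r" "\<Omega> \<subseteq> ball c r" "negligible (ball c r - \<Omega>)"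
proof -
  have \<Omega> [measurable]: "\<Omega> \<in> sets borel" using assms by simp
  have pos: "emeasure lborel \<Omega> \<noteq> 0" by (rule emeasure_lborel_open_pos[OF assms(1,3)])
  define c where "c = (1 / measure lborel \<Omega>) *\<^sub>R (\<integral>z. indicator \<Omega> z *\<^sub>R z \<partial>lborel)"
  have nbhd: "\<exists>\<rho>>0. negligible (ball x \<rho> - \<Omega>)" if y: "y \<in> \<Omega>" and xy: "dist c x < dist c y" for x y
  proof -
    define w where "w = y - x"
    have w: "w \<noteq> 0" using xy by (auto simp: w_def)
    \<comment> \<open>offset 1 at \<open>y\<close> means that the mirror image of \<open>y\<close> is \<open>y - w = x\<close>\<close>
    define t where "t = 2 * (y \<bullet> w) / (w \<bullet> w) - 1"
    have oy: "offset w t y = 1" by (simp add: offset_def t_def)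
    then have sy: "reflect w t y = x" by (simp add: reflect_def w_def)
    have "(norm (c - x))\<^sup>2 = (norm (c - y))\<^sup>2 + offset w t c * (norm w)\<^sup>2"
      using dist_reflect_sq[of c w t y] by (simp add: sy oy)
    moreover have "(norm (c - x))\<^sup>2 < (norm (c - y))\<^sup>2"
      using xy by (intro power_strict_mono) (auto simp: dist_norm)
    ultimately have "offset w t c * (norm w)\<^sup>2 < 0" by linarith
    then have "offset w t c < 0" using w by (simp add: mult_less_0_iff)
    then have Q: "emeasure lborel {x \<in> \<Omega>. 0 < offset w t x \<and> reflect w t x \<notin> \<Omega>} = 0" (is "emeasure _ ?Q = 0")
      using side[OF w, of t] centroid_side_not_null[OF \<Omega> assms(2) pos w c_def] by blast
    have [measurable]: "?Q \<in> sets borel" by measurable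
    have op: "open ({z. 0 < offset w t z} \<inter> \<Omega>)"
      using assms(1) unfolding offset_def by (intro open_Int open_Collect_less continuous_intros) (use w in auto)
    have "y \<in> {z. 0 < offset w t z} \<inter> \<Omega>" using y oy by simp
    then obtain \<rho> where \<rho>: "0 < \<rho>" "ball y \<rho> \<subseteq> {z. 0 < offset w t z} \<inter> \<Omega>"
      using op unfolding open_contains_ball by blast
    have sub: "ball x \<rho> - \<Omega> \<subseteq> {z. reflect w t z \<in> ?Q}"
    proof
      fix z assume z: "z \<in> ball x \<rho> - \<Omega>"
      have "norm (reflect w t z - y) = norm (z - x)" using dist_reflect_swap[OF w, of t z y] sy by simp
      then have "reflect w t z \<in> ball y \<rho>" using z by (simp add: dist_norm norm_minus_commute)
      then show "z \<in> {z. reflect w t z \<in> ?Q}" using \<rho> z w by auto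
    qed
    have [measurable]: "{z. reflect w t z \<in> ?Q} \<in> sets borel" by measurable
    have "emeasure lborel {z. reflect w t z \<in> ?Q} = (\<integral>\<^sup>+z. indicator ?Q (reflect w t z) \<partial>lborel)"
    proof -
      have "indicator ?Q (reflect w t z) = (indicator {z. reflect w t z \<in> ?Q} z :: ennreal)" for z
        by (simp only: indicator_def mem_Collect_eq)
      then show ?thesis by (simp only: nn_integral_indicator sets_lborel \<open>{z. reflect w t z \<in> ?Q} \<in> sets borel\<close>)
    qed
    also have "\<dots> = (\<integral>\<^sup>+z. indicator ?Q z \<partial>lborel)" by (rule nn_integral_reflect[OF _ w]) measurable
    also have "\<dots> = 0" using Q by (subst nn_integral_indicator) auto
    finally have "{z. reflect w t z \<in> ?Q} \<in> null_sets lborel" by (auto intro!: null_setsI)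
    then have "negligible {z. reflect w t z \<in> ?Q}"
      by (simp add: negligible_iff_null_sets null_sets_completion_iff)
    then show ?thesis using sub \<rho>(1) negligible_subset by blast
  qed
  define r where "r = (SUP y\<in>\<Omega>. dist c y)"
  have bdd: "bdd_above (dist c ` \<Omega>)"
    using assms(2) unfolding bounded_any_center[of \<Omega> c] by (auto intro: bdd_aboveI2)
  have "\<Omega> \<subseteq> cball c r" using bdd by (auto simp: r_def intro: cSUP_upper)
  then have sub: "\<Omega> \<subseteq> ball c r" using interior_maximal[OF _ assms(1)] interior_cball by metis
  then have r: "0 < r" using assms(3) by (metis ball_eq_empty not_le subset_empty)
  have "negligible (ball c r - \<Omega>)"
    unfolding locally_negligible_alt[of "ball c r - \<Omega>"]
  proof
    fix x assume x: "x \<in> ball c r - \<Omega>"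
    then have "dist c x < r" by simp
    then obtain y where y: "y \<in> \<Omega>" "dist c x < dist c y"
      unfolding r_def less_cSUP_iff[OF assms(3) bdd] by blast
    then obtain \<rho> where \<rho>: "0 < \<rho>" "negligible (ball x \<rho> - \<Omega>)" using nbhd by blast
    show "\<exists>U. openin (top_of_set (ball c r - \<Omega>)) U \<and> x \<in> U \<and> negligible U"
    proof (intro exI[of _ "(ball c r - \<Omega>) \<inter> ball x \<rho>"] conjI)
      show "openin (top_of_set (ball c r - \<Omega>)) ((ball c r - \<Omega>) \<inter> ball x \<rho>)" by (intro openin_open_Int) simp
      show "x \<in> (ball c r - \<Omega>) \<inter> ball x \<rho>" using x \<rho> by auto
      show "negligible ((ball c r - \<Omega>) \<inter> ball x \<rho>)" by (rule negligible_subset[OF \<rho>(2)]) auto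
    qed
  qed
  then show thesis using that r sub by blast
qed

section \<open>Passage to square-integrable functions and the theorem\<close>

lemma nn_integral_lebesgue_on:
  fixes f :: "'a::euclidean_space \<Rightarrow> ennreal"
  assumes "\<Omega> \<in> sets borel"
  shows "(\<integral>\<^sup>+x. f x \<partial>lebesgue_on \<Omega>) = (\<integral>\<^sup>+x. f x * indicator \<Omega> x \<partial>lborel)"
  using assms by (subst nn_integral_restrict_space) (auto simp: nn_integral_completion)

lemma ennreal_abs_integral_le:
  fixes f :: "'b \<Rightarrow> real"
  shows "ennreal \<bar>integral\<^sup>L M f\<bar> \<le> (\<integral>\<^sup>+x. ennreal \<bar>f x\<bar> \<partial>M)"
proof (cases "integrable M f")
  case True
  then show ?thesis using integral_norm_bound_ennreal[OF True] by simp
qed (simp add: not_integrable_integral_eq)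

text \<open>Null sets, among them the diagonal on which the two kernels differ, do not affect the iterated integrals.\<close>

lemma nn_riesz_form_eq_energy:
  fixes \<Omega> :: "'a::euclidean_space set" and f :: "'a \<Rightarrow> real"
  assumes \<Omega>: "\<Omega> \<in> sets borel" and v: "AE x in lborel. v x = ennreal \<bar>f x\<bar> * indicator \<Omega> x"
  shows "(\<integral>\<^sup>+x. (\<integral>\<^sup>+y. ennreal \<bar>f x * f y / norm (x - y) powr \<beta>\<bar> \<partial>lebesgue_on \<Omega>) \<partial>lebesgue_on \<Omega>) = energy \<beta> v v"
  unfolding nn_integral_lebesgue_on[OF \<Omega>] energy_def
proof (rule nn_integral_cong_AE, rule AE_mp[OF v], intro AE_I2 impI)
  fix x assume x: "v x = ennreal \<bar>f x\<bar> * indicator \<Omega> x"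
  show "(\<integral>\<^sup>+y. ennreal \<bar>f x * f y / norm (x - y) powr \<beta>\<bar> * indicator \<Omega> y \<partial>lborel) * indicator \<Omega> x
     = (\<integral>\<^sup>+y. v x * v y * riesz_kernel \<beta> (x - y) \<partial>lborel)"
  proof (cases "x \<in> \<Omega>")
    case True
    have "(\<integral>\<^sup>+y. ennreal \<bar>f x * f y / norm (x - y) powr \<beta>\<bar> * indicator \<Omega> y \<partial>lborel)
     = (\<integral>\<^sup>+y. v x * v y * riesz_kernel \<beta> (x - y) \<partial>lborel)"
    proof (rule nn_integral_cong_AE, rule AE_mp[OF v], rule AE_mp[OF AE_lborel_singleton[of x]], intro AE_I2 impI)
      fix y assume "y \<noteq> x" and y: "v y = ennreal \<bar>f y\<bar> * indicator \<Omega> y"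
      then have "riesz_kernel \<beta> (x - y) = ennreal (1 / norm (x - y) powr \<beta>)"
        by (subst riesz_kernel_eq) (auto simp: powr_minus inverse_eq_divide)
      moreover have "\<bar>f x * f y / norm (x - y) powr \<beta>\<bar> = \<bar>f x\<bar> * \<bar>f y\<bar> * (1 / norm (x - y) powr \<beta>)"
        by (simp add: abs_mult)
      moreover have "ennreal (\<bar>f x\<bar> * \<bar>f y\<bar> * (1 / norm (x - y) powr \<beta>))
          = ennreal \<bar>f x\<bar> * ennreal \<bar>f y\<bar> * ennreal (1 / norm (x - y) powr \<beta>)"
        by (subst ennreal_mult, simp, simp, subst ennreal_mult) simp_all
      ultimately have eq: "ennreal \<bar>f x * f y / norm (x - y) powr \<beta>\<bar> = ennreal \<bar>f x\<bar> * ennreal \<bar>f y\<bar> * riesz_kernel \<beta> (x - y)"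
        by (simp only:)
      show "ennreal \<bar>f x * f y / norm (x - y) powr \<beta>\<bar> * indicator \<Omega> y = v x * v y * riesz_kernel \<beta> (x - y)"
        unfolding eq x y using True by (cases "y \<in> \<Omega>") simp_all
    qed
    then show ?thesis using True by simp
  qed (simp add: x)
qed

lemma nn_square_eq:
  fixes \<Omega> :: "'a::euclidean_space set" and f :: "'a \<Rightarrow> real"
  assumes \<Omega>: "\<Omega> \<in> sets borel" and v: "AE x in lborel. v x = ennreal \<bar>f x\<bar> * indicator \<Omega> x"
  shows "(\<integral>\<^sup>+x. ennreal ((f x)\<^sup>2) \<partial>lebesgue_on \<Omega>) = (\<integral>\<^sup>+x. (v x)\<^sup>2 \<partial>lborel)"
  unfolding nn_integral_lebesgue_on[OF \<Omega>]
  by (rule nn_integral_cong_AE) (use v in \<open>auto elim!: eventually_mono simp: indicator_def ennreal_power\<close>)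

text \<open>Lebesgue measurable functions have Borel representatives; replacing \<open>u\<close> by its absolute value keeps the
  norm.\<close>

lemma L2_trial:
  fixes \<Omega> :: "'a::euclidean_space set"
  assumes \<Omega>: "\<Omega> \<in> sets borel" and u: "u \<in> L2_space \<Omega>" "L2_norm_on \<Omega> u = 1"
  obtains v where "v \<in> trial \<Omega>" "AE x in lborel. v x = ennreal \<bar>u x\<bar> * indicator \<Omega> x"
proof -
  have um: "u \<in> borel_measurable (lebesgue_on \<Omega>)" and ui: "integrable (lebesgue_on \<Omega>) (\<lambda>x. (u x)\<^sup>2)"
    using u by (auto simp: L2_space_def)
  have u1: "(LINT x|lebesgue_on \<Omega>. (u x)\<^sup>2) = 1" using u(2) by (simp add: L2_norm_on_def)
  have "(\<lambda>x. if x \<in> \<Omega> then u x else 0) \<in> borel_measurable lebesgue"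
    using um \<Omega> by (intro borel_measurable_if_I) auto
  then obtain g where g [measurable]: "g \<in> borel_measurable lborel" and ug: "AE x in lborel. (if x \<in> \<Omega> then u x else 0) = g x"
    using completion_ex_borel_measurable_real by blast
  define v where "v x = ennreal \<bar>g x\<bar> * indicator \<Omega> x" for x
  have vu: "AE x in lborel. v x = ennreal \<bar>u x\<bar> * indicator \<Omega> x"
    using ug by eventually_elim (auto simp: v_def indicator_def)
  have "(\<integral>\<^sup>+x. (v x)\<^sup>2 \<partial>lborel) = (\<integral>\<^sup>+x. ennreal ((u x)\<^sup>2) \<partial>lebesgue_on \<Omega>)"
    by (rule nn_square_eq[OF \<Omega> vu, symmetric])
  also have "\<dots> = 1" using nn_integral_eq_integral[OF ui] u1 by simp
  finally have "v \<in> trial \<Omega>"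
    using \<Omega> g unfolding trial_def v_def by (auto intro!: borel_measurable_times)
  then show thesis using vu by (rule that)
qed

lemma riesz_form_le_riesz_top:
  fixes \<Omega> :: "'a::euclidean_space set"
  assumes \<Omega>: "\<Omega> \<in> sets borel" and u: "u \<in> L2_space \<Omega>" "L2_norm_on \<Omega> u = 1"
  shows "ennreal \<bar>riesz_form \<alpha> \<Omega> u\<bar> \<le> riesz_top (real DIM('a) - \<alpha>) \<Omega>"
proof -
  let ?\<beta> = "real DIM('a) - \<alpha>"
  obtain v where v: "v \<in> trial \<Omega>" "AE x in lborel. v x = ennreal \<bar>u x\<bar> * indicator \<Omega> x"
    using L2_trial[OF assms] .
  have "ennreal \<bar>riesz_form \<alpha> \<Omega> u\<bar>
     \<le> (\<integral>\<^sup>+x. ennreal \<bar>LINT y|lebesgue_on \<Omega>. u x * u y / norm (x - y) powr ?\<beta>\<bar> \<partial>lebesgue_on \<Omega>)"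
    unfolding riesz_form_def by (rule ennreal_abs_integral_le)
  also have "\<dots> \<le> (\<integral>\<^sup>+x. (\<integral>\<^sup>+y. ennreal \<bar>u x * u y / norm (x - y) powr ?\<beta>\<bar> \<partial>lebesgue_on \<Omega>) \<partial>lebesgue_on \<Omega>)"
    by (intro nn_integral_mono ennreal_abs_integral_le)
  also have "\<dots> = energy ?\<beta> v v" by (rule nn_riesz_form_eq_energy[OF \<Omega> v(2)])
  also have "\<dots> \<le> riesz_top ?\<beta> \<Omega>" by (rule energy_le_riesz_top[OF v(1)])
  finally show ?thesis .
qed

text \<open>Finite energy makes the inner integrals finite almost everywhere, so that the iterated integral of real
  functions, with its convention for divergent integrals, takes the expected value.\<close>

lemma trial_L2:
  fixes \<Omega> :: "'a::euclidean_space set"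
  assumes \<Omega>: "\<Omega> \<in> sets borel" and v: "v \<in> trial \<Omega>" and fin: "energy (real DIM('a) - \<alpha>) v v < \<infinity>"
  obtains u where "u \<in> L2_space \<Omega>" "L2_norm_on \<Omega> u = 1" "ennreal (riesz_form \<alpha> \<Omega> u) = energy (real DIM('a) - \<alpha>) v v"
proof -
  let ?\<beta> = "real DIM('a) - \<alpha>"
  have [measurable]: "v \<in> borel_measurable borel" and v0: "\<And>x. x \<notin> \<Omega> \<Longrightarrow> v x = 0"
    and v1: "(\<integral>\<^sup>+x. (v x)\<^sup>2 \<partial>lborel) = 1" using v by (auto simp: trial_def)
  note \<Omega> [measurable]
  define u where "u x = enn2real (v x)" for x
  have ub [measurable]: "u \<in> borel_measurable borel" unfolding u_def by measurable
  have um [measurable]: "h \<in> borel_measurable (lebesgue_on \<Omega>)" if "h \<in> borel_measurable borel" for h :: "'a \<Rightarrow> real"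
    using that by (intro measurable_restrict_space1 measurable_completion) simp
  have u0: "0 \<le> u x" for x by (simp add: u_def)
  have "AE x in lborel. (v x)\<^sup>2 \<noteq> \<infinity>" using v1 by (intro nn_integral_noteq_infinite) auto
  then have vu: "AE x in lborel. v x = ennreal \<bar>u x\<bar> * indicator \<Omega> x"
  proof eventually_elim
    fix x assume "(v x)\<^sup>2 \<noteq> \<infinity>"
    then have "v x < top" by (cases "v x") (auto simp: power2_eq_square)
    then show "v x = ennreal \<bar>u x\<bar> * indicator \<Omega> x" using v0[of x] by (cases "x \<in> \<Omega>") (auto simp: u_def)
  qed
  have sq: "(\<integral>\<^sup>+x. ennreal ((u x)\<^sup>2) \<partial>lebesgue_on \<Omega>) = 1"
    using nn_square_eq[OF \<Omega> vu] v1 by simp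
  have "u \<in> L2_space \<Omega>"
    unfolding L2_space_def by (intro CollectI conjI um ub integrableI_nonneg) (auto simp: sq intro!: um)
  moreover have "L2_norm_on \<Omega> u = 1"
    unfolding L2_norm_on_def by (subst integral_eq_nn_integral) (auto simp: sq intro!: um)
  moreover have "ennreal (riesz_form \<alpha> \<Omega> u) = energy ?\<beta> v v"
  proof -
    define J where "J x = (\<integral>\<^sup>+y. ennreal (u x * u y / norm (x - y) powr ?\<beta>) * indicator \<Omega> y \<partial>lborel)" for x
    have J [measurable]: "J \<in> borel_measurable borel" unfolding J_def by measurable
    have inner: "(LINT y|lebesgue_on \<Omega>. u x * u y / norm (x - y) powr ?\<beta>) = enn2real (J x)" for x
      unfolding J_def nn_integral_lebesgue_on[OF \<Omega>, symmetric]
      by (rule integral_eq_nn_integral) (auto intro!: um simp: u0)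
    have total: "(\<integral>\<^sup>+x. J x * indicator \<Omega> x \<partial>lborel) = energy ?\<beta> v v"
      using nn_riesz_form_eq_energy[OF \<Omega> vu, of ?\<beta>] by (simp add: J_def u0 nn_integral_lebesgue_on[OF \<Omega>])
    have "AE x in lborel. J x * indicator \<Omega> x \<noteq> \<infinity>"
      using total fin by (intro nn_integral_noteq_infinite) auto
    then have "(\<integral>\<^sup>+x. ennreal (enn2real (J x)) * indicator \<Omega> x \<partial>lborel) = (\<integral>\<^sup>+x. J x * indicator \<Omega> x \<partial>lborel)"
      by (intro nn_integral_cong_AE) (auto elim!: eventually_mono simp: indicator_def less_top)
    then have "(\<integral>\<^sup>+x. ennreal (enn2real (J x)) \<partial>lebesgue_on \<Omega>) = energy ?\<beta> v v"
      by (simp add: nn_integral_lebesgue_on[OF \<Omega>] total)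
    moreover have "riesz_form \<alpha> \<Omega> u = enn2real (\<integral>\<^sup>+x. ennreal (enn2real (J x)) \<partial>lebesgue_on \<Omega>)"
      unfolding riesz_form_def inner by (rule integral_eq_nn_integral) (auto intro!: um)
    ultimately show ?thesis using fin by simp
  qed
  ultimately show thesis by (rule that)
qed

lemma trial_nonempty:
  fixes \<Omega> :: "'a::euclidean_space set"
  assumes "0 < riesz_top \<beta> \<Omega>"
  shows "trial \<Omega> \<noteq> {}"
  using assms by (auto simp: riesz_top_def)

text \<open>Passing from \<open>u\<close> to its absolute value cannot decrease the Riesz form, so nonnegative trial functions
  suffice.\<close>

lemma lambda1_eq_riesz_top:
  fixes \<Omega> :: "'a::euclidean_space set"
  assumes \<alpha>: "0 < \<alpha>" "\<alpha> < real DIM('a)" and \<Omega>: "open \<Omega>" "bounded \<Omega>" "\<Omega> \<noteq> {}"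
  shows "ennreal (lambda1 \<alpha> \<Omega>) = riesz_top (real DIM('a) - \<alpha>) \<Omega>"
proof -
  let ?\<beta> = "real DIM('a) - \<alpha>"
  have B: "\<Omega> \<in> sets borel" using \<Omega> by simp
  obtain R where R: "0 < R" "\<Omega> \<subseteq> ball 0 R" using \<Omega>(2) bounded_subset_ballD by blast
  have fin: "emeasure lborel \<Omega> < \<infinity>"
    using emeasure_mono[OF R(2), of lborel] emeasure_lborel_ball_finite[of "0::'a" R] by (auto intro: le_less_trans)
  have pos: "emeasure lborel \<Omega> \<noteq> 0" by (rule emeasure_lborel_open_pos[OF \<Omega>(1,3)])
  have top: "riesz_top ?\<beta> \<Omega> < \<infinity>" using \<alpha> B fin by (intro riesz_top_finite) auto
  have "0 < riesz_top ?\<beta> \<Omega>" using \<alpha> by (intro riesz_top_pos[OF _ B R pos]) auto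
  then have ne: "trial \<Omega> \<noteq> {}" by (rule trial_nonempty)
  let ?X = "{riesz_form \<alpha> \<Omega> u | u. u \<in> L2_space \<Omega> \<and> L2_norm_on \<Omega> u = 1}"
  have fin_energy: "energy ?\<beta> v v < \<infinity>" if "v \<in> trial \<Omega>" for v
    using energy_le_riesz_top[OF that, of ?\<beta>] top by (rule le_less_trans)
  have le: "z \<le> enn2real (riesz_top ?\<beta> \<Omega>)" if zX: "z \<in> ?X" for z
  proof -
    obtain u where u: "u \<in> L2_space \<Omega>" "L2_norm_on \<Omega> u = 1" "z = riesz_form \<alpha> \<Omega> u" using zX by blast
    have "enn2real (ennreal \<bar>z\<bar>) \<le> enn2real (riesz_top ?\<beta> \<Omega>)"
      using riesz_form_le_riesz_top[OF B u(1,2), of \<alpha>] top u(3) by (intro enn2real_mono) auto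
    then show ?thesis by simp
  qed
  have bdd: "bdd_above ?X" using le by (rule bdd_aboveI)
  have "?X \<noteq> {}"
  proof -
    obtain v where v: "v \<in> trial \<Omega>" using ne by blast
    show ?thesis by (rule trial_L2[OF B v fin_energy[OF v]]) blast
  qed
  then have "lambda1 \<alpha> \<Omega> \<le> enn2real (riesz_top ?\<beta> \<Omega>)"
    unfolding lambda1_def by (rule cSup_least) (rule le)
  then have "ennreal (lambda1 \<alpha> \<Omega>) \<le> ennreal (enn2real (riesz_top ?\<beta> \<Omega>))" by (rule ennreal_leI)
  also have "\<dots> = riesz_top ?\<beta> \<Omega>" using top by simp
  finally have 1: "ennreal (lambda1 \<alpha> \<Omega>) \<le> riesz_top ?\<beta> \<Omega>" .
  have 2: "riesz_top ?\<beta> \<Omega> \<le> ennreal (lambda1 \<alpha> \<Omega>)"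
    unfolding riesz_top_def
  proof (rule SUP_least)
    fix v assume v: "v \<in> trial \<Omega>"
    obtain u where u: "u \<in> L2_space \<Omega>" "L2_norm_on \<Omega> u = 1" "ennreal (riesz_form \<alpha> \<Omega> u) = energy ?\<beta> v v"
      by (rule trial_L2[OF B v fin_energy[OF v]])
    have "riesz_form \<alpha> \<Omega> u \<le> lambda1 \<alpha> \<Omega>"
      unfolding lambda1_def by (rule cSup_upper[OF _ bdd]) (use u in blast)
    then show "energy ?\<beta> v v \<le> ennreal (lambda1 \<alpha> \<Omega>)" unfolding u(3)[symmetric] by (rule ennreal_leI)
  qed
  from 1 2 show ?thesis by (rule antisym)
qed

lemma symm_ball_eq:
  fixes \<Omega> :: "'a::euclidean_space set"
  assumes "\<Omega> \<in> sets borel" "emeasure lborel \<Omega> < \<infinity>" "emeasure lborel \<Omega> \<noteq> 0"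
  obtains r where "0 < r" "symm_ball \<Omega> = ball 0 r" "emeasure lborel (ball (0::'a) r) = emeasure lborel \<Omega>"
proof -
  define N where "N = DIM('a)"
  have N: "0 < N" by (simp add: N_def)
  define v where "v = unit_ball_vol (real N)"
  have v: "0 < v" unfolding v_def by (rule unit_ball_vol_pos) simp
  have ball: "emeasure lborel (ball (0::'a) \<rho>) = ennreal (v * \<rho> ^ N)" if "0 \<le> \<rho>" for \<rho>
    using that by (simp add: emeasure_ball v_def N_def)
  have leb: "emeasure lebesgue X = emeasure lborel X" if "X \<in> sets borel" for X :: "'a set"
    using that by simp
  obtain m where m: "emeasure lborel \<Omega> = ennreal m" "0 < m"
    using assms(2,3) by (cases "emeasure lborel \<Omega>") (auto simp: less_le)
  define r where "r = root N (m / v)"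
  have r: "0 < r" "v * r ^ N = m" using N m v by (auto simp: r_def real_root_gt_zero)
  have "(THE r. 0 \<le> r \<and> emeasure lebesgue (ball (0::'a) r) = emeasure lebesgue \<Omega>) = r"
  proof (rule the_equality)
    show "0 \<le> r \<and> emeasure lebesgue (ball (0::'a) r) = emeasure lebesgue \<Omega>"
      using r m assms(1) by (simp add: leb ball)
  next
    fix \<rho> assume \<rho>: "0 \<le> \<rho> \<and> emeasure lebesgue (ball (0::'a) \<rho>) = emeasure lebesgue \<Omega>"
    then have "ennreal (v * \<rho> ^ N) = ennreal m"
      using assms(1) m ball[of \<rho>] leb[of \<Omega>] leb[of "ball 0 \<rho>"] by simp
    moreover have "0 \<le> v * \<rho> ^ N" "0 \<le> m" using \<rho> v m by auto
    ultimately have "v * \<rho> ^ N = v * r ^ N" unfolding r(2) by (simp only: ennreal_inj)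
    then have "\<rho> ^ N = r ^ N" using v by (simp only: mult_cancel_left) simp
    then show "\<rho> = r" using N \<rho> r by (intro power_eq_imp_eq_base[of \<rho> N r]) auto
  qed
  then have "symm_ball \<Omega> = ball 0 r" by (simp add: symm_ball_def)
  moreover have "emeasure lborel (ball (0::'a) r) = emeasure lborel \<Omega>" using r m by (simp add: ball)
  ultimately show thesis using r(1) that by blast
qed

lemma bounded_polarize_set:
  assumes "bounded A" and w: "w \<noteq> 0"
  shows "bounded (polarize_set w t A)"
proof -
  obtain R where R: "\<And>x. x \<in> A \<Longrightarrow> norm x \<le> R" using assms(1) unfolding bounded_iff by blast
  have "norm x \<le> \<bar>R\<bar> + norm (reflect w t 0)" if x: "x \<in> polarize_set w t A" for x
  proof (cases "x \<in> A")
    case True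
    then show ?thesis using R[of x] by (simp add: add_increasing2)
  next
    case False
    then have "reflect w t x \<in> A" using x by (auto simp: polarize_set_def split: if_splits)
    moreover have "norm (x - reflect w t 0) = norm (reflect w t x)"
      using dist_reflect_swap[OF w, of t x 0] by simp
    moreover have "norm x \<le> norm (x - reflect w t 0) + norm (reflect w t 0)"
      using norm_triangle_sub[of x "reflect w t 0"] by simp
    ultimately show ?thesis using R[of "reflect w t x"] by linarith
  qed
  then show ?thesis unfolding bounded_iff by blast
qed

text \<open>A ball that agrees with \<open>\<Omega>\<close> up to a null set has the radius of the symmetrized ball.\<close>

lemma almost_equal_ball:
  fixes \<Omega> :: "'a::euclidean_space set"
  assumes \<Omega>: "\<Omega> \<in> sets borel" "\<Omega> \<subseteq> ball c \<rho>" "negligible (ball c \<rho> - \<Omega>)"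
    and pos: "0 < \<rho>" "0 < r" and eq: "emeasure lborel (ball (0::'a) r) = emeasure lborel \<Omega>"
  shows "almost_equal ((\<lambda>x. c + x) ` ball 0 r) \<Omega>"
proof -
  have "emeasure lborel (ball c \<rho>) = emeasure lborel \<Omega> + emeasure lborel (ball c \<rho> - \<Omega>)"
    using \<Omega>(1,2) by (subst plus_emeasure) (auto intro: arg_cong[where f = "emeasure lborel"])
  also have "emeasure lborel (ball c \<rho> - \<Omega>) = 0"
    using \<Omega> by (intro null_setsD1) (simp add: negligible_iff_null_sets null_sets_completion_iff)
  finally have "emeasure lborel (ball c \<rho>) = emeasure lborel (ball (0::'a) r)" using eq by simp
  then have "unit_ball_vol (real DIM('a)) * \<rho> ^ DIM('a) = unit_ball_vol (real DIM('a)) * r ^ DIM('a)"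
    using pos by (simp add: emeasure_ball)
  then have "\<rho> ^ DIM('a) = r ^ DIM('a)"
    using unit_ball_vol_pos[of "real DIM('a)"] by (simp del: unit_ball_vol_pos)
  then have "\<rho> = r" using pos by (intro power_eq_imp_eq_base[of \<rho> "DIM('a)" r]) auto
  then have "(\<lambda>x. c + x) ` ball 0 r = ball c \<rho>" by (simp add: image_add_ball)
  moreover have "sym_diff (ball c \<rho>) \<Omega> = ball c \<rho> - \<Omega>" using \<Omega>(2) by blast
  ultimately show ?thesis using \<Omega>(3) by (simp add: almost_equal_def negligible_iff_null_sets)
qed

theorem corollary5p3:
  fixes \<Omega> :: "'a::euclidean_space set" and \<alpha> :: real
  assumes "DIM('a) \<ge> 2"
    and "0 < \<alpha>" and "\<alpha> < real DIM('a)"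
    and "open \<Omega>" and "connected \<Omega>" and "\<Omega> \<noteq> {}" and "bounded \<Omega>"
  shows "lambda1 \<alpha> \<Omega> \<le> lambda1 \<alpha> (symm_ball \<Omega>) \<and>
         (lambda1 \<alpha> \<Omega> = lambda1 \<alpha> (symm_ball \<Omega>) \<longrightarrow>
            (\<exists>a. almost_equal ((\<lambda>x. a + x) ` symm_ball \<Omega>) \<Omega>))"
proof -
  define \<beta> where "\<beta> = real DIM('a) - \<alpha>"
  have \<beta>: "0 < \<beta>" "\<beta> < real DIM('a)" using assms by (auto simp: \<beta>_def)
  have \<Omega>: "\<Omega> \<in> sets borel" using assms by simp
  obtain R where R: "0 < R" "\<Omega> \<subseteq> ball 0 R" using assms(7) bounded_subset_ballD by blast
  have fin: "emeasure lborel \<Omega> < \<infinity>"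
    using emeasure_mono[OF R(2), of lborel] emeasure_lborel_ball_finite[of "0::'a" R] by (auto intro: le_less_trans)
  have pos: "emeasure lborel \<Omega> \<noteq> 0" by (rule emeasure_lborel_open_pos[OF assms(4,6)])
  obtain r where r: "0 < r" "symm_ball \<Omega> = ball 0 r" "emeasure lborel (ball (0::'a) r) = emeasure lborel \<Omega>"
    using symm_ball_eq[OF \<Omega> fin pos] .
  have \<Lambda>: "ennreal (lambda1 \<alpha> \<Omega>) = riesz_top \<beta> \<Omega>"
    unfolding \<beta>_def by (rule lambda1_eq_riesz_top) (use assms in auto)
  have \<Lambda>b: "ennreal (lambda1 \<alpha> (symm_ball \<Omega>)) = riesz_top \<beta> (ball (0::'a) r)"
    unfolding \<beta>_def r(2) by (rule lambda1_eq_riesz_top) (use assms r(1) in auto)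
  have le: "riesz_top \<beta> \<Omega> \<le> riesz_top \<beta> (ball (0::'a) r)"
    by (rule riesz_top_le_ball[OF \<beta> \<Omega> assms(7) r(1) r(3)[symmetric]])
  have "0 < riesz_top \<beta> \<Omega>" using \<beta> by (intro riesz_top_pos[OF _ \<Omega> R pos]) simp
  then have "0 < ennreal (lambda1 \<alpha> (symm_ball \<Omega>))" using le \<Lambda>b by simp
  then have "0 < lambda1 \<alpha> (symm_ball \<Omega>)" by simp
  then have "lambda1 \<alpha> \<Omega> \<le> lambda1 \<alpha> (symm_ball \<Omega>)"
    using le[folded \<Lambda> \<Lambda>b] by (simp only: ennreal_le_iff less_imp_le)
  moreover have "\<exists>a. almost_equal ((\<lambda>x. a + x) ` symm_ball \<Omega>) \<Omega>" if eq: "lambda1 \<alpha> \<Omega> = lambda1 \<alpha> (symm_ball \<Omega>)"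
  proof -
    have "emeasure lborel {x \<in> \<Omega>. offset w t x < 0 \<and> reflect w t x \<notin> \<Omega>} = 0 \<or>
        emeasure lborel {x \<in> \<Omega>. 0 < offset w t x \<and> reflect w t x \<notin> \<Omega>} = 0" if w: "w \<noteq> 0" for w t
    proof (rule ccontr)
      assume n: "\<not> ?thesis"
      have "riesz_top \<beta> \<Omega> < riesz_top \<beta> (polarize_set w t \<Omega>)"
        by (rule riesz_top_polarize_less[OF \<beta> \<Omega> assms(7) w]) (use n in simp_all)
      also have "\<dots> \<le> riesz_top \<beta> (ball (0::'a) r)"
        using emeasure_polarize_set[OF \<Omega> w, of t] r
        by (intro riesz_top_le_ball[OF \<beta> sets_polarize_set[OF \<Omega>] bounded_polarize_set[OF assms(7) w]]) auto
      finally show False using eq \<Lambda> \<Lambda>b by simp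
    qed
    then obtain c \<rho> where "0 < \<rho>" "\<Omega> \<subseteq> ball c \<rho>" "negligible (ball c \<rho> - \<Omega>)"
      using ball_if_one_sided[OF assms(4,7,6)] by blast
    then have "almost_equal ((\<lambda>x. c + x) ` symm_ball \<Omega>) \<Omega>"
      unfolding r(2) using \<Omega> r by (intro almost_equal_ball) auto
    then show ?thesis by blast
  qed
  ultimately show ?thesis by blast
qed

end
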